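(* Let $f$ be a rational function. Suppose that for some good orbifold $\mathcal O$ on $\mathbb{CP}^1$ the conditions $\chi(f^*(\mathcal O))>0$ and $\nu(f^*(\mathcal O))\ne\nu(\mathcal O)$ hold. Then $f$ is decomposable, unless it is an indecomposable compositional left factor of $\theta_{\mathcal O}$.
   Context: Rational functions are non-constant, viewed as holomorphic maps $\mathbb{CP}^1\to\mathbb{CP}^1$; $\deg_z f$ denotes the local degree (multiplicity) of $f$ at $z$. A rational function is indecomposable if it cannot be represented as a composition of two rational functions of degree at least two; otherwise it is decomposable. A rational function $g$ is a compositional left factor of a rational function $F$ if $F=g\circ h$ for some rational function $h$. An orbifold $\mathcal O=(R,\nu)$ is a (connected) Riemann surface $R$ with a ramification function $\nu:R\to\mathbb N=\{1,2,\dots\}$ equal to $1$ except at isolated points; it is non-ramified if $\nu\equiv1$. For compact $R$ its Euler characteristic is $\chi(\mathcal O)=\chi(R)+\sum_{z\in R}\left(\frac1{\nu(z)}-1\right)$. Its signature $\nu(\mathcal O)$ is the multiset of values $\nu(z)$ over the points $z$ with $\nu(z)>1$. $\mathcal O$ is bad if $R=\mathbb{CP}^1$ and either exactly one point has $\nu>1$, or exactly two points $z_1,z_2$ have $\nu>1$ and $\nu(z_1)\ne\nu(z_2)$; otherwise it is good. For a holomorphic map $f:R'\to R$ between compact Riemann surfaces and an orbifold $\mathcal O=(R,\nu)$, the orbifold $f^*(\mathcal O)=(R',\nu')$ is defined by $\nu'(z)=\nu(f(z))/\gcd(\deg_z f,\nu(f(z)))$. If $\chi(f^*(\mathcal O))>0$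 for a rational function $f$, then $\chi(\mathcal O)>0$. For orbifolds $\mathcal O_1=(R_1,\nu_1)$, $\mathcal O_2=(R_2,\nu_2)$, a holomorphic branched covering map $f:R_1\to R_2$ is a covering map between orbifolds $f:\mathcal O_1\to\mathcal O_2$ if $\nu_2(f(z))=\nu_1(z)\deg_z f$ for all $z\in R_1$. A universal covering of $\mathcal O$ is a covering map between orbifolds $\theta_{\mathcal O}:\widetilde{\mathcal O}\to\mathcal O$ where $\widetilde{\mathcal O}$ is non-ramified with simply connected underlying surface $\widetilde R$. It exists and is unique up to a conformal isomorphism of $\widetilde R$ whenever $\mathcal O$ is good. If $\mathcal O$ is a good orbifold on $\mathbb{CP}^1$ with $\chi(\mathcal O)>0$, then $\widetilde R=\mathbb{CP}^1$ and $\theta_{\mathcal O}$ is a rational function, defined up to precomposition with a Möbius transformation. *)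

theory Defs
  imports
    "HOL-Complex_Analysis.Complex_Analysis"
    "HOL-Computational_Algebra.Computational_Algebra"
    "HOL-Library.Multiset"
begin

datatype cp1 = Fin complex | Infty


section \<open>Rational functions\<close>

text \<open>
  For coprime \<open>p\<close> and \<open>q\<close>, not both constant, this is the holomorphic self-map \<open>p/q\<close> of the sphere.
  At infinity, if the degree of \<open>p\<close> is at most that of \<open>q\<close>, the limit is the quotient of the
  coefficients in degree \<open>degree q\<close> (hence 0 if the degree of \<open>p\<close> is smaller).
\<close>

fun rat_map :: "complex poly \<Rightarrow> complex poly \<Rightarrow> cp1 \<Rightarrow> cp1" where
  "rat_map p q (Fin z) = (if poly q z = 0 then Infty else Fin (poly p z / poly q z))"
| "rat_map p q Infty =
     (if degree p > degree q then Infty else Fin (coeff p (degree q) / lead_coeff q))"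

definition rational_of_degree :: "nat \<Rightarrow> (cp1 \<Rightarrow> cp1) \<Rightarrow> bool" where
  "rational_of_degree n f \<longleftrightarrow>
     n \<ge> 1 \<and> (\<exists>p q. coprime p q \<and> max (degree p) (degree q) = n \<and> f = rat_map p q)"

definition rational_function :: "(cp1 \<Rightarrow> cp1) \<Rightarrow> bool" where
  "rational_function f \<longleftrightarrow> (\<exists>n. rational_of_degree n f)"

definition decomposable :: "(cp1 \<Rightarrow> cp1) \<Rightarrow> bool" where
  "decomposable f \<longleftrightarrow> rational_function f \<and>
     (\<exists>g h m n. m \<ge> 2 \<and> n \<ge> 2 \<and> rational_of_degree m g \<and> rational_of_degree n h \<and> f = g \<circ> h)"

definition indecomposable :: "(cp1 \<Rightarrow> cp1) \<Rightarrow> bool" where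
  "indecomposable f \<longleftrightarrow> rational_function f \<and> \<not> decomposable f"

definition left_factor :: "(cp1 \<Rightarrow> cp1) \<Rightarrow> (cp1 \<Rightarrow> cp1) \<Rightarrow> bool" where
  "left_factor g F \<longleftrightarrow> rational_function g \<and> rational_function F \<and>
     (\<exists>h. rational_function h \<and> F = g \<circ> h)"


section \<open>Local degree\<close>

text \<open>
  \<open>param a\<close> parametrizes a neighbourhood of \<open>a\<close>, sending 0 to \<open>a\<close>; \<open>coord a\<close> is the inverse local
  coordinate, vanishing at \<open>a\<close>. The values \<open>coord (Fin b) Infty\<close> and \<open>coord Infty (Fin 0)\<close> are
  junk, taken only away from the point at which the coordinate is centred. The local degree is the
  order of vanishing at 0 of the map in these coordinates.
\<close>

fun param :: "cp1 \<Rightarrow> complex \<Rightarrow> cp1" where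
  "param (Fin a) w = Fin (a + w)"
| "param Infty w = (if w = 0 then Infty else Fin (1 / w))"

fun coord :: "cp1 \<Rightarrow> cp1 \<Rightarrow> complex" where
  "coord (Fin b) (Fin w) = w - b"
| "coord (Fin b) Infty = 0"
| "coord Infty (Fin w) = 1 / w"
| "coord Infty Infty = 0"

definition local_degree :: "(cp1 \<Rightarrow> cp1) \<Rightarrow> cp1 \<Rightarrow> nat" where
  "local_degree f z = nat (zorder (\<lambda>w. coord (f z) (f (param z w))) 0)"


section \<open>Orbifolds on the sphere\<close>

text \<open>
  An orbifold on the sphere is given by its ramification function. By compactness, the points where
  it differs from 1 are isolated, i.e. form a closed discrete set, iff there are finitely many.
\<close>

definition orbifold :: "(cp1 \<Rightarrow> nat) \<Rightarrow> bool" where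
  "orbifold \<nu> \<longleftrightarrow> (\<forall>z. \<nu> z \<ge> 1) \<and> finite {z. \<nu> z \<noteq> 1}"

definition non_ramified :: "(cp1 \<Rightarrow> nat) \<Rightarrow> bool" where
  "non_ramified \<nu> \<longleftrightarrow> (\<forall>z. \<nu> z = 1)"

definition euler_char :: "(cp1 \<Rightarrow> nat) \<Rightarrow> real" where
  "euler_char \<nu> = 2 + (\<Sum>z | \<nu> z \<noteq> 1. (1 / real (\<nu> z) - 1))"

definition signature :: "(cp1 \<Rightarrow> nat) \<Rightarrow> nat multiset" where
  "signature \<nu> = image_mset \<nu> (mset_set {z. \<nu> z > 1})"

definition bad_orbifold :: "(cp1 \<Rightarrow> nat) \<Rightarrow> bool" where
  "bad_orbifold \<nu> \<longleftrightarrow> orbifold \<nu> \<and>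
     ((\<exists>z. {z. \<nu> z > 1} = {z}) \<or>
      (\<exists>z1 z2. z1 \<noteq> z2 \<and> {z. \<nu> z > 1} = {z1, z2} \<and> \<nu> z1 \<noteq> \<nu> z2))"

definition good_orbifold :: "(cp1 \<Rightarrow> nat) \<Rightarrow> bool" where
  "good_orbifold \<nu> \<longleftrightarrow> orbifold \<nu> \<and> \<not> bad_orbifold \<nu>"

definition pullback :: "(cp1 \<Rightarrow> cp1) \<Rightarrow> (cp1 \<Rightarrow> nat) \<Rightarrow> cp1 \<Rightarrow> nat" where
  "pullback f \<nu> z = \<nu> (f z) div gcd (local_degree f z) (\<nu> (f z))"


section \<open>Universal coverings\<close>

definition orbifold_covering :: "(cp1 \<Rightarrow> cp1) \<Rightarrow> (cp1 \<Rightarrow> nat) \<Rightarrow> (cp1 \<Rightarrow> nat) \<Rightarrow> bool" where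
  "orbifold_covering f \<nu>1 \<nu>2 \<longleftrightarrow> rational_function f \<and> orbifold \<nu>1 \<and> orbifold \<nu>2 \<and>
     (\<forall>z. \<nu>2 (f z) = \<nu>1 z * local_degree f z)"

text \<open>
  Universal coverings whose covering surface is the sphere, which is simply connected. For a good
  orbifold on the sphere these are all its universal coverings if the Euler characteristic is
  positive, and there are none otherwise.
\<close>

definition universal_covering :: "(cp1 \<Rightarrow> cp1) \<Rightarrow> (cp1 \<Rightarrow> nat) \<Rightarrow> bool" where
  "universal_covering \<theta> \<nu> \<longleftrightarrow> (\<exists>\<nu>'. non_ramified \<nu>' \<and> orbifold_covering \<theta> \<nu>' \<nu>)"

text \<open>
  A universal covering is unique only up to precomposition with a Moebius transformation, which does
  not affect its compositional left factors.
\<close>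

definition theta :: "(cp1 \<Rightarrow> nat) \<Rightarrow> cp1 \<Rightarrow> cp1" where
  "theta \<nu> = (SOME \<theta>. universal_covering \<theta> \<nu>)"

end

(*
  Let \<theta> = \<theta>_O have degree N = 2/\<chi>(O), and let O' be a good orbifold with \<chi>(O') > \<chi>(O) whose ramification
  function is divisible by that of f^*(O) at every point. Then f \<circ> \<theta>_O' ramifies enough over O to lift through
  \<theta>, because the sphere is simply connected: \<theta> \<circ> F = f \<circ> \<theta>_O'. The lift F is equivariant with respect to
  a homomorphism from the deck group of \<theta>_O', of order 2/\<chi>(O') < N, to the deck group of \<theta>. Its image
  H is a proper subgroup, so \<theta> = g \<circ> q for the quotient map q by H, where deg g = N/|H| > 1, and
  equivariance gives f = g \<circ> h. Hence f is decomposable unless h is a Moebius transformation, in which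
  case f is a left factor of \<theta>.

  One takes O' = f^*(O) if this has three ramified points, and otherwise the orbifold in which two points
  have the least common multiple of the ramification indices of f^*(O); f^*(O) itself may be bad at this stage.
  That \<chi>(O') > \<chi>(O) unless the signatures agree follows from the classification of spherical
  orbifolds and the congruences modulo \<nu>(z) satisfied by the sums of local degrees over z.
*)
theory Submission
  imports Defs
begin

section \<open>Holomorphic maps into the sphere\<close>

text \<open>Ramified points rule out plain covering theory. Near any point of the source all local
  lifts through \<theta> are listed and counted, which replaces even covering; they are then
  continued over growing discs and matched at \<open>Infty\<close>. Lifts and quotient maps arise
  only as holomorphic maps: Liouville's theorem makes them rational, and fibres counted with
  multiplicity give their degrees. Since \<open>theta\<close> is a choice, a universal covering has
  to exist; it is built as a tower of explicit polynomial maps starting from z^n. The formula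
  2/\<chi> is Riemann-Hurwitz for an unramified source, so comparing Euler characteristics is
  comparing degrees. The strict inequality for \<chi> matters: for equal degrees the group H could
  be the whole deck group and g a Moebius transformation. The delicate target has signature (2,2,m)
  with m unbounded, since the pullback could have signature (2,3,a). Divisibility makes m a multiple
  of 6, 12 or 30; the multiple itself would give equal Euler characteristics and is excluded by
  parity.\<close>

text \<open>
  Maps out of plane domains are expanded in the coordinate centred at their own value.
  A map \<open>F\<close> of the sphere is handled through its restrictions \<open>\<lambda>w. F (param z w)\<close>.
\<close>

definition hol_at :: "(complex \<Rightarrow> cp1) \<Rightarrow> complex \<Rightarrow> bool" where
  "hol_at \<phi> w0 \<longleftrightarrow> (\<exists>g. g analytic_on {w0} \<and> g w0 = 0 \<and> (\<forall>\<^sub>F w in nhds w0. \<phi> w = param (\<phi> w0) (g w)))"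

definition mult_at :: "(complex \<Rightarrow> cp1) \<Rightarrow> complex \<Rightarrow> nat \<Rightarrow> bool" where
  "mult_at \<phi> w0 m \<longleftrightarrow> m \<ge> 1 \<and> (\<exists>u. u analytic_on {w0} \<and> u w0 \<noteq> 0 \<and>
     (\<forall>\<^sub>F w in nhds w0. \<phi> w = param (\<phi> w0) ((w - w0) ^ m * u w)))"

definition holo :: "(cp1 \<Rightarrow> cp1) \<Rightarrow> bool" where
  "holo F \<longleftrightarrow> (\<forall>z. hol_at (\<lambda>w. F (param z w)) 0)"

lemma param_zero [simp]: "param z 0 = z"
  by (cases z) auto

lemma param_inject [simp]: "param a v = param a w \<longleftrightarrow> v = w"
  by (cases a) auto

lemma coord_param [simp]: "coord a (param a w) = w"
  by (cases a) auto

text \<open>\<open>cp1\<close> carries no topology; this is the Hausdorff property of the sphere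
  expressed through charts. Between a finite point and \<open>Infty\<close> the radius 1/(|a| + 2)
  works: it forces |1/w| > |a| + 2 while |a + v| < |a| + 1.\<close>

lemma param_separate:
  assumes "a \<noteq> b"
  obtains e where "e > 0" "\<And>v w. norm v < e \<Longrightarrow> norm w < e \<Longrightarrow> param a v \<noteq> param b w"
proof -
  have fi: "\<exists>e>0. \<forall>v w. norm v < e \<longrightarrow> norm w < e \<longrightarrow> param (Fin a) v \<noteq> param Infty w" for a :: complex
  proof (intro exI conjI allI impI)
    show "0 < 1 / (norm a + 2)" by (simp add: add_nonneg_pos)
    fix v w :: complex assume v: "norm v < 1 / (norm a + 2)" and w: "norm w < 1 / (norm a + 2)"
    have "a + v \<noteq> 1 / w" if "w \<noteq> 0"
    proof
      assume eq: "a + v = 1 / w"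
      have p: "norm a + 2 > 0" by (simp add: add_nonneg_pos)
      have "norm a + 2 < 1 / norm w"
        using w p that by (simp add: field_simps)
      also have "\<dots> = norm (a + v)" by (simp add: eq norm_divide)
      also have "\<dots> \<le> norm a + norm v" by (rule norm_triangle_ineq)
      also have "norm v < 1"
        using v p by (smt (verit) divide_le_eq_1 norm_ge_zero)
      finally show False by simp
    qed
    then show "param (Fin a) v \<noteq> param Infty w" by auto
  qed
  show thesis
  proof (cases a)
    case a: (Fin a')
    show ?thesis
    proof (cases b)
      case b: (Fin b')
      with a assms have ne: "a' \<noteq> b'" by simp
      show ?thesis
      proof (rule that)
        show "0 < norm (a' - b') / 2" using ne by simp
        fix v w :: complex assume v: "norm v < norm (a' - b') / 2" and w: "norm w < norm (a' - b') / 2"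
        have "a' + v \<noteq> b' + w"
        proof
          assume "a' + v = b' + w"
          then have "a' - b' = w - v" by (simp add: algebra_simps)
          then have "norm (a' - b') \<le> norm w + norm v" by (simp add: norm_triangle_ineq4)
          with v w show False by linarith
        qed
        then show "param a v \<noteq> param b w" using a b by simp
      qed
    next
      case Infty
      then show ?thesis using fi[of a'] a that by metis
    qed
  next
    case a: Infty
    then obtain b' where "b = Fin b'" using assms by (cases b) auto
    then show ?thesis using fi[of b'] a that by metis
  qed
qed

lemma eventually_compose_analytic:
  assumes "g analytic_on {u0}" and "\<forall>\<^sub>F w in nhds (g u0). P w"
  shows "\<forall>\<^sub>F u in nhds u0. P (g u)"
proof -
  have "isCont g u0" by (rule analytic_at_imp_isCont[OF assms(1)])
  then have "filterlim g (nhds (g u0)) (nhds u0)"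
    by (simp add: continuous_within tendsto_nhds_iff)
  then show ?thesis using assms(2) by (rule eventually_compose_filterlim[rotated])
qed

lemma hol_at_param: "hol_at (param a) v"
proof (cases a)
  case (Fin a')
  have "(\<lambda>w. w - v) analytic_on {v}" by (intro analytic_intros)
  then show ?thesis unfolding hol_at_def Fin
    by (intro exI[of _ "\<lambda>w. w - v"]) auto
next
  case Infty
  show ?thesis
  proof (cases "v = 0")
    case True
    then show ?thesis unfolding hol_at_def Infty
      by (intro exI[of _ "\<lambda>w. w"]) (auto intro: analytic_intros)
  next
    case False
    have "(\<lambda>w. 1 / w - 1 / v) analytic_on {v}" using False by (intro analytic_intros) auto
    moreover have "\<forall>\<^sub>F w in nhds v. w \<noteq> 0" using False by (simp add: t1_space_nhds)
    ultimately show ?thesis using False unfolding hol_at_def Infty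
      by (intro exI[of _ "\<lambda>w. 1 / w - 1 / v"]) (auto elim!: eventually_mono)
  qed
qed

lemma hol_at_Fin: "hol_at Fin v"
  using hol_at_param[of "Fin 0" v] by (simp add: hol_at_def)

lemma hol_at_const: "hol_at (\<lambda>_. c) w0"
  unfolding hol_at_def by (intro exI[of _ "\<lambda>_. 0"]) (auto intro: analytic_intros)

lemma hol_at_compose_analytic:
  assumes "hol_at \<phi> (g u0)" and g: "g analytic_on {u0}"
  shows "hol_at (\<lambda>u. \<phi> (g u)) u0"
proof -
  obtain h where h: "h analytic_on {g u0}" "h (g u0) = 0"
    and ev: "\<forall>\<^sub>F w in nhds (g u0). \<phi> w = param (\<phi> (g u0)) (h w)"
    using assms(1) unfolding hol_at_def by blast
  have "(h \<circ> g) analytic_on {u0}" using g h(1) by (intro analytic_on_compose) auto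
  then show ?thesis unfolding hol_at_def
    using eventually_compose_analytic[OF g ev] h(2)
    by (intro exI[of _ "h \<circ> g"]) auto
qed

lemma hol_at_param_compose: "g analytic_on {u0} \<Longrightarrow> hol_at (\<lambda>u. param a (g u)) u0"
  by (rule hol_at_compose_analytic[OF hol_at_param])

lemma hol_at_compose:
  assumes "hol_at \<phi> w0" "hol_at (\<lambda>w. F (param (\<phi> w0) w)) 0"
  shows "hol_at (\<lambda>w. F (\<phi> w)) w0"
proof -
  obtain g where g: "g analytic_on {w0}" "g w0 = 0"
    and evg: "\<forall>\<^sub>F w in nhds w0. \<phi> w = param (\<phi> w0) (g w)"
    using assms(1) unfolding hol_at_def by blast
  have "hol_at (\<lambda>w. F (param (\<phi> w0) (g w))) w0"
    using hol_at_compose_analytic[of "\<lambda>w. F (param (\<phi> w0) w)" g w0] assms(2) g by simp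
  then obtain k where k: "k analytic_on {w0}" "k w0 = 0"
    "\<forall>\<^sub>F w in nhds w0. F (param (\<phi> w0) (g w)) = param (F (param (\<phi> w0) (g w0))) (k w)"
    unfolding hol_at_def by blast
  have "\<forall>\<^sub>F w in nhds w0. F (\<phi> w) = param (F (\<phi> w0)) (k w)"
    using k(3) evg by eventually_elim (simp add: g(2))
  with k show ?thesis unfolding hol_at_def by blast
qed

lemma hol_at_cong:
  assumes "\<forall>\<^sub>F w in nhds w0. \<phi> w = \<psi> w"
  shows "hol_at \<phi> w0 \<longleftrightarrow> hol_at \<psi> w0"
proof -
  have e: "\<phi> w0 = \<psi> w0" using eventually_nhds_x_imp_x[OF assms] .
  have *: "(\<forall>\<^sub>F w in nhds w0. \<phi> w = param (\<phi> w0) (g w)) \<longleftrightarrow> (\<forall>\<^sub>F w in nhds w0. \<psi> w = param (\<psi> w0) (g w))" for g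
    unfolding e using assms by (intro eventually_subst) (auto elim: eventually_mono)
  show ?thesis unfolding hol_at_def by (simp only: *)
qed

lemma holo_hol_at: "holo F \<Longrightarrow> hol_at \<phi> w \<Longrightarrow> hol_at (\<lambda>w. F (\<phi> w)) w"
  by (rule hol_at_compose[of \<phi> w F]) (auto simp: holo_def)

lemma holo_compose: "holo F \<Longrightarrow> holo G \<Longrightarrow> holo (F \<circ> G)"
  using holo_hol_at[of F "\<lambda>w. G (param z w)" 0 for z] by (auto simp: holo_def)

lemma holo_id: "holo id"
  by (simp add: holo_def hol_at_param)

section \<open>Orders of vanishing and the identity theorem\<close>

lemma analytic_dichotomy:
  assumes "g analytic_on {w0}" "g w0 = 0"
  obtains "\<forall>\<^sub>F w in nhds w0. g w = 0"
  | m u where "m \<ge> (1::nat)" "u analytic_on {w0}" "u w0 \<noteq> 0" "\<forall>\<^sub>F w in nhds w0. g w = (w - w0) ^ m * u w"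
proof -
  obtain e where e: "e > 0" "g holomorphic_on ball w0 e"
    using assms(1) by (auto simp: analytic_at_ball)
  show thesis
  proof (cases "g constant_on ball w0 e")
    case True
    then have z: "g w = 0" if "w \<in> ball w0 e" for w
      using that assms(2) e(1) by (metis centre_in_ball constant_on_def)
    have "\<forall>\<^sub>F w in nhds w0. w \<in> ball w0 e"
      using e(1) by (intro eventually_nhds_in_open) auto
    then have "\<forall>\<^sub>F w in nhds w0. g w = 0" by eventually_elim (rule z)
    then show thesis by (rule that(1))
  next
    case False
    obtain u r n where u: "0 < n" "0 < r" "ball w0 r \<subseteq> ball w0 e" "u holomorphic_on ball w0 r"
      "\<And>w. w \<in> ball w0 r \<Longrightarrow> g w = (w - w0)^n * u w" "\<And>w. w \<in> ball w0 r \<Longrightarrow> u w \<noteq> 0"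
      by (rule holomorphic_factor_zero_nonconstant[OF e(2) open_ball _ _ assms(2) False])
        (use e(1) in auto)
    show thesis
    proof (rule that(2))
      show "n \<ge> 1" using u by simp
      show "u analytic_on {w0}" using u by (auto simp: analytic_at_ball)
      show "u w0 \<noteq> 0" using u by simp
      show "\<forall>\<^sub>F w in nhds w0. g w = (w - w0) ^ n * u w"
        using eventually_nhds_in_open[of "ball w0 r" w0] u(2,5) by (auto elim!: eventually_mono)
    qed
  qed
qed

lemma mult_at_imp_hol_at: "mult_at \<phi> w0 m \<Longrightarrow> hol_at \<phi> w0"
  unfolding mult_at_def hol_at_def
  by (elim conjE exE) (rule exI[of _ "\<lambda>w. (w - w0) ^ m * u w" for u],
      auto intro!: analytic_intros)

lemma hol_at_cases:
  assumes "hol_at \<phi> w0"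
  obtains "\<forall>\<^sub>F w in nhds w0. \<phi> w = \<phi> w0" | m where "mult_at \<phi> w0 m"
proof -
  obtain g where g: "g analytic_on {w0}" "g w0 = 0"
    "\<forall>\<^sub>F w in nhds w0. \<phi> w = param (\<phi> w0) (g w)"
    using assms unfolding hol_at_def by blast
  show thesis
  proof (rule analytic_dichotomy[OF g(1,2)])
    assume "\<forall>\<^sub>F w in nhds w0. g w = 0"
    then have "\<forall>\<^sub>F w in nhds w0. \<phi> w = \<phi> w0"
      using g(3) by eventually_elim simp
    then show thesis by (rule that(1))
  next
    fix m u assume u: "m \<ge> (1::nat)" "u analytic_on {w0}" "u w0 \<noteq> 0" "\<forall>\<^sub>F w in nhds w0. g w = (w - w0) ^ m * u w"
    have "\<forall>\<^sub>F w in nhds w0. \<phi> w = param (\<phi> w0) ((w - w0) ^ m * u w)"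
      using g(3) u(4) by eventually_elim simp
    with u show thesis by (intro that(2)[of m]) (auto simp: mult_at_def)
  qed
qed

lemma mult_at_compose:
  assumes "mult_at \<phi> w0 m" "mult_at (\<lambda>w. F (param (\<phi> w0) w)) 0 n"
  shows "mult_at (\<lambda>w. F (\<phi> w)) w0 (m * n)"
proof -
  obtain u where u: "m \<ge> 1" "u analytic_on {w0}" "u w0 \<noteq> 0"
    "\<forall>\<^sub>F w in nhds w0. \<phi> w = param (\<phi> w0) ((w - w0) ^ m * u w)"
    using assms(1) unfolding mult_at_def by blast
  obtain v where v: "n \<ge> 1" "v analytic_on {0}" "v 0 \<noteq> 0"
    "\<forall>\<^sub>F w in nhds 0. F (param (\<phi> w0) w) = param (F (\<phi> w0)) (w ^ n * v w)"
    using assms(2) unfolding mult_at_def by auto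
  define g where "g = (\<lambda>w. (w - w0) ^ m * u w)"
  have g: "g analytic_on {w0}" "g w0 = 0"
    using u by (auto simp: g_def intro!: analytic_intros)
  have ev: "\<forall>\<^sub>F w in nhds w0. F (param (\<phi> w0) (g w)) = param (F (\<phi> w0)) (g w ^ n * v (g w))"
    using eventually_compose_analytic[OF g(1), of "\<lambda>w. F (param (\<phi> w0) w) = param (F (\<phi> w0)) (w ^ n * v w)"]
      v(4) g(2) by simp
  have "\<forall>\<^sub>F w in nhds w0. F (\<phi> w) = param (F (\<phi> w0)) ((w - w0) ^ (m * n) * (u w ^ n * v (g w)))"
    using ev u(4) by eventually_elim (simp add: g_def power_mult power_mult_distrib mult_ac)
  moreover have "(\<lambda>w. u w ^ n * v (g w)) analytic_on {w0}"
  proof -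
    have "(v \<circ> g) analytic_on {w0}" using g v by (intro analytic_on_compose) auto
    then show ?thesis using u by (auto intro!: analytic_intros simp: o_def)
  qed
  moreover have "u w0 ^ n * v (g w0) \<noteq> 0" using u v g by simp
  moreover have "m * n \<ge> 1" using u v by simp
  ultimately show ?thesis unfolding mult_at_def by blast
qed

text \<open>The bridge from \<open>zorder\<close>, which defines \<open>local_degree\<close>, to the
  factored form in \<open>mult_at\<close>, where multiplicities visibly multiply under
  composition.\<close>

lemma local_degree_eqI:
  assumes "mult_at (\<lambda>w. F (param z w)) 0 m"
  shows "local_degree F z = m"
proof -
  obtain u where u: "m \<ge> 1" "u analytic_on {0}" "u 0 \<noteq> 0"
    "\<forall>\<^sub>F w in nhds 0. F (param z w) = param (F z) (w ^ m * u w)"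
    using assms unfolding mult_at_def by auto
  obtain e where e: "e > 0" "u holomorphic_on ball 0 e"
    using u(2) by (auto simp: analytic_at_ball)
  obtain S where S: "open S" "0 \<in> S" "\<And>w. w \<in> S \<Longrightarrow> F (param z w) = param (F z) (w ^ m * u w)"
    using u(4) unfolding eventually_nhds by blast
  have "zorder (\<lambda>w. coord (F z) (F (param z w))) 0 = int m"
  proof (rule zorder_eqI[where S = "S \<inter> ball 0 e" and g = u])
    show "open (S \<inter> ball 0 e)" "0 \<in> S \<inter> ball 0 e" using S e by auto
    show "u holomorphic_on S \<inter> ball 0 e" using e by (auto intro: holomorphic_on_subset)
    show "u 0 \<noteq> 0" by fact
    show "coord (F z) (F (param z w)) = u w * (w - 0) powi int m" if "w \<in> S \<inter> ball 0 e" for w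
      using that S(3)[of w] by simp
  qed
  then show ?thesis by (simp add: local_degree_def)
qed

text \<open>If the values at \<open>x\<close> agree, both maps are read in the same chart and the
  difference of their expansions vanishes identically or has an isolated zero. If they differ,
  disjoint charts keep the maps apart nearby.\<close>

lemma agree_dichotomy:
  assumes "hol_at \<phi>1 x" "hol_at \<phi>2 x"
  shows "(\<forall>\<^sub>F w in nhds x. \<phi>1 w = \<phi>2 w) \<or> (\<forall>\<^sub>F w in at x. \<phi>1 w \<noteq> \<phi>2 w)"
proof -
  obtain g where g: "g analytic_on {x}" "g x = 0"
    "\<forall>\<^sub>F w in nhds x. \<phi>1 w = param (\<phi>1 x) (g w)"
    using assms(1) unfolding hol_at_def by blast
  obtain h where h: "h analytic_on {x}" "h x = 0"
    "\<forall>\<^sub>F w in nhds x. \<phi>2 w = param (\<phi>2 x) (h w)"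
    using assms(2) unfolding hol_at_def by blast
  show ?thesis
  proof (cases "\<phi>1 x = \<phi>2 x")
    case True
    have "(\<lambda>w. g w - h w) analytic_on {x}" "g x - h x = 0"
      using g h by (auto intro!: analytic_intros)
    then show ?thesis
    proof (rule analytic_dichotomy)
      assume "\<forall>\<^sub>F w in nhds x. g w - h w = 0"
      then have "\<forall>\<^sub>F w in nhds x. \<phi>1 w = \<phi>2 w"
        using g(3) h(3) by eventually_elim (simp add: True)
      then show ?thesis ..
    next
      fix m u assume u: "m \<ge> (1::nat)" "u analytic_on {x}" "u x \<noteq> 0" "\<forall>\<^sub>F w in nhds x. g w - h w = (w - x) ^ m * u w"
      have "\<forall>\<^sub>F w in nhds x. u w \<noteq> 0"
        using eventually_compose_analytic[OF u(2), of "\<lambda>w. w \<noteq> 0"] u(3) by (simp add: t1_space_nhds)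
      then have "\<forall>\<^sub>F w in nhds x. w \<noteq> x \<longrightarrow> \<phi>1 w \<noteq> \<phi>2 w"
        using g(3) h(3) u(4)
        by eventually_elim (metis True eq_iff_diff_eq_0 mult_eq_0_iff param_inject power_not_zero)
      then show ?thesis by (simp add: eventually_at_filter)
    qed
  next
    case False
    obtain e where e: "e > 0" "\<And>v w. norm v < e \<Longrightarrow> norm w < e \<Longrightarrow> param (\<phi>1 x) v \<noteq> param (\<phi>2 x) w"
      using param_separate[OF False] by blast
    have ball: "\<forall>\<^sub>F w in nhds 0. norm (w::complex) < e"
      using e(1) by (metis eventually_nhds_metric dist_0_norm dist_commute)
    have "\<forall>\<^sub>F w in nhds x. norm (g w) < e" "\<forall>\<^sub>F w in nhds x. norm (h w) < e"
      using eventually_compose_analytic[OF g(1), of "\<lambda>w. norm w < e"]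
        eventually_compose_analytic[OF h(1), of "\<lambda>w. norm w < e"] g(2) h(2) ball by auto
    then have "\<forall>\<^sub>F w in nhds x. \<phi>1 w \<noteq> \<phi>2 w"
      using g(3) h(3) by eventually_elim (simp add: e)
    then show ?thesis by (simp add: eventually_nhds_conv_at)
  qed
qed

lemma eventually_at_contradiction:
  fixes x :: complex
  assumes "\<forall>\<^sub>F w in at x. P w" "\<forall>\<^sub>F w in at x. \<not> P w"
  shows False
proof -
  have "\<forall>\<^sub>F w in at x. False" using assms by eventually_elim simp
  then show ?thesis by simp
qed

text \<open>Both alternatives of \<open>agree_dichotomy\<close> are open conditions, so on a
  connected set one of them holds throughout. The hypothesis on \<open>u\<close> is the negation of
  the second alternative.\<close>

lemma hol_identity:
  assumes S: "open S" "connected S"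
    and hol: "\<And>x. x \<in> S \<Longrightarrow> hol_at \<phi>1 x" "\<And>x. x \<in> S \<Longrightarrow> hol_at \<phi>2 x"
    and u: "u \<in> S" "\<not> (\<forall>\<^sub>F w in at u. \<phi>1 w \<noteq> \<phi>2 w)"
    and x: "x \<in> S"
  shows "\<phi>1 x = \<phi>2 x"
proof -
  define A where "A = {x \<in> S. \<forall>\<^sub>F w in nhds x. \<phi>1 w = \<phi>2 w}"
  define B where "B = {x \<in> S. \<forall>\<^sub>F w in at x. \<phi>1 w \<noteq> \<phi>2 w}"
  have "open A"
  proof (subst open_subopen, intro ballI)
    fix x assume "x \<in> A"
    then obtain T where "open T" "x \<in> T" "\<forall>w\<in>T. \<phi>1 w = \<phi>2 w" "x \<in> S"
      unfolding A_def eventually_nhds by blast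
    then show "\<exists>T. open T \<and> x \<in> T \<and> T \<subseteq> A"
      by (intro exI[of _ "S \<inter> T"]) (use S in \<open>auto simp: A_def eventually_nhds\<close>)
  qed
  moreover have "open B"
  proof (subst open_subopen, intro ballI)
    fix x assume "x \<in> B"
    then obtain T where T: "open T" "x \<in> T" "\<forall>w\<in>T. w \<noteq> x \<longrightarrow> \<phi>1 w \<noteq> \<phi>2 w" "x \<in> S"
      unfolding B_def eventually_at_filter eventually_nhds by blast
    have "\<forall>\<^sub>F w in at y. \<phi>1 w \<noteq> \<phi>2 w" if "y \<in> T" for y
    proof (cases "y = x")
      case True
      then show ?thesis using \<open>x \<in> B\<close> by (simp add: B_def)
    next
      case False
      then show ?thesis unfolding eventually_at_filter eventually_nhds
        using T(1,3) that by (intro exI[of _ "T - {x}"]) (auto intro: open_delete)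
    qed
    with T show "\<exists>T. open T \<and> x \<in> T \<and> T \<subseteq> B"
      by (intro exI[of _ "S \<inter> T"]) (use S in \<open>auto simp: B_def\<close>)
  qed
  moreover have "S \<subseteq> A \<union> B"
    using agree_dichotomy hol unfolding A_def B_def by blast
  moreover have "A \<inter> B \<inter> S = {}"
  proof -
    have False if "\<forall>\<^sub>F w in nhds y. \<phi>1 w = \<phi>2 w" "\<forall>\<^sub>F w in at y. \<phi>1 w \<noteq> \<phi>2 w" for y
    proof -
      have "\<forall>\<^sub>F w in at y. \<phi>1 w = \<phi>2 w" using that(1) by (simp add: eventually_nhds_conv_at)
      from eventually_at_contradiction[OF this that(2)] show False .
    qed
    then show ?thesis by (auto simp: A_def B_def)
  qed
  ultimately have "A \<inter> S = {} \<or> B \<inter> S = {}"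
    using connectedD[OF S(2)] by blast
  moreover have "u \<in> A" using u agree_dichotomy hol unfolding A_def by blast
  ultimately have "x \<in> A" using \<open>S \<subseteq> A \<union> B\<close> u x by blast
  then show ?thesis unfolding A_def using eventually_nhds_x_imp_x by blast
qed

lemma eventually_param_notin:
  assumes "finite T"
  shows "\<forall>\<^sub>F w in at v. param z w \<notin> T"
proof -
  have "finite (param z -` T)" using assms by (intro finite_vimageI) (auto simp: inj_on_def)
  then have "open (- (param z -` T - {v}))" by (intro open_Compl finite_imp_closed) auto
  then show ?thesis unfolding eventually_at_filter eventually_nhds by auto
qed

text \<open>Lets later arguments discard finitely many inconvenient points, typically
  \<open>Infty\<close>, poles and ramified points.\<close>

lemma holo_eqI:
  assumes "holo F" "holo G" "finite T" "\<And>z. z \<notin> T \<Longrightarrow> F z = G z"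
  shows "F = G"
proof
  fix z
  have h: "hol_at (\<lambda>w. F (param z w)) 0" "hol_at (\<lambda>w. G (param z w)) 0"
    using assms by (auto simp: holo_def)
  have "\<forall>\<^sub>F w in at 0. F (param z w) = G (param z w)"
    using eventually_param_notin[OF assms(3)] by eventually_elim (use assms in auto)
  then have "\<not> (\<forall>\<^sub>F w in at 0. F (param z w) \<noteq> G (param z w))"
    using eventually_at_contradiction by blast
  then have "\<forall>\<^sub>F w in nhds 0. F (param z w) = G (param z w)"
    using agree_dichotomy[OF h] by blast
  from eventually_nhds_x_imp_x[OF this] show "F z = G z" by simp
qed

section \<open>Roots and local normal forms\<close>

lemma analytic_nth_root:
  assumes "u analytic_on {w0}" "u w0 \<noteq> (0::complex)" "m \<ge> (1::nat)"
  obtains k where "k analytic_on {w0}" "k w0 \<noteq> 0" "\<forall>\<^sub>F w in nhds w0. k w ^ m = u w"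
proof
  \<comment> \<open>Dividing by \<open>u w0\<close> moves the argument of the second logarithm close
    to 1, away from the branch cut.\<close>
  let ?k = "\<lambda>w. exp (Ln (u w0) / of_nat m) * exp (Ln (u w / u w0) / of_nat m)"
  have "(\<lambda>w. u w / u w0) analytic_on {w0}" using assms by (intro analytic_intros) auto
  then have "(\<lambda>w. Ln (u w / u w0)) analytic_on {w0}"
    by (rule analytic_on_ln) (use assms in auto)
  then show "?k analytic_on {w0}" using assms by (intro analytic_intros) auto
  show "?k w0 \<noteq> 0" by simp
  have "\<forall>\<^sub>F w in nhds w0. u w \<noteq> 0"
    using eventually_compose_analytic[OF assms(1), of "\<lambda>w. w \<noteq> 0"] assms(2) by (simp add: t1_space_nhds)
  then show "\<forall>\<^sub>F w in nhds w0. ?k w ^ m = u w"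
  proof eventually_elim
    case (elim w)
    have "exp (a / of_nat m) ^ m = exp a" for a :: complex
      using assms(3) by (simp flip: exp_of_nat_mult)
    then show ?case using elim assms(2) by (simp add: power_mult_distrib)
  qed
qed

lemma analytic_local_inverse:
  assumes a: "\<alpha> analytic_on {0}" "\<alpha> 0 = 0" "deriv \<alpha> 0 \<noteq> (0::complex)"
  obtains \<beta> where "\<beta> analytic_on {0}" "\<beta> 0 = 0"
    "\<forall>\<^sub>F s in nhds 0. \<alpha> (\<beta> s) = s" "\<forall>\<^sub>F w in nhds 0. \<beta> (\<alpha> w) = w"
proof -
  obtain e where e: "e > 0" "\<alpha> holomorphic_on ball 0 e"
    using a(1) by (auto simp: analytic_at_ball)
  obtain r where r: "r > 0" "ball (0::complex) r \<subseteq> ball 0 e" "inj_on \<alpha> (ball 0 r)"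
    by (rule has_complex_derivative_locally_injective[OF e(2) centre_in_ball[THEN iffD2, OF e(1)] open_ball a(3)])
  have hr: "\<alpha> holomorphic_on ball 0 r" using e r holomorphic_on_subset by blast
  have "\<exists>\<beta>. \<beta> holomorphic_on (\<alpha> ` ball 0 r) \<and> (\<forall>z\<in>ball 0 r. \<beta> (\<alpha> z) = z)"
    by (rule holomorphic_has_inverse[OF hr open_ball r(3)]) auto
  then obtain \<beta> where b: "\<beta> holomorphic_on (\<alpha> ` ball 0 r)" "\<forall>z\<in>ball 0 r. \<beta> (\<alpha> z) = z"
    by blast
  have op: "open (\<alpha> ` ball 0 r)" by (rule open_mapping_thm3[OF hr open_ball r(3)])
  have "0 \<in> \<alpha> ` ball 0 r" using r a(2) by force
  show thesis
  proof (rule that[of \<beta>])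
    show "\<beta> analytic_on {0}" unfolding analytic_at using op b \<open>0 \<in> _\<close> by blast
    show "\<beta> 0 = 0" using b(2) a(2) r(1) by (metis centre_in_ball)
    show "\<forall>\<^sub>F s in nhds 0. \<alpha> (\<beta> s) = s"
      unfolding eventually_nhds using op \<open>0 \<in> _\<close> b(2) by auto
    show "\<forall>\<^sub>F w in nhds 0. \<beta> (\<alpha> w) = w"
      unfolding eventually_nhds using b(2) r(1) by (intro exI[of _ "ball 0 r"]) auto
  qed
qed

text \<open>An m-th root k of the unit factor turns \<alpha>(w) = w k(w) into a local coordinate in
  which \<phi> is the pure power s^m; \<beta> is the inverse coordinate change.\<close>

lemma mult_at_normal_form:
  assumes "mult_at \<phi> 0 m"
  obtains \<alpha> \<beta> where "\<alpha> analytic_on {0}" "\<alpha> 0 = 0" "\<beta> analytic_on {0}" "\<beta> 0 = 0"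
    "\<forall>\<^sub>F s in nhds 0. \<alpha> (\<beta> s) = s" "\<forall>\<^sub>F w in nhds 0. \<beta> (\<alpha> w) = w"
    "\<forall>\<^sub>F w in nhds 0. \<phi> w = param (\<phi> 0) (\<alpha> w ^ m)"
    "\<forall>\<^sub>F s in nhds 0. \<phi> (\<beta> s) = param (\<phi> 0) (s ^ m)"
proof -
  obtain u where u: "m \<ge> 1" "u analytic_on {0}" "u 0 \<noteq> 0"
    "\<forall>\<^sub>F w in nhds 0. \<phi> w = param (\<phi> 0) (w ^ m * u w)"
    using assms unfolding mult_at_def by auto
  obtain k where k: "k analytic_on {0}" "k 0 \<noteq> 0" "\<forall>\<^sub>F w in nhds 0. k w ^ m = u w"
    using analytic_nth_root[OF u(2,3,1)] by blast
  define \<alpha> where "\<alpha> = (\<lambda>w. w * k w)"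
  have a: "\<alpha> analytic_on {0}" unfolding \<alpha>_def using k by (intro analytic_intros)
  have a0: "\<alpha> 0 = 0" by (simp add: \<alpha>_def)
  have "(k has_field_derivative deriv k 0) (at 0)"
    using k(1) by (simp add: analytic_on_imp_differentiable_at DERIV_deriv_iff_field_differentiable)
  then have "(\<alpha> has_field_derivative k 0) (at 0)"
    unfolding \<alpha>_def by (auto intro!: derivative_eq_intros)
  then have "deriv \<alpha> 0 \<noteq> 0" using k(2) DERIV_imp_deriv by metis
  then obtain \<beta> where b: "\<beta> analytic_on {0}" "\<beta> 0 = 0"
    "\<forall>\<^sub>F s in nhds 0. \<alpha> (\<beta> s) = s" "\<forall>\<^sub>F w in nhds 0. \<beta> (\<alpha> w) = w"
    using analytic_local_inverse[OF a a0] by blast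
  have 1: "\<forall>\<^sub>F w in nhds 0. \<phi> w = param (\<phi> 0) (\<alpha> w ^ m)"
    using u(4) k(3) by eventually_elim (simp add: \<alpha>_def power_mult_distrib)
  have "\<forall>\<^sub>F s in nhds 0. \<phi> (\<beta> s) = param (\<phi> 0) (\<alpha> (\<beta> s) ^ m)"
    using eventually_compose_analytic[OF b(1), of "\<lambda>w. \<phi> w = param (\<phi> 0) (\<alpha> w ^ m)"] 1 b(2) by simp
  then have 2: "\<forall>\<^sub>F s in nhds 0. \<phi> (\<beta> s) = param (\<phi> 0) (s ^ m)"
    using b(3) by eventually_elim simp
  show thesis by (rule that[OF a a0 b 1 2])
qed

section \<open>Local degrees of rational functions\<close>

text \<open>Writing P = (x - a)^n r, the derivative of the power contributes n r Q (x - a)^(n-1),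
  and all other terms carry one more factor x - a. In characteristic zero the cofactor
  \<open>s\<close> therefore does not vanish at \<open>a\<close>.\<close>

lemma order_wronskian:
  fixes P Q :: "complex poly"
  assumes "P \<noteq> 0" "poly P a = 0" "poly Q a \<noteq> 0"
  shows "pderiv P * Q - P * pderiv Q \<noteq> 0" "order a (pderiv P * Q - P * pderiv Q) = order a P - 1"
proof -
  define n where "n = order a P"
  have n: "n \<ge> 1" using assms order_root[of P a] by (simp add: n_def)
  obtain r where r: "P = [:-a, 1:] ^ n * r" "\<not> [:-a, 1:] dvd r"
    using order_decomp[OF assms(1), of a] unfolding n_def by blast
  define s where "s = smult (of_nat n) (r * Q) + [:-a, 1:] * (pderiv r * Q - r * pderiv Q)"
  have ra: "poly r a \<noteq> 0" using r(2) by (simp add: poly_eq_0_iff_dvd)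
  have lin: "pderiv [:-a, 1:] = 1" by (simp add: pderiv_pCons)
  obtain k where k: "n = Suc k" using n by (cases n) auto
  have dP: "pderiv P = [:-a, 1:] ^ n * pderiv r + smult (of_nat n) ([:-a, 1:] ^ k * r)"
    unfolding r(1) k pderiv_mult pderiv_power_Suc lin by (simp add: mult.commute)
  define L where "L = [:-a, 1:]"
  have eq: "pderiv P * Q - P * pderiv Q = [:-a, 1:] ^ k * s"
    unfolding dP unfolding r(1) s_def k unfolding L_def[symmetric]
    by (simp add: algebra_simps del: of_nat_Suc)
  have sa: "poly s a \<noteq> 0" using ra assms(3) n by (simp add: s_def)
  then have "s \<noteq> 0" by auto
  then show nz: "pderiv P * Q - P * pderiv Q \<noteq> 0" unfolding eq by simp
  have "order a ([:-a, 1:] ^ k * s) = k"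
    using nz sa unfolding eq by (subst order_mult) (auto simp: order_power_n_n order_0I)
  then show "order a (pderiv P * Q - P * pderiv Q) = order a P - 1"
    unfolding eq n_def[symmetric] k by simp
qed

text \<open>The top coefficient is (deg P - deg Q) times the product of the leading coefficients,
  nonzero because the degrees differ. Constant P is treated apart, since \<open>degree P - 1\<close>
  is truncated there.\<close>

lemma degree_wronskian:
  fixes P Q :: "complex poly"
  assumes "P \<noteq> 0" "degree P < degree Q"
  shows "degree (pderiv P * Q - P * pderiv Q) = degree P + degree Q - 1"
proof (rule antisym)
  let ?V = "pderiv P * Q - P * pderiv Q" and ?n = "degree P + degree Q - 1"
  have dQ: "degree (pderiv Q) = degree Q - 1" by (rule degree_pderiv)
  have dP: "degree (pderiv P) = degree P - 1" by (rule degree_pderiv)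
  have Q0: "Q \<noteq> 0" using assms by auto
  have c2: "coeff (P * pderiv Q) ?n = lead_coeff P * (of_nat (degree Q) * lead_coeff Q)"
  proof -
    have "coeff (P * pderiv Q) (degree P + degree (pderiv Q)) = lead_coeff P * lead_coeff (pderiv Q)"
      by (rule coeff_mult_degree_sum)
    moreover have "degree P + degree (pderiv Q) = ?n" using assms dQ by simp
    moreover have "lead_coeff (pderiv Q) = of_nat (degree Q) * lead_coeff Q"
      using assms by (simp add: dQ coeff_pderiv)
    ultimately show ?thesis by simp
  qed
  have c1: "coeff (pderiv P * Q) ?n = of_nat (degree P) * lead_coeff P * lead_coeff Q"
  proof (cases "degree P = 0")
    case True
    then have "pderiv P = 0" by (simp add: pderiv_eq_0_iff)
    then show ?thesis using True by simp
  next
    case False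
    have "coeff (pderiv P * Q) (degree (pderiv P) + degree Q) = lead_coeff (pderiv P) * lead_coeff Q"
      by (rule coeff_mult_degree_sum)
    moreover have "degree (pderiv P) + degree Q = ?n" using False dP by simp
    moreover have "lead_coeff (pderiv P) = of_nat (degree P) * lead_coeff P"
      using False by (simp add: dP coeff_pderiv)
    ultimately show ?thesis by simp
  qed
  have "coeff ?V ?n = (of_nat (degree P) - of_nat (degree Q)) * (lead_coeff P * lead_coeff Q)"
    by (simp only: coeff_diff c1 c2) (simp add: algebra_simps)
  then have "coeff ?V ?n \<noteq> 0" using assms Q0 by simp
  then show "?n \<le> degree ?V" by (rule le_degree)
  have "degree (pderiv P * Q) \<le> ?n"
  proof (cases "degree P = 0")
    case True
    then have "pderiv P = 0" by (simp add: pderiv_eq_0_iff)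
    then show ?thesis by simp
  next
    case False
    then show ?thesis using degree_mult_le[of "pderiv P" Q] dP by simp
  qed
  moreover have "degree (P * pderiv Q) \<le> ?n"
    using degree_mult_le[of P "pderiv Q"] dQ assms by simp
  ultimately show "degree ?V \<le> ?n" by (rule degree_diff_le)
qed

lemma sum_order_complex:
  fixes P :: "complex poly"
  assumes "P \<noteq> 0"
  shows "(\<Sum>a | poly P a = 0. order a P) = degree P"
proof -
  have "degree P = size (proots P)" by (simp add: size_proots_complex)
  also have "\<dots> = (\<Sum>a\<in>set_mset (proots P). count (proots P) a)"
    by (simp add: size_multiset_overloaded_eq)
  also have "\<dots> = (\<Sum>a | poly P a = 0. order a P)"
    using assms by (intro sum.cong) auto
  finally show ?thesis ..
qed

section \<open>Fibres and ramification of a reduced fraction\<close>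

locale coprime_fraction =
  fixes p q :: "complex poly"
  assumes coprime: "coprime p q" and nonconst: "max (degree p) (degree q) \<ge> 1"
begin

definition "d = max (degree p) (degree q)"

abbreviation "f \<equiv> rat_map p q"

text \<open>Its roots with multiplicity are the finite part of the fibre over c; the amount by which
  its degree falls short of d is the multiplicity of \<open>Infty\<close> in that fibre.\<close>

definition fibre_poly :: "cp1 \<Rightarrow> complex poly" where
  "fibre_poly c = (case c of Fin b \<Rightarrow> p - smult b q | Infty \<Rightarrow> q)"

text \<open>The denominator that goes with \<open>fibre_poly\<close>: their quotient is the map in
  the coordinate centred at c, namely p/q - b for \<open>Fin b\<close> and q/p for
  \<open>Infty\<close>.\<close>

definition fibre_partner :: "cp1 \<Rightarrow> complex poly" where
  "fibre_partner c = (case c of Fin b \<Rightarrow> q | Infty \<Rightarrow> p)"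

lemma no_common_root: "poly p x \<noteq> 0 \<or> poly q x \<noteq> 0"
  using coprime_poly_0[OF coprime] by auto

lemma fibre_poly_nonzero: "fibre_poly c \<noteq> 0"
proof
  assume 0: "fibre_poly c = 0"
  show False
  proof (cases c)
    case (Fin b)
    then have "p = smult b q" using 0 by (simp add: fibre_poly_def)
    then have "q dvd p" by (simp add: dvd_smult)
    then have "is_unit q" using coprime by (metis coprime_commute coprime_absorb_left)
    then have "degree q = 0" by (cases "q = 0") (auto simp: is_unit_iff_degree)
    then show False using nonconst \<open>p = smult b q\<close> by (simp split: if_splits)
  next
    case Infty
    then have "q = 0" using 0 by (simp add: fibre_poly_def)
    then have "is_unit p" using coprime by simp
    then have "degree p = 0" by (cases "p = 0") (auto simp: is_unit_iff_degree)
    then show False using nonconst \<open>q = 0\<close> by simp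
  qed
qed

lemma map_Fin_eq_iff: "f (Fin a) = c \<longleftrightarrow> poly (fibre_poly c) a = 0"
  using no_common_root[of a] by (cases c) (auto simp: fibre_poly_def field_simps)

lemma map_Infty_eq_iff: "f Infty = c \<longleftrightarrow> degree (fibre_poly c) < d"
proof (cases c)
  case (Fin b)
  have le: "degree (p - smult b q) \<le> d"
    unfolding d_def by (intro degree_diff_le) (auto simp: degree_smult_le le_max_iff_disj intro: le_trans)
  have lt: "degree (p - smult b q) < d \<longleftrightarrow> coeff (p - smult b q) d = 0"
  proof
    assume "coeff (p - smult b q) d = 0"
    moreover have "p - smult b q \<noteq> 0" using fibre_poly_nonzero[of c] Fin by (simp add: fibre_poly_def)
    ultimately have "degree (p - smult b q) \<noteq> d" by (metis leading_coeff_0_iff)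
    then show "degree (p - smult b q) < d" using le by simp
  qed (rule coeff_eq_0)
  show ?thesis
  proof (cases "degree p > degree q")
    case True
    then have "coeff (p - smult b q) d \<noteq> 0"
      using leading_coeff_0_iff[of p] by (auto simp: d_def coeff_eq_0)
    then show ?thesis using True lt Fin by (auto simp: fibre_poly_def)
  next
    case False
    then have "d = degree q" "q \<noteq> 0" using nonconst by (auto simp: d_def)
    then show ?thesis using False lt Fin by (auto simp: fibre_poly_def field_simps)
  qed
next
  case Infty
  then show ?thesis by (auto simp: fibre_poly_def d_def)
qed

lemma poly_plus_analytic: "(\<lambda>w. poly r (a + w)) analytic_on {x}" for r :: "complex poly"
  unfolding poly_altdef by (intro analytic_intros)

lemma poly_plus_nonzero:
  fixes r :: "complex poly"
  assumes "poly r a \<noteq> 0"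
  shows "\<forall>\<^sub>F w in nhds 0. poly r (a + w) \<noteq> 0"
  using eventually_compose_analytic[OF poly_plus_analytic[of r a 0], of "\<lambda>w. w \<noteq> 0"] assms
  by (simp add: t1_space_nhds)

lemma mult_at_Fin: "mult_at (\<lambda>w. f (param (Fin a) w)) 0 (order a (fibre_poly (f (Fin a))))"
proof -
  define c P n where "c = f (Fin a)" and "P = fibre_poly c" and "n = order a P"
  have P: "P \<noteq> 0" by (simp add: P_def fibre_poly_nonzero)
  have root: "poly P a = 0" using map_Fin_eq_iff[of a c] by (simp add: c_def P_def)
  have n: "n \<ge> 1" using root P by (simp add: n_def order_root)
  obtain r where r: "P = [:-a, 1:] ^ n * r" "\<not> [:-a, 1:] dvd r"
    using order_decomp[OF P, of a] unfolding n_def by blast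
  have ra: "poly r a \<noteq> 0" using r(2) by (simp add: poly_eq_0_iff_dvd)
  have Pw: "poly P (a + w) = w ^ n * poly r (a + w)" for w by (simp add: r(1) poly_power)
  define Q where "Q = fibre_partner c"
  have Qa: "poly Q a \<noteq> 0"
    using no_common_root[of a] root by (cases c) (auto simp: Q_def P_def fibre_poly_def fibre_partner_def)
  define u where "u = (\<lambda>w. poly r (a + w) / poly Q (a + w))"
  have "u analytic_on {0}" unfolding u_def using Qa by (intro analytic_intros poly_plus_analytic) auto
  moreover have "u 0 \<noteq> 0" using ra Qa by (simp add: u_def)
  moreover have "\<forall>\<^sub>F w in nhds 0. f (param (Fin a) w) = param c (w ^ n * u w)"
    using poly_plus_nonzero[OF Qa] poly_plus_nonzero[OF ra]
  proof eventually_elim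
    case (elim w)
    show ?case
    proof (cases c)
      case (Fin b)
      then have "poly p (a + w) = w ^ n * poly r (a + w) + b * poly Q (a + w)" "Q = q"
        using Pw[of w] by (auto simp: P_def Q_def fibre_poly_def fibre_partner_def algebra_simps)
      then show ?thesis using elim Fin by (simp add: u_def field_simps)
    next
      case Infty
      then have "poly q (a + w) = w ^ n * poly r (a + w)" "Q = p"
        using Pw[of w] by (auto simp: P_def Q_def fibre_poly_def fibre_partner_def)
      then show ?thesis using elim Infty n by (auto simp: u_def field_simps)
    qed
  qed
  ultimately have "mult_at (\<lambda>w. f (param z w)) 0 n"
    if "f z = c" "z = Fin a" for z
    using n that unfolding mult_at_def by (intro conjI exI[of _ u]) auto
  then show ?thesis by (simp only: c_def P_def n_def)
qed

text \<open>Substituting 1/w turns both polynomials into their reflections, which do not vanish at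
  0. The partner has full degree d, so the quotient of the two acquires the factor w^(d - deg
  P).\<close>

lemma mult_at_Infty: "mult_at (\<lambda>w. f (param Infty w)) 0 (d - degree (fibre_poly (f Infty)))"
proof -
  define c P Q n where "c = f Infty" and "P = fibre_poly c" and "Q = fibre_partner c" and "n = d - degree P"
  have P: "P \<noteq> 0" by (simp add: P_def fibre_poly_nonzero)
  have lt: "degree P < d" using map_Infty_eq_iff[of c] by (simp add: c_def P_def)
  have n: "n \<ge> 1" using lt by (simp add: n_def)
  have dQ: "degree Q = d"
    using lt by (auto simp: c_def P_def Q_def fibre_poly_def fibre_partner_def d_def split: if_splits)
  then have Q0: "Q \<noteq> 0" using lt by auto
  define u where "u = (\<lambda>w. poly (reflect_poly P) (0 + w) / poly (reflect_poly Q) (0 + w))"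
  have rP: "poly (reflect_poly P) 0 \<noteq> 0" and rQ: "poly (reflect_poly Q) 0 \<noteq> 0"
    using P Q0 by simp_all
  have "u analytic_on {0}" unfolding u_def using rQ by (intro analytic_intros poly_plus_analytic) auto
  moreover have "u 0 \<noteq> 0" using rP rQ by (simp add: u_def)
  moreover have "\<forall>\<^sub>F w in nhds 0. f (param Infty w) = param c (w ^ n * u w)"
    using poly_plus_nonzero[OF rP] poly_plus_nonzero[OF rQ]
  proof eventually_elim
    case (elim w)
    show ?case
    proof (cases "w = 0")
      case True
      then show ?thesis using n by (simp add: c_def)
    next
      case False
      have ri: "poly R (1 / w) * w ^ degree R = poly (reflect_poly R) w" for R
        using poly_reflect_poly_nz[OF False, of R] by (simp add: inverse_eq_divide mult.commute)
      have PQ: "poly P (1 / w) = poly Q (1 / w) * (w ^ n * u w)" and "poly Q (1 / w) \<noteq> 0" "u w \<noteq> 0"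
      proof -
        have "w ^ d = w ^ degree P * w ^ n" using lt by (simp add: n_def flip: power_add)
        then show "poly P (1 / w) = poly Q (1 / w) * (w ^ n * u w)"
        proof -
          have "poly Q (1 / w) * (w ^ n * u w) * w ^ degree P = (poly Q (1 / w) * w ^ d) * u w"
            using \<open>w ^ d = w ^ degree P * w ^ n\<close> by simp
          also have "\<dots> = poly (reflect_poly P) w"
            using ri[of Q] elim dQ by (simp add: u_def)
          also have "\<dots> = poly P (1 / w) * w ^ degree P" using ri[of P] by simp
          finally show ?thesis using False by simp
        qed
        show "poly Q (1 / w) \<noteq> 0" using ri[of Q] elim by auto
        show "u w \<noteq> 0" using elim by (simp add: u_def)
      qed
      show ?thesis
      proof (cases c)
        case (Fin b)
        then show ?thesis using PQ \<open>poly Q (1 / w) \<noteq> 0\<close> False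
          by (simp add: P_def Q_def fibre_poly_def fibre_partner_def field_simps)
      next
        case Infty
        then show ?thesis using PQ \<open>poly Q (1 / w) \<noteq> 0\<close> \<open>u w \<noteq> 0\<close> False
          by (simp add: P_def Q_def fibre_poly_def fibre_partner_def field_simps)
      qed
    qed
  qed
  ultimately have "mult_at (\<lambda>w. f (param z w)) 0 n"
    if "f z = c" "z = Infty" for z
    using n that unfolding mult_at_def by (intro conjI exI[of _ u]) auto
  then show ?thesis by (simp only: c_def P_def n_def)
qed

lemma local_degree_Fin: "local_degree f (Fin a) = order a (fibre_poly (f (Fin a)))"
  by (rule local_degree_eqI) (rule mult_at_Fin)

lemma local_degree_Infty: "local_degree f Infty = d - degree (fibre_poly (f Infty))"
  by (rule local_degree_eqI) (rule mult_at_Infty)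

lemma mult_at_map: "mult_at (\<lambda>w. f (param z w)) 0 (local_degree f z)"
  by (cases z) (simp_all only: local_degree_Fin local_degree_Infty mult_at_Fin mult_at_Infty)

lemma fibre: "{x. f x = c} = Fin ` {a. poly (fibre_poly c) a = 0} \<union> (if degree (fibre_poly c) < d then {Infty} else {})"
proof (rule set_eqI)
  fix x show "x \<in> {x. f x = c} \<longleftrightarrow> x \<in> Fin ` {a. poly (fibre_poly c) a = 0} \<union> (if degree (fibre_poly c) < d then {Infty} else {})"
    using map_Fin_eq_iff[of _ c] map_Infty_eq_iff[of c] by (cases x) auto
qed

lemma finite_fibre: "finite {x. f x = c}"
  unfolding fibre by (auto intro!: poly_roots_finite finite_imageI fibre_poly_nonzero)

lemma degree_fibre_poly_le: "degree (fibre_poly c) \<le> d"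
  unfolding fibre_poly_def d_def
  by (cases c) (auto intro!: degree_diff_le simp: degree_smult_le le_max_iff_disj intro: le_trans)

text \<open>Over the complex numbers the finite points contribute the degree of the fibre
  polynomial, and \<open>Infty\<close> contributes exactly the deficit to d.\<close>

lemma sum_fibre: "(\<Sum>x | f x = c. local_degree f x) = d"
proof -
  let ?P = "fibre_poly c"
  have fin: "finite {a. poly ?P a = 0}" by (auto intro!: poly_roots_finite finite_imageI fibre_poly_nonzero)
  have "(\<Sum>x\<in>Fin ` {a. poly ?P a = 0}. local_degree f x) = (\<Sum>a | poly ?P a = 0. order a ?P)"
    by (subst sum.reindex) (auto simp: inj_on_def local_degree_Fin map_Fin_eq_iff[of _ c, symmetric] intro!: sum.cong)
  also have "\<dots> = degree ?P" by (rule sum_order_complex[OF fibre_poly_nonzero])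
  finally have 1: "(\<Sum>x\<in>Fin ` {a. poly ?P a = 0}. local_degree f x) = degree ?P" .
  show ?thesis
  proof (cases "degree ?P < d")
    case True
    then have "local_degree f Infty = d - degree ?P"
      using map_Infty_eq_iff[of c] by (simp add: local_degree_Infty)
    then show ?thesis unfolding fibre using True fin 1
      by (subst sum.union_disjoint) auto
  next
    case False
    then show ?thesis unfolding fibre using 1 degree_fibre_poly_le[of c] by simp
  qed
qed

definition "wronskian = pderiv p * q - p * pderiv q"

text \<open>The Wronskian is unchanged when a multiple of q is subtracted from p and changes sign
  when p and q are swapped. Hence one polynomial detects ramification over every value at
  once.\<close>

lemma wronskian_fibre: "wronskian = pderiv (fibre_poly c) * fibre_partner c - fibre_poly c * pderiv (fibre_partner c) \<or>
  wronskian = - (pderiv (fibre_poly c) * fibre_partner c - fibre_poly c * pderiv (fibre_partner c))"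
  by (cases c) (auto simp: wronskian_def fibre_poly_def fibre_partner_def pderiv_diff pderiv_smult algebra_simps)

lemma wronskian_order: "wronskian \<noteq> 0" "order a wronskian = local_degree f (Fin a) - 1"
proof -
  let ?c = "f (Fin a)"
  have root: "poly (fibre_poly ?c) a = 0" using map_Fin_eq_iff[of a ?c] by simp
  then have Q: "poly (fibre_partner ?c) a \<noteq> 0"
    using no_common_root[of a] by (cases ?c) (auto simp: fibre_poly_def fibre_partner_def)
  note w = order_wronskian[OF fibre_poly_nonzero root Q]
  show "wronskian \<noteq> 0" using wronskian_fibre[of ?c] w(1) by auto
  show "order a wronskian = local_degree f (Fin a) - 1"
    using wronskian_fibre[of ?c] w(2) unfolding local_degree_Fin by (metis order_uminus)
qed

text \<open>For the value at \<open>Infty\<close> the fibre polynomial P has degree below d and its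
  partner degree d, so the Wronskian has degree deg P + d - 1. What is missing from 2d - 2 is d -
  deg P - 1, the ramification at \<open>Infty\<close>.\<close>

lemma wronskian_degree: "degree wronskian + (local_degree f Infty - 1) = 2 * d - 2"
proof -
  let ?c = "f Infty"
  have lt: "degree (fibre_poly ?c) < d" using map_Infty_eq_iff[of ?c] by simp
  then have dQ: "degree (fibre_partner ?c) = d"
    by (auto simp: fibre_poly_def fibre_partner_def d_def split: if_splits)
  have "degree wronskian = degree (pderiv (fibre_poly ?c) * fibre_partner ?c - fibre_poly ?c * pderiv (fibre_partner ?c))"
    using wronskian_fibre[of ?c] by (metis degree_minus)
  also have "\<dots> = degree (fibre_poly ?c) + d - 1"
    using degree_wronskian[OF fibre_poly_nonzero, of ?c "fibre_partner ?c"] lt dQ by simp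
  finally have "degree wronskian = degree (fibre_poly ?c) + d - 1" .
  then show ?thesis using lt by (simp add: local_degree_Infty)
qed

lemma ramified_subset: "{x. local_degree f x \<noteq> 1} \<subseteq> Fin ` {a. poly wronskian a = 0} \<union> {Infty}"
proof
  fix x assume x: "x \<in> {x. local_degree f x \<noteq> 1}"
  show "x \<in> Fin ` {a. poly wronskian a = 0} \<union> {Infty}"
  proof (cases x)
    case (Fin a)
    have "local_degree f x \<ge> 1" using mult_at_map[of x] by (simp add: mult_at_def)
    then have "order a wronskian \<noteq> 0" using x by (simp add: Fin wronskian_order)
    then show ?thesis using Fin wronskian_order(1) by (auto simp: order_root)
  qed auto
qed

lemma finite_ramified: "finite {x. local_degree f x \<noteq> 1}"
  by (rule finite_subset[OF ramified_subset]) (auto intro!: poly_roots_finite finite_imageI wronskian_order)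

text \<open>The ramification at finite points is the zero divisor of the Wronskian, whose degree is
  known up to the contribution of \<open>Infty\<close>.\<close>

lemma riemann_hurwitz: "(\<Sum>x | local_degree f x \<noteq> 1. local_degree f x - 1) = 2 * d - 2"
proof -
  let ?R = "Fin ` {a. poly wronskian a = 0}"
  have fin: "finite {a. poly wronskian a = 0}" by (auto intro!: poly_roots_finite finite_imageI wronskian_order)
  have "(\<Sum>x | local_degree f x \<noteq> 1. local_degree f x - 1) = (\<Sum>x\<in>?R \<union> {Infty}. local_degree f x - 1)"
  proof (rule sum.mono_neutral_left)
    show "finite (?R \<union> {Infty})" using fin by simp
    show "{x. local_degree f x \<noteq> 1} \<subseteq> ?R \<union> {Infty}" by (rule ramified_subset)
  qed auto
  also have "\<dots> = (\<Sum>x\<in>?R. local_degree f x - 1) + (local_degree f Infty - 1)"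
    using fin by (subst sum.union_disjoint) auto
  also have "(\<Sum>x\<in>?R. local_degree f x - 1) = (\<Sum>a | poly wronskian a = 0. order a wronskian)"
    by (subst sum.reindex) (auto simp: inj_on_def wronskian_order intro!: sum.cong)
  also have "\<dots> = degree wronskian" by (rule sum_order_complex[OF wronskian_order(1)])
  finally show ?thesis using wronskian_degree by simp
qed

end

lemma rational_of_degree_coprime_fraction:
  assumes "rational_of_degree n f"
  obtains p q where "coprime_fraction p q" "f = rat_map p q" "coprime_fraction.d p q = n"
proof -
  obtain p q where pq: "coprime p q" "max (degree p) (degree q) = n" "f = rat_map p q" "n \<ge> 1"
    using assms unfolding rational_of_degree_def by blast
  have c: "coprime_fraction p q" by standard (use pq in auto)
  show thesis by (rule that[OF c pq(3)]) (simp add: coprime_fraction.d_def[OF c] pq)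
qed

lemma rat_mult_at: "rational_function f \<Longrightarrow> mult_at (\<lambda>w. f (param z w)) 0 (local_degree f z)"
  unfolding rational_function_def
  by (auto elim!: rational_of_degree_coprime_fraction simp: coprime_fraction.mult_at_map)

lemma rat_holo: "rational_function f \<Longrightarrow> holo f"
  unfolding holo_def using mult_at_imp_hol_at rat_mult_at by blast

lemma rat_local_degree_pos: "rational_function f \<Longrightarrow> local_degree f z \<ge> 1"
  using rat_mult_at mult_at_def by blast

lemma rat_finite_fibre: "rational_function f \<Longrightarrow> finite {x. f x = c}"
  unfolding rational_function_def
  by (auto elim!: rational_of_degree_coprime_fraction simp: coprime_fraction.finite_fibre)

lemma rat_sum_fibre: "rational_of_degree n f \<Longrightarrow> (\<Sum>x | f x = c. local_degree f x) = n"
  by (auto elim!: rational_of_degree_coprime_fraction simp: coprime_fraction.sum_fibre)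

lemma rat_finite_ramified: "rational_function f \<Longrightarrow> finite {x. local_degree f x \<noteq> 1}"
  unfolding rational_function_def
  by (metis coprime_fraction.finite_ramified rational_of_degree_coprime_fraction)

lemma rat_riemann_hurwitz:
  "rational_of_degree n f \<Longrightarrow> (\<Sum>x | local_degree f x \<noteq> 1. local_degree f x - 1) = 2 * n - 2"
  by (metis coprime_fraction.riemann_hurwitz rational_of_degree_coprime_fraction)

lemma rational_of_degree_imp_rational: "rational_of_degree n f \<Longrightarrow> rational_function f"
  by (auto simp: rational_function_def)

lemma rational_of_degree_pos: "rational_of_degree n f \<Longrightarrow> n \<ge> 1"
  by (simp add: rational_of_degree_def)

lemma rat_surj:
  assumes "rational_function f"
  shows "surj f"
proof -
  obtain n where n: "rational_of_degree n f" using assms by (auto simp: rational_function_def)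
  have "\<exists>x. f x = c" for c
    using rat_sum_fibre[OF n, of c] rational_of_degree_pos[OF n] by (cases "{x. f x = c} = {}") auto
  then show ?thesis unfolding surj_def by metis
qed

lemma rat_card_fibre_le:
  assumes "rational_of_degree n f"
  shows "card {x. f x = c} \<le> n"
proof -
  have rf: "rational_function f" using assms by (rule rational_of_degree_imp_rational)
  have "card {x. f x = c} = (\<Sum>x | f x = c. 1)" by simp
  also have "\<dots> \<le> (\<Sum>x | f x = c. local_degree f x)"
    by (intro sum_mono rat_local_degree_pos rf)
  finally show ?thesis using rat_sum_fibre[OF assms, of c] by simp
qed

lemma rational_of_degree_unique: "rational_of_degree m f \<Longrightarrow> rational_of_degree n f \<Longrightarrow> m = n"
  using rat_sum_fibre by metis

section \<open>Holomorphic self-maps of the sphere are rational\<close>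

lemma eventually_nhds_zero_norm:
  assumes "\<forall>\<^sub>F w in nhds (0::complex). P w"
  obtains e where "e > 0" "\<And>w. norm w < e \<Longrightarrow> P w"
  using assms unfolding eventually_nhds_metric by auto

lemma eventually_at_zero_norm:
  assumes "\<forall>\<^sub>F w in at (0::complex). P w"
  obtains e where "e > 0" "\<And>w. w \<noteq> 0 \<Longrightarrow> norm w < e \<Longrightarrow> P w"
  using assms unfolding eventually_at by auto

text \<open>An infinite level set on the compact sphere would accumulate at a finite point or at
  \<open>Infty\<close>; in either case the identity theorem makes F constant.\<close>

lemma holo_level_finite:
  assumes F: "holo F" and nc: "F \<noteq> (\<lambda>_. c)"
  shows "finite {z. F z = c}"
proof -
  have hF: "hol_at (\<lambda>w. F (param z w)) 0" for z using F by (simp add: holo_def)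
  have hFin: "hol_at (\<lambda>x. F (Fin x)) x" for x by (rule holo_hol_at[OF F hol_at_Fin])
  have key: False if "\<forall>\<^sub>F w in nhds u. F (Fin w) = c" for u
  proof -
    have "\<forall>\<^sub>F w in at u. F (Fin w) = c" using that by (simp add: eventually_nhds_conv_at)
    then have 1: "\<not> (\<forall>\<^sub>F w in at u. F (Fin w) \<noteq> c)" using eventually_at_contradiction by blast
    have "F (Fin x) = c" for x
      using hol_identity[of UNIV "\<lambda>x. F (Fin x)" "\<lambda>_. c" u x] hFin hol_at_const 1 by auto
    then have "F z = c" if "z \<notin> {Infty}" for z using that by (cases z) auto
    moreover have "holo (\<lambda>_. c)" by (simp add: holo_def hol_at_const)
    ultimately have "F = (\<lambda>_. c)" by (intro holo_eqI[OF F, of _ "{Infty}"]) auto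
    with nc show False by simp
  qed
  have isolated: "\<forall>\<^sub>F w in at x. F (Fin w) \<noteq> c" for x
    using agree_dichotomy[OF hFin[of x] hol_at_const[of c x]] key by auto
  \<comment> \<open>If F were equal to c near \<open>Infty\<close>, it would be so on the exterior
    of a disc, hence near a finite point such as 2/e, which \<open>key\<close> excludes.\<close>
  have "\<forall>\<^sub>F w in at 0. F (param Infty w) \<noteq> c"
  proof (rule ccontr)
    assume "\<not> ?thesis"
    then have "\<forall>\<^sub>F w in nhds 0. F (param Infty w) = c"
      using agree_dichotomy[OF hF[of Infty] hol_at_const[of c 0]] by auto
    then obtain e where e: "e > 0" "\<And>w. norm w < e \<Longrightarrow> F (param Infty w) = c"
      using eventually_nhds_zero_norm by blast
    have "F (Fin w) = c" if "norm w > 1 / e" for w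
    proof -
      have "norm w > 0" using that e(1) by (smt (verit) divide_pos_pos)
      then have "norm (1 / w) < e" using that e(1) by (simp add: norm_divide field_simps)
      moreover have "w \<noteq> 0" using \<open>norm w > 0\<close> by auto
      ultimately show ?thesis using e(2)[of "1 / w"] by simp
    qed
    moreover have "open {w::complex. norm w > 1 / e}" by (intro open_Collect_less continuous_intros)
    moreover have "complex_of_real (2 / e) \<in> {w. norm w > 1 / e}" using e(1) by (simp add: norm_divide field_simps)
    ultimately have "\<forall>\<^sub>F w in nhds (complex_of_real (2 / e)). F (Fin w) = c"
      unfolding eventually_nhds by blast
    then show False by (rule key)
  qed
  then obtain e where e: "e > 0" "\<And>w. w \<noteq> 0 \<Longrightarrow> norm w < e \<Longrightarrow> F (param Infty w) \<noteq> c"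
    using eventually_at_zero_norm by blast
  have sub: "{a. F (Fin a) = c} \<subseteq> cball 0 (1 / e)"
  proof
    fix a assume a: "a \<in> {a. F (Fin a) = c}"
    show "a \<in> cball 0 (1 / e)"
    proof (rule ccontr)
      assume "a \<notin> cball 0 (1 / e)"
      then have "norm a > 1 / e" by simp
      moreover from this have "norm a > 0" using e(1) by (smt (verit) divide_pos_pos)
      ultimately have "norm (1 / a) < e" "1 / a \<noteq> 0" using e(1) by (auto simp: norm_divide field_simps)
      then show False using e(2)[of "1 / a"] a by simp
    qed
  qed
  have "finite {a. F (Fin a) = c}"
  proof (rule ccontr)
    assume "infinite {a. F (Fin a) = c}"
    then obtain x where "x islimpt {a. F (Fin a) = c}"
      using compact_cball[of "0::complex" "1 / e"] sub unfolding compact_eq_Bolzano_Weierstrass by blast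
    then show False using isolated[of x] by (simp add: islimpt_iff_eventually)
  qed
  moreover have "{z. F z = c} \<subseteq> insert Infty (Fin ` {a. F (Fin a) = c})"
  proof
    fix z assume "z \<in> {z. F z = c}"
    then show "z \<in> insert Infty (Fin ` {a. F (Fin a) = c})" by (cases z) auto
  qed
  ultimately show ?thesis by (meson finite.insertI finite_imageI finite_subset)
qed

text \<open>The default 0 at \<open>Infty\<close> is harmless in upper bounds and keeps products
  over Moebius transformations total.\<close>

primrec finite_value :: "cp1 \<Rightarrow> complex" where
  "finite_value (Fin z) = z"
| "finite_value Infty = 0"

lemma poly_growth:
  fixes P :: "complex poly"
  obtains K where "K \<ge> 0" "\<And>x. norm x \<ge> 1 \<Longrightarrow> norm (poly P x) \<le> K * norm x ^ degree P"
proof (rule that)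
  show "(\<Sum>i\<le>degree P. norm (coeff P i)) \<ge> 0" by (intro sum_nonneg) auto
  fix x :: complex assume x: "norm x \<ge> 1"
  have "norm (poly P x) \<le> (\<Sum>i\<le>degree P. norm (coeff P i * x ^ i))"
    unfolding poly_altdef by (rule norm_sum)
  also have "\<dots> \<le> (\<Sum>i\<le>degree P. norm (coeff P i) * norm x ^ degree P)"
    using x by (intro sum_mono) (auto simp: norm_mult norm_power intro!: mult_left_mono power_increasing)
  finally show "norm (poly P x) \<le> (\<Sum>i\<le>degree P. norm (coeff P i)) * norm x ^ degree P"
    by (simp add: sum_distrib_right)
qed

text \<open>Near \<open>Infty\<close> the map is either bounded or has a pole of some order m, and
  then grows at most like |x|^m.\<close>

lemma holo_growth_at_infinity:
  assumes F: "holo F" and nc: "\<nexists>c. F = (\<lambda>_. c)"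
  obtains A K n where "A \<ge> 1" "K \<ge> 0" "\<And>x. norm x \<ge> A \<Longrightarrow> norm (finite_value (F (Fin x))) \<le> K * norm x ^ n"
proof -
  have h: "hol_at (\<lambda>w. F (param Infty w)) 0" using F unfolding holo_def by blast
  have "\<exists>e K n. e > 0 \<and> K \<ge> 0 \<and> (\<forall>w. w \<noteq> 0 \<longrightarrow> norm w < e \<longrightarrow> norm (finite_value (F (param Infty w))) \<le> K * norm (1 / w) ^ n)"
  proof (cases "F Infty")
    case (Fin b)
    obtain g where g: "g analytic_on {0}" "g 0 = 0" "\<forall>\<^sub>F w in nhds 0. F (param Infty w) = param (Fin b) (g w)"
      using h Fin unfolding hol_at_def by auto
    have "\<forall>\<^sub>F w in nhds (g 0). norm (b + w) < norm b + 1"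
      by (rule eventually_nhds_in_open[of "{w. norm (b + w) < norm b + 1}", simplified])
        (auto intro!: open_Collect_less continuous_intros simp: g(2))
    then have "\<forall>\<^sub>F w in nhds 0. norm (b + g w) < norm b + 1"
      by (rule eventually_compose_analytic[OF g(1)])
    with g(3) have "\<forall>\<^sub>F w in nhds 0. norm (finite_value (F (param Infty w))) \<le> (norm b + 1) * norm (1 / w) ^ 0"
      by eventually_elim simp
    then obtain e where "e > 0" "\<And>w. norm w < e \<Longrightarrow> norm (finite_value (F (param Infty w))) \<le> (norm b + 1) * norm (1 / w) ^ 0"
      using eventually_nhds_zero_norm by blast
    then show ?thesis
      by (intro exI[of _ e] exI[of _ "norm b + 1"] exI[of _ 0] conjI) (auto simp del: param.simps)
  next
    case Infty
    from h obtain m where "mult_at (\<lambda>w. F (param Infty w)) 0 m"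
    proof (rule hol_at_cases)
      assume "\<forall>\<^sub>F w in nhds 0. F (param Infty w) = F (param Infty 0)"
      then obtain e where e: "e > 0" "\<And>w. norm w < e \<Longrightarrow> F (param Infty w) = Infty"
        using eventually_nhds_zero_norm Infty by auto
      have "finite {z. F z = Infty}" using holo_level_finite[OF F] nc by blast
      then have "\<forall>\<^sub>F w in at 0. param Infty w \<notin> {z. F z = Infty}" by (rule eventually_param_notin)
      moreover have "\<forall>\<^sub>F w in at 0. \<not> (param Infty w \<notin> {z. F z = Infty})"
        unfolding eventually_at using e by (intro exI[of _ e]) (auto simp del: param.simps)
      ultimately show ?thesis using eventually_at_contradiction by blast
    qed auto
    then obtain u where u: "u analytic_on {0}" "u 0 \<noteq> 0"
      "\<forall>\<^sub>F w in nhds 0. F (param Infty w) = param Infty (w ^ m * u w)"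
      unfolding mult_at_def using Infty by auto
    have "(\<lambda>w. 1 / u w) analytic_on {0}" using u by (intro analytic_intros) auto
    moreover have "\<forall>\<^sub>F w in nhds (1 / u 0). norm w < norm (1 / u 0) + 1"
      by (rule eventually_nhds_in_open[of "{w. norm w < norm (1 / u 0) + 1}", simplified])
        (auto intro!: open_Collect_less continuous_intros)
    ultimately have "\<forall>\<^sub>F w in nhds 0. norm (1 / u w) < norm (1 / u 0) + 1"
      by (rule eventually_compose_analytic)
    with u(3) have "\<forall>\<^sub>F w in nhds 0. norm (finite_value (F (param Infty w))) \<le> (norm (1 / u 0) + 1) * norm (1 / w) ^ m"
    proof eventually_elim
      case (elim w)
      have "norm (1 / (w ^ m * u w)) = norm (1 / u w) * norm (1 / w) ^ m"
        by (simp add: norm_divide norm_mult norm_power power_divide)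
      also have "\<dots> \<le> (norm (1 / u 0) + 1) * norm (1 / w) ^ m"
        using elim(2) by (intro mult_right_mono) auto
      finally show ?case using elim(1) by simp
    qed
    then obtain e where "e > 0" "\<And>w. norm w < e \<Longrightarrow> norm (finite_value (F (param Infty w))) \<le> (norm (1 / u 0) + 1) * norm (1 / w) ^ m"
      using eventually_nhds_zero_norm by blast
    then show ?thesis
      by (intro exI[of _ e] exI[of _ "norm (1 / u 0) + 1"] exI[of _ m] conjI) (auto simp del: param.simps)
  qed
  then obtain e K n where e: "e > 0" "K \<ge> 0"
    "\<And>w. w \<noteq> 0 \<Longrightarrow> norm w < e \<Longrightarrow> norm (finite_value (F (param Infty w))) \<le> K * norm (1 / w) ^ n"
    by blast
  show thesis
  proof (rule that[of "1 / e + 1" K n])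
    show "1 \<le> 1 / e + 1" using e(1) by simp
    show "0 \<le> K" by fact
    fix x :: complex assume x: "1 / e + 1 \<le> norm x"
    moreover have "1 / e > 0" using e(1) by simp
    ultimately have "norm x > 1 / e" "norm x > 0" by linarith+
    then have "norm (1 / x) < e" "1 / x \<noteq> 0" using e(1) by (auto simp: norm_divide field_simps)
    then show "norm (finite_value (F (Fin x))) \<le> K * norm x ^ n"
      using e(3)[of "1 / x"] by simp
  qed
qed

lemma analytic_on_eventually_eq:
  assumes "f analytic_on {x}" "\<forall>\<^sub>F y in nhds x. f y = g y"
  shows "g analytic_on {x}"
  using analytic_at_cong[OF assms(2) refl] assms(1) by simp

text \<open>F has finitely many finite poles, each of finite order, so a polynomial clears them all
  and leaves an entire numerator E.\<close>

lemma holo_clear_poles: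
  assumes F: "holo F" and nc: "\<nexists>c. F = (\<lambda>_. c)"
  obtains P :: "complex poly" and E where "E holomorphic_on UNIV"
    "\<And>x. poly P x = 0 \<longleftrightarrow> F (Fin x) = Infty" "\<And>x. poly P x \<noteq> 0 \<Longrightarrow> F (Fin x) = Fin (E x / poly P x)"
proof -
  define B where "B = {a. F (Fin a) = Infty}"
  have "finite {z. F z = Infty}" using holo_level_finite[OF F] nc by blast
  then have "finite (Fin -` {z. F z = Infty})" by (rule finite_vimageI) (simp add: inj_on_def)
  then have finB: "finite B" by (simp add: B_def vimage_def)
  have hFin: "hol_at (\<lambda>x. F (Fin x)) x" for x by (rule holo_hol_at[OF F hol_at_Fin])
  have notB: "\<forall>\<^sub>F x in at y. x \<notin> B" for y
    using islimpt_finite[OF finB] islimpt_iff_eventually by blast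
  have ex: "\<exists>m u. u analytic_on {a} \<and> u a \<noteq> 0 \<and> (\<forall>\<^sub>F x in nhds a. F (Fin x) = param Infty ((x - a) ^ m * u x))"
    if "a \<in> B" for a
    using hFin[of a]
  proof (rule hol_at_cases)
    assume "\<forall>\<^sub>F x in nhds a. F (Fin x) = F (Fin a)"
    then have "\<forall>\<^sub>F x in at a. \<not> x \<notin> B" using that by (simp add: eventually_nhds_conv_at B_def)
    then show ?thesis using notB[of a] eventually_at_contradiction by blast
  next
    fix m assume "mult_at (\<lambda>x. F (Fin x)) a m"
    then obtain u where u: "u analytic_on {a}" "u a \<noteq> 0"
      "\<forall>\<^sub>F x in nhds a. F (Fin x) = param (F (Fin a)) ((x - a) ^ m * u x)"
      unfolding mult_at_def by blast
    have "F (Fin a) = Infty" using that by (simp add: B_def)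
    with u show ?thesis by (intro exI[of _ m] exI[of _ u]) (simp del: param.simps)
  qed
  from ex have "\<forall>a\<in>B. \<exists>m u. u analytic_on {a} \<and> u a \<noteq> 0 \<and> (\<forall>\<^sub>F x in nhds a. F (Fin x) = param Infty ((x - a) ^ m * u x))"
    by blast
  from bchoice[OF this] obtain m where
    "\<forall>a\<in>B. \<exists>u. u analytic_on {a} \<and> u a \<noteq> 0 \<and> (\<forall>\<^sub>F x in nhds a. F (Fin x) = param Infty ((x - a) ^ m a * u x))"
    by blast
  from bchoice[OF this] obtain u where mu: "\<And>a. a \<in> B \<Longrightarrow> u a analytic_on {a}" "\<And>a. a \<in> B \<Longrightarrow> u a a \<noteq> 0"
    "\<And>a. a \<in> B \<Longrightarrow> \<forall>\<^sub>F x in nhds a. F (Fin x) = param Infty ((x - a) ^ m a * u a x)"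
    by blast
  \<comment> \<open>The exponent exceeds the pole order by one, so P vanishes at each pole even
    though \<open>ex\<close> records no positivity of the order.\<close>
  define P where "P = (\<Prod>a\<in>B. [:-a, 1:] ^ Suc (m a))"
  have P0: "poly P x = 0 \<longleftrightarrow> x \<in> B" for x
    using finB by (auto simp: P_def poly_prod poly_power)
  define R where "R = (\<lambda>a. [:-a, 1:] * (\<Prod>b\<in>B - {a}. [:-b, 1:] ^ Suc (m b)))"
  have PR: "poly P x = (x - a) ^ m a * poly (R a) x" if "a \<in> B" for a x
    using finB that unfolding P_def R_def
    by (subst prod.remove[OF finB that]) (simp only: poly_mult poly_power power_Suc mult_ac, simp)
  \<comment> \<open>At a pole the value is the limit of P F, read off from the factor
    \<open>R x\<close> of P and the unit \<open>u x\<close> of the local expansion.\<close>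
  define E where "E = (\<lambda>x. if x \<in> B then poly (R x) x / u x x else poly P x * finite_value (F (Fin x)))"
  have "E analytic_on {x}" for x
  proof (cases "x \<in> B")
    case True
    have an: "(\<lambda>y. poly (R x) y / u x y) analytic_on {x}"
      using mu(1,2)[OF True] unfolding poly_altdef by (intro analytic_intros) auto
    have "\<forall>\<^sub>F y in nhds x. u x y \<noteq> 0"
      using eventually_compose_analytic[OF mu(1)[OF True], of "\<lambda>w. w \<noteq> 0"] mu(2)[OF True] by (simp add: t1_space_nhds)
    moreover have "\<forall>\<^sub>F y in nhds x. y \<noteq> x \<longrightarrow> y \<notin> B" using notB[of x] by (simp add: eventually_at_filter)
    ultimately have "\<forall>\<^sub>F y in nhds x. poly (R x) y / u x y = E y"
      using mu(3)[OF True]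
    proof eventually_elim
      case (elim y)
      show ?case
      proof (cases "y = x")
        case False
        then show ?thesis using elim PR[OF True, of y] by (simp add: E_def)
      qed (simp add: E_def True)
    qed
    then show ?thesis by (rule analytic_on_eventually_eq[OF an])
  next
    case False
    then obtain b where b: "F (Fin x) = Fin b" by (cases "F (Fin x)") (auto simp: B_def)
    then obtain g where g: "g analytic_on {x}" "\<forall>\<^sub>F y in nhds x. F (Fin y) = Fin (b + g y)"
      using hFin[of x] unfolding hol_at_def by auto
    then have an: "(\<lambda>y. poly P y * (b + g y)) analytic_on {x}"
      unfolding poly_altdef by (intro analytic_intros)
    have "\<forall>\<^sub>F y in nhds x. poly P y * (b + g y) = E y"
      using g(2) by eventually_elim (auto simp: E_def B_def)
    then show ?thesis by (rule analytic_on_eventually_eq[OF an])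
  qed
  then have "E analytic_on UNIV" unfolding analytic_on_def by blast
  then have "E holomorphic_on UNIV" by (rule analytic_imp_holomorphic)
  moreover have "F (Fin x) = Fin (E x / poly P x)" if "poly P x \<noteq> 0" for x
    using that P0[of x] by (cases "F (Fin x)") (auto simp: E_def B_def)
  moreover have "poly P x = 0 \<longleftrightarrow> F (Fin x) = Infty" for x using P0 by (simp add: B_def)
  ultimately show thesis by (intro that[of E P])
qed

text \<open>Among all fractions equal to Q/P one with denominator of least degree is taken; a
  nonconstant common factor would lower that degree.\<close>

lemma coprime_fraction_exists:
  fixes P Q :: "complex poly"
  assumes "P \<noteq> 0"
  shows "\<exists>p q. q \<noteq> 0 \<and> Q * q = P * p \<and> coprime p q"
proof -
  let ?R = "\<lambda>pq. snd pq \<noteq> 0 \<and> Q * snd pq = P * fst pq"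
  have "?R (Q, P)" using assms by simp
  from ex_has_least_nat[of ?R, OF this, of "\<lambda>pq. degree (snd pq)"]
  obtain p q where pq: "q \<noteq> 0" "Q * q = P * p"
    and least: "\<And>p' q'. q' \<noteq> 0 \<Longrightarrow> Q * q' = P * p' \<Longrightarrow> degree q \<le> degree q'"
    by auto
  have "coprime p q"
  proof (rule coprimeI)
    fix c assume "c dvd p" "c dvd q"
    then obtain p' q' where c: "p = c * p'" "q = c * q'" by (auto elim!: dvdE)
    then have nz: "c \<noteq> 0" "q' \<noteq> 0" using pq(1) by auto
    have "c * (Q * q') = c * (P * p')" using pq(2) by (simp add: c mult_ac)
    then have "Q * q' = P * p'" using nz by simp
    then have "degree q \<le> degree q'" using least nz by blast
    then have "degree c = 0" using nz by (simp add: c degree_mult_eq)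
    then show "is_unit c" using nz is_unit_iff_degree by blast
  qed
  with pq show ?thesis by blast
qed

text \<open>Once the poles are cleared, an entire function of polynomial growth remains, which is a
  polynomial by Liouville. The reduced fraction agrees with F off finitely many points, hence
  everywhere. Every lift and every quotient map below becomes rational through this theorem.\<close>

theorem holo_imp_rational:
  assumes F: "holo F" and nc: "\<nexists>c. F = (\<lambda>_. c)"
  shows "rational_function F"
proof -
  obtain P :: "complex poly" and E where E: "E holomorphic_on UNIV"
    "\<And>x. poly P x = 0 \<longleftrightarrow> F (Fin x) = Infty" "\<And>x. poly P x \<noteq> 0 \<Longrightarrow> F (Fin x) = Fin (E x / poly P x)"
    using holo_clear_poles[OF assms] by metis
  obtain A K n where g: "A \<ge> 1" "K \<ge> 0" "\<And>x. norm x \<ge> A \<Longrightarrow> norm (finite_value (F (Fin x))) \<le> K * norm x ^ n"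
    using holo_growth_at_infinity[OF assms] by metis
  obtain K' where K': "K' \<ge> 0" "\<And>x. norm x \<ge> 1 \<Longrightarrow> norm (poly P x) \<le> K' * norm x ^ degree P"
    using poly_growth[of P] by metis
  have fin: "finite {z. F z = Infty}" using holo_level_finite[OF F] nc by blast
  then have finB: "finite {x. poly P x = 0}"
    using finite_vimageI[OF fin, of Fin] by (simp add: E(2) vimage_def inj_on_def)
  obtain A' where A': "A' \<ge> A" "\<And>x. norm x \<ge> A' \<Longrightarrow> poly P x \<noteq> 0"
  proof -
    obtain M where M: "\<And>x. x \<in> {x. poly P x = 0} \<Longrightarrow> norm x < M"
      using finite_imp_bounded[OF finB] unfolding bounded_pos_less by blast
    show thesis by (rule that[of "max A M"]) (use M in fastforce)+
  qed
  have "norm (E x) \<le> K' * K * norm x ^ (degree P + n)" if "norm x \<ge> A'" for x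
  proof -
    have "norm (E x) = norm (poly P x) * norm (finite_value (F (Fin x)))"
      using E(3)[of x] A'(2)[OF that] by (simp add: norm_divide)
    also have "\<dots> \<le> (K' * norm x ^ degree P) * (K * norm x ^ n)"
      using K' g A' that by (intro mult_mono) auto
    finally show ?thesis by (simp add: power_add mult_ac)
  qed
  from Liouville_polynomial[OF E(1) this]
  have Ex: "E x = (\<Sum>k\<le>degree P + n. (deriv ^^ k) E 0 / fact k * x ^ k)" for x .
  define Q where "Q = (\<Sum>k\<le>degree P + n. monom ((deriv ^^ k) E 0 / fact k) k)"
  have EQ: "E x = poly Q x" for x unfolding Q_def by (rule trans[OF Ex]) (simp add: poly_sum poly_monom)
  have "P \<noteq> 0" using finB infinite_UNIV_char_0[where 'a = complex] by auto
  then obtain p q where pq: "q \<noteq> 0" "Q * q = P * p" "coprime p q"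
    using coprime_fraction_exists by blast
  have eq: "F (Fin x) = rat_map p q (Fin x)" if "poly P x \<noteq> 0" "poly q x \<noteq> 0" for x
  proof -
    have "poly Q x * poly q x = poly P x * poly p x" using pq(2) by (metis poly_mult)
    then show ?thesis using E(3)[OF that(1)] that by (simp add: EQ field_simps)
  qed
  have eq': "F z = rat_map p q z" if "z \<notin> insert Infty (Fin ` {x. poly P x = 0} \<union> Fin ` {x. poly q x = 0})" for z
    using that eq by (cases z) auto
  have finT: "finite (insert Infty (Fin ` {x. poly P x = 0} \<union> Fin ` {x. poly q x = 0}))" using finB poly_roots_finite[OF pq(1)] by simp
  show ?thesis
  proof (cases "max (degree p) (degree q) \<ge> 1")
    case True
    then have rat: "rational_function (rat_map p q)"
      unfolding rational_function_def rational_of_degree_def using pq(3) by blast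
    then have "F = rat_map p q"
      by (intro holo_eqI[OF F rat_holo finT]) (use eq' in auto)
    then show ?thesis using rat by simp
  next
    case False
    then obtain a b where ab: "p = [:a:]" "q = [:b:]" by (metis degree_eq_zeroE max_def not_less_eq_eq le_zero_eq One_nat_def nat_le_linear)
    have "holo (\<lambda>_. rat_map p q (Fin 0))" by (simp add: holo_def hol_at_const)
    then have "F = (\<lambda>_. rat_map p q (Fin 0))"
    proof (rule holo_eqI[OF F _ finT])
      fix z assume z: "z \<notin> insert Infty (Fin ` {x. poly P x = 0} \<union> Fin ` {x. poly q x = 0})"
      then obtain x where "z = Fin x" by (cases z) auto
      then show "F z = rat_map p q (Fin 0)" using eq'[OF z] by (simp add: ab)
    qed
    then show ?thesis using nc by blast
  qed
qed

section \<open>Composition and factorization\<close>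

lemma rational_compose:
  assumes "rational_function f" "rational_function g"
  shows "rational_function (f \<circ> g)"
proof (rule holo_imp_rational)
  show "holo (f \<circ> g)" using assms by (intro holo_compose rat_holo)
  have "surj (f \<circ> g)" using assms by (intro comp_surj rat_surj)
  then show "\<nexists>c. f \<circ> g = (\<lambda>_. c)" unfolding surj_def by (metis cp1.distinct(1))
qed

lemma local_degree_compose:
  assumes "rational_function f" "rational_function g"
  shows "local_degree (f \<circ> g) z = local_degree g z * local_degree f (g z)"
  using mult_at_compose[OF rat_mult_at[OF assms(2)], of f z "local_degree f (g z)"] rat_mult_at[OF assms(1)]
  by (intro local_degree_eqI) simp

text \<open>Degrees are never read off from composed polynomials, where cancellation would have to
  be controlled. Instead the fibre over \<open>Infty\<close> is counted with multiplicity, grouped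
  by its image under g.\<close>

lemma rational_of_degree_compose:
  assumes f: "rational_of_degree m f" and g: "rational_of_degree n g"
  shows "rational_of_degree (m * n) (f \<circ> g)"
proof -
  have rf: "rational_function f" "rational_function g"
    using assms by (auto intro: rational_of_degree_imp_rational)
  then have rfg: "rational_function (f \<circ> g)" by (rule rational_compose)
  then obtain k where k: "rational_of_degree k (f \<circ> g)" by (auto simp: rational_function_def)
  have "k = (\<Sum>x | (f \<circ> g) x = Infty. local_degree (f \<circ> g) x)" using rat_sum_fibre[OF k] by simp
  also have "\<dots> = (\<Sum>y | f y = Infty. \<Sum>x | x \<in> {x. (f \<circ> g) x = Infty} \<and> g x = y. local_degree (f \<circ> g) x)"
    by (rule sum.group[symmetric]) (use rat_finite_fibre[OF rf(1)] rat_finite_fibre[OF rfg] in auto)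
  also have "\<dots> = (\<Sum>y | f y = Infty. \<Sum>x | g x = y. local_degree g x * local_degree f y)"
    by (intro sum.cong) (auto simp: local_degree_compose rf)
  also have "\<dots> = (\<Sum>y | f y = Infty. n * local_degree f y)"
    by (simp add: rat_sum_fibre[OF g] flip: sum_distrib_right)
  also have "\<dots> = m * n" by (simp add: rat_sum_fibre[OF f] mult.commute flip: sum_distrib_left)
  finally show ?thesis using k by simp
qed

section \<open>Descent of holomorphic maps through a rational function\<close>

lemma complex_root_exists:
  assumes "m \<ge> (1::nat)"
  obtains s :: complex where "s ^ m = v"
proof (cases "v = 0")
  case True
  then show ?thesis using that[of 0] assms by (simp add: zero_power)
next
  case False
  have "(\<lambda>w. w) analytic_on {v}" by (intro analytic_intros)
  then obtain k where "\<forall>\<^sub>F w in nhds v. k w ^ m = w"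
    using analytic_nth_root[of "\<lambda>w. w" v m] False assms by blast
  from eventually_nhds_x_imp_x[OF this] show ?thesis by (rule that)
qed

text \<open>The left inverse \<alpha> with \<alpha>(0) = 0 guarantees that \<beta>(s^k) stays away
  from 0 for small nonzero s, so that punctured neighbourhoods pull back to punctured
  neighbourhoods.\<close>

lemma eventually_at_zero_compose:
  assumes b: "\<beta> analytic_on {0}" "\<beta> 0 = 0" "\<alpha> 0 = 0" "\<forall>\<^sub>F s in nhds 0. \<alpha> (\<beta> s) = (s::complex)"
    and k: "k \<ge> (1::nat)" and P: "\<forall>\<^sub>F v in at 0. P v"
  shows "\<forall>\<^sub>F s in at 0. P (\<beta> (s ^ k))"
proof -
  have pow: "(\<lambda>s::complex. s ^ k) analytic_on {0}" by (intro analytic_intros)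
  have z: "(0::complex) ^ k = 0" using k by simp
  have "(\<beta> \<circ> (\<lambda>s. s ^ k)) analytic_on {0}" using b(1) pow by (intro analytic_on_compose) (auto simp: z)
  then have an: "(\<lambda>s. \<beta> (s ^ k)) analytic_on {0}" by (simp add: o_def)
  have "\<forall>\<^sub>F s in nhds 0. \<beta> (s ^ k) \<noteq> 0 \<longrightarrow> P (\<beta> (s ^ k))"
    using eventually_compose_analytic[OF an, of "\<lambda>v. v \<noteq> 0 \<longrightarrow> P v"] P z b(2) by (simp add: eventually_at_filter)
  moreover have "\<forall>\<^sub>F s in nhds 0. \<alpha> (\<beta> (s ^ k)) = s ^ k"
    using eventually_compose_analytic[OF pow, of "\<lambda>s. \<alpha> (\<beta> s) = s"] b(4) z by simp
  ultimately have "\<forall>\<^sub>F s in nhds 0. s \<noteq> 0 \<longrightarrow> P (\<beta> (s ^ k))"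
    by eventually_elim (metis b(3) power_not_zero)
  then show ?thesis by (simp add: eventually_at_filter)
qed

lemma rat_normal_form:
  assumes "rational_function A"
  obtains \<alpha> \<beta> where "\<alpha> analytic_on {0}" "\<alpha> 0 = 0" "\<beta> analytic_on {0}" "\<beta> 0 = 0"
    "\<forall>\<^sub>F s in nhds 0. \<alpha> (\<beta> s) = s" "\<forall>\<^sub>F w in nhds 0. \<beta> (\<alpha> w) = w"
    "\<forall>\<^sub>F w in nhds 0. A (param y w) = param (A y) (\<alpha> w ^ local_degree A y)"
    "\<forall>\<^sub>F s in nhds 0. A (param y (\<beta> s)) = param (A y) (s ^ local_degree A y)"
  by (rule mult_at_normal_form[OF rat_mult_at[OF assms, of y], unfolded param_zero])

text \<open>Two points of a fibre with local degrees m and m' are approached along one parameter s: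
  inserting s^m' at \<open>y\<close> and s^m at \<open>y'\<close> gives both sides the same value
  s^(m m') in the chart of the image. The hypothesis applies for small nonzero s, and the identity
  passes to s = 0.\<close>

lemma constant_on_fibres:
  assumes A: "rational_function A" and B: "holo B" and S: "finite S"
    and fib: "\<And>y y'. y \<notin> S \<Longrightarrow> y' \<notin> S \<Longrightarrow> A y = A y' \<Longrightarrow> B y = B y'"
    and eq: "A y = A y'"
  shows "B y = B y'"
proof -
  define m m' where "m = local_degree A y" and "m' = local_degree A y'"
  have m: "m \<ge> 1" "m' \<ge> 1" unfolding m_def m'_def by (rule rat_local_degree_pos[OF A])+
  obtain \<alpha> \<beta> where n: "\<alpha> analytic_on {0}" "\<alpha> 0 = 0" "\<beta> analytic_on {0}" "\<beta> 0 = 0"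
    "\<forall>\<^sub>F s in nhds 0. \<alpha> (\<beta> s) = s" "\<forall>\<^sub>F w in nhds 0. \<beta> (\<alpha> w) = w"
    "\<forall>\<^sub>F w in nhds 0. A (param y w) = param (A y) (\<alpha> w ^ local_degree A y)"
    "\<forall>\<^sub>F s in nhds 0. A (param y (\<beta> s)) = param (A y) (s ^ local_degree A y)"
    by (rule rat_normal_form[OF A, of y])
  note b = n(2,3,4,5) n(8)[folded m_def]
  obtain \<alpha>' \<beta>' where n': "\<alpha>' analytic_on {0}" "\<alpha>' 0 = 0" "\<beta>' analytic_on {0}" "\<beta>' 0 = 0"
    "\<forall>\<^sub>F s in nhds 0. \<alpha>' (\<beta>' s) = s" "\<forall>\<^sub>F w in nhds 0. \<beta>' (\<alpha>' w) = w"
    "\<forall>\<^sub>F w in nhds 0. A (param y' w) = param (A y') (\<alpha>' w ^ local_degree A y')"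
    "\<forall>\<^sub>F s in nhds 0. A (param y' (\<beta>' s)) = param (A y') (s ^ local_degree A y')"
    by (rule rat_normal_form[OF A, of y'])
  note b' = n'(2,3,4,5) n'(8)[folded m'_def]
  have pow: "(\<lambda>s::complex. s ^ k) analytic_on {0}" for k by (intro analytic_intros)
  have z: "(0::complex) ^ m = 0" "(0::complex) ^ m' = 0" using m by auto
  have h: "hol_at (\<lambda>s. B (param y (\<beta> (s ^ k)))) 0" if "\<beta> analytic_on {0}" "\<beta> 0 = 0" "k \<ge> 1" for y \<beta> k
  proof -
    have "(\<beta> \<circ> (\<lambda>s. s ^ k)) analytic_on {0}" using that pow by (intro analytic_on_compose) (auto simp: zero_power)
    from holo_hol_at[OF B hol_at_param_compose[OF this, of y]] show ?thesis by (simp add: o_def)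
  qed
  have 1: "\<forall>\<^sub>F s in at 0. param y (\<beta> (s ^ m')) \<notin> S"
    by (rule eventually_at_zero_compose[OF b(2,3,1,4) m(2) eventually_param_notin[OF S]])
  have 2: "\<forall>\<^sub>F s in at 0. param y' (\<beta>' (s ^ m)) \<notin> S"
    by (rule eventually_at_zero_compose[OF b'(2,3,1,4) m(1) eventually_param_notin[OF S]])
  have 3: "\<forall>\<^sub>F s in nhds 0. A (param y (\<beta> (s ^ m'))) = param (A y) ((s ^ m') ^ m)"
    using eventually_compose_analytic[OF pow[of m'], of "\<lambda>s. A (param y (\<beta> s)) = param (A y) (s ^ m)"] b(5) z by simp
  have 4: "\<forall>\<^sub>F s in nhds 0. A (param y' (\<beta>' (s ^ m))) = param (A y') ((s ^ m) ^ m')"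
    using eventually_compose_analytic[OF pow[of m], of "\<lambda>s. A (param y' (\<beta>' s)) = param (A y') (s ^ m')"] b'(5) z by simp
  have "\<forall>\<^sub>F s in at 0. A (param y (\<beta> (s ^ m'))) = param (A y) ((s ^ m') ^ m)"
    "\<forall>\<^sub>F s in at 0. A (param y' (\<beta>' (s ^ m))) = param (A y') ((s ^ m) ^ m')"
    using 3 4 by (auto simp: eventually_nhds_conv_at)
  with 1 2 have "\<forall>\<^sub>F s in at 0. B (param y (\<beta> (s ^ m'))) = B (param y' (\<beta>' (s ^ m)))"
    by eventually_elim (rule fib, auto simp: eq power_mult[symmetric] mult.commute)
  then have "\<not> (\<forall>\<^sub>F s in at 0. B (param y (\<beta> (s ^ m'))) \<noteq> B (param y' (\<beta>' (s ^ m))))"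
    using eventually_at_contradiction by blast
  then have "\<forall>\<^sub>F s in nhds 0. B (param y (\<beta> (s ^ m'))) = B (param y' (\<beta>' (s ^ m)))"
    using agree_dichotomy[OF h[OF b(2,3) m(2), of y] h[OF b'(2,3) m(1), of y']] by blast
  from eventually_nhds_x_imp_x[OF this] show ?thesis using z b(3) b'(3) by simp
qed

text \<open>Off 0 a local branch of the m-th root shows that \<phi> is holomorphic; at 0 it is
  continuous, so the singularity is removable.\<close>

lemma hol_at_pushforward:
  assumes m: "m \<ge> (1::nat)" and b: "b analytic_on {0}" "b 0 = 0"
    and ev: "\<forall>\<^sub>F s in nhds 0. \<phi> (s ^ m) = param c (b s)"
  shows "hol_at \<phi> 0"
proof -
  obtain e1 where e1: "e1 > 0" "b holomorphic_on ball 0 e1" using b(1) by (auto simp: analytic_at_ball)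
  obtain e2 where e2: "e2 > 0" "\<And>s. norm s < e2 \<Longrightarrow> \<phi> (s ^ m) = param c (b s)"
    using eventually_nhds_zero_norm[OF ev] by blast
  define e where "e = min e1 e2"
  have e: "e > 0" "b holomorphic_on ball 0 e" "\<And>s. norm s < e \<Longrightarrow> \<phi> (s ^ m) = param c (b s)"
    using e1 e2 by (auto simp: e_def intro: holomorphic_on_subset)
  define k where "k = (\<lambda>v. coord c (\<phi> v))"
  have kb: "k (s ^ m) = b s" if "norm s < e" for s using e(3)[OF that] by (simp add: k_def)
  have small: "norm s < r" if "norm (s ^ m) < r ^ m" "r > 0" for s :: complex and r
    using that by (metis norm_power power_less_imp_less_base less_imp_le)
  have cont: "continuous_on (ball 0 e) b" using e(2) by (rule holomorphic_on_imp_continuous_on)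
  have an: "k field_differentiable at v" if v: "v \<in> ball 0 (e ^ m) - {0}" for v
  proof -
    have "(\<lambda>w. w) analytic_on {v}" by (intro analytic_intros)
    then obtain \<sigma> where s: "\<sigma> analytic_on {v}" "\<forall>\<^sub>F w in nhds v. \<sigma> w ^ m = w"
      using analytic_nth_root[of "\<lambda>w. w" v m] v m by auto
    have sv: "\<sigma> v ^ m = v" using eventually_nhds_x_imp_x[OF s(2)] .
    then have "norm (\<sigma> v) < e" using small[of "\<sigma> v" e] v e(1) by simp
    then have "b analytic_on \<sigma> ` {v}" using e(2) by (auto simp: analytic_at intro!: exI[of _ "ball 0 e"])
    then have "(b \<circ> \<sigma>) analytic_on {v}" using s(1) by (intro analytic_on_compose)
    moreover have "\<forall>\<^sub>F w in nhds v. (b \<circ> \<sigma>) w = k w"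
    proof -
      have "\<forall>\<^sub>F w in nhds v. w \<in> ball 0 (e ^ m)" using v by (intro eventually_nhds_in_open) auto
      with s(2) show ?thesis
      proof eventually_elim
        case (elim w)
        then have "norm (\<sigma> w) < e" using small[of "\<sigma> w" e] e(1) by simp
        then show ?case using kb[of "\<sigma> w"] elim by simp
      qed
    qed
    ultimately have "k analytic_on {v}" by (rule analytic_on_eventually_eq)
    then show ?thesis by (simp add: analytic_on_imp_differentiable_at)
  qed
  have k0: "k 0 = 0" using kb[of 0] e(1) m b(2) by (simp add: zero_power)
  have "isCont k 0"
    unfolding continuous_at_eps_delta k0
  proof (intro allI impI)
    fix \<epsilon> :: real assume "\<epsilon> > 0"
    have "isCont b 0" using b(1) by (rule analytic_at_imp_isCont)
    then obtain d where d: "d > 0" "\<And>s. dist s 0 < d \<Longrightarrow> dist (b s) (b 0) < \<epsilon>"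
      using \<open>\<epsilon> > 0\<close> unfolding continuous_at_eps_delta by blast
    define r where "r = min d e"
    have r: "r > 0" using d e by (simp add: r_def)
    show "\<exists>d>0. \<forall>x'. dist x' 0 < d \<longrightarrow> dist (k x') 0 < \<epsilon>"
    proof (intro exI conjI allI impI)
      show "r ^ m > 0" using r by simp
      fix v :: complex assume v: "dist v 0 < r ^ m"
      obtain s where s: "s ^ m = v" using complex_root_exists[OF m] by blast
      then have "norm s < r" using small[of s r] v r by simp
      then show "dist (k v) 0 < \<epsilon>" using kb[of s] d(2)[of s] b(2) by (simp add: r_def s)
    qed
  qed
  have "k holomorphic_on ball 0 (e ^ m)"
  proof (rule no_isolated_singularity[where K = "{0}"])
    show "continuous_on (ball 0 (e ^ m)) k"
      unfolding continuous_on_eq_continuous_at[OF open_ball]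
      using an \<open>isCont k 0\<close> by (metis DiffI field_differentiable_imp_continuous_at singletonD)
    show "k holomorphic_on ball 0 (e ^ m) - {0}"
      unfolding holomorphic_on_def using an field_differentiable_at_within by blast
  qed auto
  moreover have em: "e ^ m > 0" using e(1) by simp
  ultimately have ka: "k analytic_on {0}" unfolding analytic_at_ball by blast
  have eq: "\<phi> v = param c (k v)" if "norm v < e ^ m" for v
  proof -
    obtain s where s: "s ^ m = v" using complex_root_exists[OF m] by blast
    then have "norm s < e" using small[of s e] that e(1) by simp
    then show ?thesis using e(3)[of s] kb[of s] s by simp
  qed
  have "\<phi> 0 = c" using eq[of 0] em k0 by simp
  moreover have "\<forall>\<^sub>F v in nhds 0. \<phi> v = param c (k v)"
    using eventually_nhds_in_open[of "ball (0::complex) (e ^ m)" 0] em eq by (auto elim!: eventually_mono)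
  ultimately show ?thesis unfolding hol_at_def using ka k0 by blast
qed

text \<open>Constancy on fibres makes C well defined, and near A(y) the normal form of A presents
  C(s^m) as an analytic expansion. The fibre condition needs checking only outside a finite set,
  which is what the applications can verify.\<close>

theorem holo_factor:
  assumes A: "rational_function A" and B: "holo B" and S: "finite S"
    and fib: "\<And>y y'. y \<notin> S \<Longrightarrow> y' \<notin> S \<Longrightarrow> A y = A y' \<Longrightarrow> B y = B y'"
  obtains C where "holo C" "B = C \<circ> A"
proof -
  note const = constant_on_fibres[OF A B S fib]
  define C where "C = (\<lambda>z. B (SOME y. A y = z))"
  have CA: "C (A y) = B y" for y
    unfolding C_def by (rule const) (auto intro: someI2)
  have "holo C"
    unfolding holo_def
  proof
    fix z
    obtain y where y: "A y = z" using rat_surj[OF A] by (metis surjD)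
    define m where "m = local_degree A y"
    have m: "m \<ge> 1" unfolding m_def by (rule rat_local_degree_pos[OF A])
    obtain \<alpha> \<beta> where n: "\<alpha> analytic_on {0}" "\<alpha> 0 = 0" "\<beta> analytic_on {0}" "\<beta> 0 = 0"
      "\<forall>\<^sub>F s in nhds 0. \<alpha> (\<beta> s) = s" "\<forall>\<^sub>F w in nhds 0. \<beta> (\<alpha> w) = w"
      "\<forall>\<^sub>F w in nhds 0. A (param y w) = param (A y) (\<alpha> w ^ local_degree A y)"
      "\<forall>\<^sub>F s in nhds 0. A (param y (\<beta> s)) = param (A y) (s ^ local_degree A y)"
      by (rule rat_normal_form[OF A, of y])
    note b = n(3,4) n(8)[folded m_def, unfolded y]
    have "hol_at (\<lambda>s. B (param y (\<beta> s))) 0"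
      by (rule holo_hol_at[OF B hol_at_param_compose[OF b(1)]])
    then obtain g where g: "g analytic_on {0}" "g 0 = 0" "\<forall>\<^sub>F s in nhds 0. B (param y (\<beta> s)) = param (B y) (g s)"
      unfolding hol_at_def by (auto simp: b(2))
    have "\<forall>\<^sub>F s in nhds 0. C (param z (s ^ m)) = param (B y) (g s)"
      using b(3) g(3) by eventually_elim (metis CA)
    then show "hol_at (\<lambda>w. C (param z w)) 0" by (rule hol_at_pushforward[OF m g(1,2)])
  qed
  moreover have "B = C \<circ> A" using CA by auto
  ultimately show thesis by (rule that)
qed

lemma rational_of_degree_id: "rational_of_degree 1 id"
proof -
  have "rat_map [:0, 1:] 1 z = id z" for z by (cases z) auto
  then have "id = rat_map [:0, 1:] 1" by (intro ext) simp
  then show ?thesis unfolding rational_of_degree_def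
    by (intro conjI exI[of _ "[:0, 1:]"] exI[of _ 1]) auto
qed

text \<open>Degree one makes fibres singletons, so the identity factors through \<open>h\<close>;
  the factor is rational and has degree one by multiplicativity.\<close>

lemma degree_one_inverse:
  assumes "rational_of_degree 1 h"
  obtains k where "rational_of_degree 1 k" "k \<circ> h = id" "h \<circ> k = id"
proof -
  have rh: "rational_function h" using assms by (rule rational_of_degree_imp_rational)
  have inj: "y = y'" if "h y = h y'" for y y'
    using rat_card_fibre_le[OF assms, of "h y'"] card_le_Suc0_iff_eq[OF rat_finite_fibre[OF rh, of "h y'"]] that by auto
  obtain k where k: "holo k" "id = k \<circ> h"
    by (rule holo_factor[OF rh holo_id, of "{}"]) (auto dest: inj)
  have rk: "rational_function k"
    using k by (intro holo_imp_rational) (metis comp_apply cp1.distinct(1) id_apply)+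
  then obtain n where n: "rational_of_degree n k" by (auto simp: rational_function_def)
  then have "rational_of_degree (n * 1) (k \<circ> h)" using assms by (rule rational_of_degree_compose)
  then have "n = 1" using rational_of_degree_id rational_of_degree_unique unfolding k(2)[symmetric] by fastforce
  moreover have "h \<circ> k = id"
    using k(2) rat_surj[OF rh] by (metis (no_types, lifting) ext comp_apply id_apply surjD)
  ultimately show thesis using that[of k] n k(2) by simp
qed

section \<open>Lifting through a rational function\<close>

definition lift_on :: "(cp1 \<Rightarrow> cp1) \<Rightarrow> (complex \<Rightarrow> cp1) \<Rightarrow> (complex \<Rightarrow> cp1) \<Rightarrow> complex set \<Rightarrow> bool" where
  "lift_on \<theta> \<psi> \<phi> S \<longleftrightarrow> (\<forall>w\<in>S. hol_at \<phi> w \<and> \<theta> (\<phi> w) = \<psi> w)"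

text \<open>At a point of local degree one \<theta> has a local inverse, so two lifts that meet
  there agree nearby, and the identity theorem spreads this over S.\<close>

lemma lift_unique:
  assumes \<theta>: "rational_function \<theta>" and S: "open S" "connected S"
    and l: "lift_on \<theta> \<psi> \<phi>1 S" "lift_on \<theta> \<psi> \<phi>2 S"
    and u: "u \<in> S" "\<phi>1 u = \<phi>2 u" "local_degree \<theta> (\<phi>1 u) = 1" and x: "x \<in> S"
  shows "\<phi>1 x = \<phi>2 x"
proof -
  define y where "y = \<phi>1 u"
  obtain \<alpha> \<beta> where n: "\<alpha> analytic_on {0}" "\<alpha> 0 = 0" "\<beta> analytic_on {0}" "\<beta> 0 = 0"
    "\<forall>\<^sub>F s in nhds 0. \<alpha> (\<beta> s) = s" "\<forall>\<^sub>F w in nhds 0. \<beta> (\<alpha> w) = w"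
    "\<forall>\<^sub>F w in nhds 0. \<theta> (param y w) = param (\<theta> y) (\<alpha> w ^ local_degree \<theta> y)"
    "\<forall>\<^sub>F s in nhds 0. \<theta> (param y (\<beta> s)) = param (\<theta> y) (s ^ local_degree \<theta> y)"
    by (rule rat_normal_form[OF \<theta>, of y])
  have h: "hol_at \<phi>1 u" "hol_at \<phi>2 u" using l u unfolding lift_on_def by auto
  obtain g1 where g1: "g1 analytic_on {u}" "g1 u = 0" "\<forall>\<^sub>F w in nhds u. \<phi>1 w = param y (g1 w)"
    using h(1) unfolding hol_at_def y_def by blast
  obtain g2 where g2: "g2 analytic_on {u}" "g2 u = 0" "\<forall>\<^sub>F w in nhds u. \<phi>2 w = param y (g2 w)"
    using h(2) unfolding hol_at_def y_def u(2) by blast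
  note g = g1 g2
  have ev: "\<forall>\<^sub>F w in nhds 0. \<beta> (\<alpha> w) = w \<and> \<theta> (param y w) = param (\<theta> y) (\<alpha> w)"
    using n(6,7) u(3) by (auto simp: y_def elim: eventually_elim2)
  have "\<forall>\<^sub>F w in nhds u. \<beta> (\<alpha> (g1 w)) = g1 w \<and> \<theta> (param y (g1 w)) = param (\<theta> y) (\<alpha> (g1 w))"
    using eventually_compose_analytic[OF g(1), of "\<lambda>w. \<beta> (\<alpha> w) = w \<and> \<theta> (param y w) = param (\<theta> y) (\<alpha> w)"] ev g(2) by simp
  moreover have "\<forall>\<^sub>F w in nhds u. \<beta> (\<alpha> (g2 w)) = g2 w \<and> \<theta> (param y (g2 w)) = param (\<theta> y) (\<alpha> (g2 w))"
    using eventually_compose_analytic[OF g(4), of "\<lambda>w. \<beta> (\<alpha> w) = w \<and> \<theta> (param y w) = param (\<theta> y) (\<alpha> w)"] ev g(5) by simp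
  moreover have "\<forall>\<^sub>F w in nhds u. w \<in> S" using S u by (intro eventually_nhds_in_open)
  ultimately have "\<forall>\<^sub>F w in nhds u. \<phi>1 w = \<phi>2 w"
    using g(3,6)
  proof eventually_elim
    case (elim w)
    have "\<theta> (\<phi>1 w) = \<theta> (\<phi>2 w)" using l elim(3) by (simp add: lift_on_def)
    then have "param (\<theta> y) (\<alpha> (g1 w)) = param (\<theta> y) (\<alpha> (g2 w))" using elim by metis
    then have "\<alpha> (g1 w) = \<alpha> (g2 w)" by (simp only: param_inject)
    then have "g1 w = g2 w" using elim by metis
    then show ?case using elim by simp
  qed
  then have "\<forall>\<^sub>F w in at u. \<phi>1 w = \<phi>2 w" by (simp add: eventually_nhds_conv_at)
  then have "\<not> (\<forall>\<^sub>F w in at u. \<phi>1 w \<noteq> \<phi>2 w)" using eventually_at_contradiction by blast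
  then show ?thesis
    using l by (intro hol_identity[OF S _ _ u(1) _ x]) (auto simp: lift_on_def)
qed

lemma eventually_analytic_nhds:
  assumes "g analytic_on {w0}"
  shows "\<forall>\<^sub>F w in nhds w0. g analytic_on {w}"
proof -
  obtain S where "open S" "w0 \<in> S" "g holomorphic_on S" using assms by (auto simp: analytic_at)
  then show ?thesis unfolding eventually_nhds analytic_at by blast
qed

text \<open>
  Every root of unity of order the local degree of \<open>\<theta>\<close> at a point of the central fibre yields one
  lift. Their number is the sum of the local degrees, that is the degree of \<open>\<theta>\<close>, so these lifts
  exhaust every nearby fibre.
\<close>

lemma local_lifts:
  assumes \<theta>: "rational_of_degree N \<theta>" and \<psi>: "mult_at \<psi> 0 M"
    and dvd: "\<And>y. \<theta> y = \<psi> 0 \<Longrightarrow> local_degree \<theta> y dvd M"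
  obtains \<delta> where "\<delta> > 0"
    "\<And>u y. norm u < \<delta> \<Longrightarrow> \<theta> y = \<psi> u \<Longrightarrow> \<exists>\<phi>. lift_on \<theta> \<psi> \<phi> (ball 0 \<delta>) \<and> \<phi> u = y"
proof -
  have r: "rational_function \<theta>" using \<theta> by (rule rational_of_degree_imp_rational)
  define Y where "Y = {y. \<theta> y = \<psi> 0}"
  have finY: "finite Y" unfolding Y_def by (rule rat_finite_fibre[OF r])
  define m where "m = local_degree \<theta>"
  have m: "m y \<ge> 1" for y unfolding m_def by (rule rat_local_degree_pos[OF r])
  obtain \<alpha> \<beta>' where a: "\<alpha> analytic_on {0}" "\<alpha> 0 = 0" "\<beta>' analytic_on {0}" "\<beta>' 0 = 0"
    "\<forall>\<^sub>F s in nhds 0. \<alpha> (\<beta>' s) = s" "\<forall>\<^sub>F w in nhds 0. \<beta>' (\<alpha> w) = w"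
    "\<forall>\<^sub>F w in nhds 0. \<psi> w = param (\<psi> 0) (\<alpha> w ^ M)"
    "\<forall>\<^sub>F s in nhds 0. \<psi> (\<beta>' s) = param (\<psi> 0) (s ^ M)"
    by (rule mult_at_normal_form[OF \<psi>])
  have M: "M \<ge> 1" using \<psi> by (simp add: mult_at_def)
  have a_nz: "\<forall>\<^sub>F w in nhds 0. w \<noteq> 0 \<longrightarrow> \<alpha> w \<noteq> 0"
    using a(6) by eventually_elim (metis a(4))
  have "\<forall>y. \<exists>\<gamma> \<beta>. \<beta> analytic_on {0} \<and> \<beta> 0 = 0 \<and> (\<forall>\<^sub>F s in nhds 0. \<gamma> (\<beta> s) = s) \<and>
     (\<forall>\<^sub>F s in nhds 0. \<theta> (param y (\<beta> s)) = param (\<theta> y) (s ^ m y))"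
  proof
    fix y
    show "\<exists>\<gamma> \<beta>. \<beta> analytic_on {0} \<and> \<beta> 0 = 0 \<and> (\<forall>\<^sub>F s in nhds 0. \<gamma> (\<beta> s) = s) \<and>
     (\<forall>\<^sub>F s in nhds 0. \<theta> (param y (\<beta> s)) = param (\<theta> y) (s ^ m y))"
      by (rule rat_normal_form[OF r, of y]) (auto simp: m_def)
  qed
  then obtain \<gamma> where "\<forall>y. \<exists>\<beta>. \<beta> analytic_on {0} \<and> \<beta> 0 = 0 \<and> (\<forall>\<^sub>F s in nhds 0. \<gamma> y (\<beta> s) = s) \<and>
     (\<forall>\<^sub>F s in nhds 0. \<theta> (param y (\<beta> s)) = param (\<theta> y) (s ^ m y))"
    by (rule choice[THEN exE])
  then obtain \<beta> where bb: "\<forall>y. \<beta> y analytic_on {0} \<and> \<beta> y 0 = 0 \<and> (\<forall>\<^sub>F s in nhds 0. \<gamma> y (\<beta> y s) = s) \<and>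
     (\<forall>\<^sub>F s in nhds 0. \<theta> (param y (\<beta> y s)) = param (\<theta> y) (s ^ m y))"
    by (rule choice[THEN exE])
  then have b: "\<beta> y analytic_on {0}" "\<beta> y 0 = 0" "\<forall>\<^sub>F s in nhds 0. \<gamma> y (\<beta> y s) = s"
     "\<forall>\<^sub>F s in nhds 0. \<theta> (param y (\<beta> y s)) = param (\<theta> y) (s ^ m y)" for y by blast+
  \<comment> \<open>In normal coordinates \<theta> is s^m and \<psi> is \<alpha>^M; as m divides M,
    the solutions of s^m = \<alpha>^M are \<zeta> \<alpha>^(M div m) with \<zeta>^m = 1.\<close>
  define t where "t = (\<lambda>y \<zeta> w. \<zeta> * \<alpha> w ^ (M div m y))"
  define g where "g = (\<lambda>y \<zeta> w. \<beta> y (t y \<zeta> w))"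
  define I where "I = Sigma Y (\<lambda>y. {\<zeta>::complex. \<zeta> ^ m y = 1})"
  have finI: "finite I" unfolding I_def
    using finY m by (intro finite_SigmaI finite_roots_unity) auto
  have k: "M div m y \<ge> 1" "m y * (M div m y) = M" if "y \<in> Y" for y
    using dvd[of y] that M m[of y] unfolding Y_def m_def by (auto simp: div_greater_zero_iff intro!: dvd_imp_le)
  have t: "t y \<zeta> analytic_on {0}" for y \<zeta> unfolding t_def using a(1) by (intro analytic_intros)
  have t0: "t y \<zeta> 0 = 0" if "y \<in> Y" for y \<zeta> using k[OF that] a(2) by (simp add: t_def zero_power)
  have g: "g y \<zeta> analytic_on {0}" "g y \<zeta> 0 = 0" if "y \<in> Y" for y \<zeta>
  proof -
    have "(\<beta> y \<circ> t y \<zeta>) analytic_on {0}" using t b(1) t0[OF that] by (intro analytic_on_compose) auto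
    then show "g y \<zeta> analytic_on {0}" by (simp add: g_def o_def)
    show "g y \<zeta> 0 = 0" using t0[OF that] b(2) by (simp add: g_def)
  qed
  define \<phi> where "\<phi> = (\<lambda>i w. param (fst i) (g (fst i) (snd i) w))"
  have ev1: "\<forall>\<^sub>F w in nhds 0. hol_at (\<phi> i) w" if "i \<in> I" for i
  proof -
    have "fst i \<in> Y" using that by (auto simp: I_def)
    from eventually_analytic_nhds[OF g(1)[OF this]] show ?thesis
      by (rule eventually_mono) (unfold \<phi>_def, rule hol_at_param_compose)
  qed
  have ev2: "\<forall>\<^sub>F w in nhds 0. \<theta> (\<phi> i w) = \<psi> w" if "i \<in> I" for i
  proof -
    obtain y \<zeta> where i: "i = (y, \<zeta>)" "y \<in> Y" "\<zeta> ^ m y = 1" using \<open>i \<in> I\<close> by (auto simp: I_def)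
    have "\<forall>\<^sub>F w in nhds 0. \<theta> (param y (g y \<zeta> w)) = param (\<theta> y) (t y \<zeta> w ^ m y)"
      using eventually_compose_analytic[OF t, of "\<lambda>s. \<theta> (param y (\<beta> y s)) = param (\<theta> y) (s ^ m y)" y \<zeta>]
        b(4)[of y] t0[OF i(2)] by (simp add: g_def)
    with a(7) show ?thesis
    proof eventually_elim
      case (elim w)
      have "t y \<zeta> w ^ m y = \<alpha> w ^ M"
        using i(3) k(2)[OF i(2)] by (simp add: t_def power_mult_distrib mult.commute flip: power_mult)
      moreover have "\<theta> y = \<psi> 0" using i(2) by (simp add: Y_def)
      ultimately show ?case using elim by (simp add: \<phi>_def i(1))
    qed
  qed
  \<comment> \<open>Distinct indices must give distinct values off 0 for the count to work. Over the
    same \<open>y\<close> the left inverse \<gamma> recovers \<open>t\<close>; over different points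
    the charts are disjoint.\<close>
  have ev3: "\<forall>\<^sub>F w in nhds 0. w \<noteq> 0 \<longrightarrow> \<phi> i w \<noteq> \<phi> j w" if "i \<in> I" "j \<in> I" "i \<noteq> j" for i j
  proof -
    obtain y \<zeta> where i: "i = (y, \<zeta>)" "y \<in> Y" using \<open>i \<in> I\<close> by (auto simp: I_def)
    obtain y' \<zeta>' where j: "j = (y', \<zeta>')" "y' \<in> Y" using \<open>j \<in> I\<close> by (auto simp: I_def)
    show ?thesis
    proof (cases "y = y'")
      case True
      have "\<forall>\<^sub>F w in nhds 0. \<gamma> y (g y \<zeta> w) = t y \<zeta> w" "\<forall>\<^sub>F w in nhds 0. \<gamma> y (g y \<zeta>' w) = t y \<zeta>' w"
        using eventually_compose_analytic[OF t, of "\<lambda>s. \<gamma> y (\<beta> y s) = s" y \<zeta>]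
          eventually_compose_analytic[OF t, of "\<lambda>s. \<gamma> y (\<beta> y s) = s" y \<zeta>']
          b(3)[of y] t0[OF i(2)] by (simp_all add: g_def)
      with a_nz show ?thesis
      proof eventually_elim
        case (elim w)
        show ?case
        proof
          assume w: "w \<noteq> 0"
          have "t y \<zeta> w \<noteq> t y \<zeta>' w" using \<open>i \<noteq> j\<close> True elim(1) w by (simp add: t_def i j)
          then have "g y \<zeta> w \<noteq> g y \<zeta>' w" using elim by metis
          then show "\<phi> i w \<noteq> \<phi> j w" using True by (simp add: \<phi>_def i j)
        qed
      qed
    next
      case False
      obtain e where e: "e > 0" "\<And>v w. norm v < e \<Longrightarrow> norm w < e \<Longrightarrow> param y v \<noteq> param y' w"
        using param_separate[OF False] by metis
      have ball: "\<forall>\<^sub>F w in nhds 0. norm (w::complex) < e"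
        using e(1) by (metis eventually_nhds_metric dist_0_norm dist_commute)
      have "\<forall>\<^sub>F w in nhds 0. norm (g y \<zeta> w) < e" "\<forall>\<^sub>F w in nhds 0. norm (g y' \<zeta>' w) < e"
        using eventually_compose_analytic[OF g(1)[OF i(2)], of "\<lambda>w. norm w < e" \<zeta>]
          eventually_compose_analytic[OF g(1)[OF j(2)], of "\<lambda>w. norm w < e" \<zeta>'] g(2)[OF i(2)] g(2)[OF j(2)] ball by auto
      then show ?thesis by eventually_elim (use e(2) in \<open>simp add: \<phi>_def i j\<close>)
    qed
  qed
  have "\<forall>\<^sub>F w in nhds 0. \<forall>i\<in>I. hol_at (\<phi> i) w \<and> \<theta> (\<phi> i w) = \<psi> w"
    using ev1 ev2 by (intro eventually_ball_finite[OF finI]) (auto intro: eventually_conj)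
  moreover have "\<forall>\<^sub>F w in nhds 0. \<forall>i\<in>I. \<forall>j\<in>I. i \<noteq> j \<longrightarrow> w \<noteq> 0 \<longrightarrow> \<phi> i w \<noteq> \<phi> j w"
    using ev3 by (intro eventually_ball_finite[OF finI] ballI) auto
  ultimately have "\<forall>\<^sub>F w in nhds 0. (\<forall>i\<in>I. hol_at (\<phi> i) w \<and> \<theta> (\<phi> i w) = \<psi> w) \<and>
     (\<forall>i\<in>I. \<forall>j\<in>I. i \<noteq> j \<longrightarrow> w \<noteq> 0 \<longrightarrow> \<phi> i w \<noteq> \<phi> j w)" by (rule eventually_conj)
  then obtain \<delta> where d: "\<delta> > 0"
    "\<And>w. norm w < \<delta> \<Longrightarrow> (\<forall>i\<in>I. hol_at (\<phi> i) w \<and> \<theta> (\<phi> i w) = \<psi> w) \<and>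
     (\<forall>i\<in>I. \<forall>j\<in>I. i \<noteq> j \<longrightarrow> w \<noteq> 0 \<longrightarrow> \<phi> i w \<noteq> \<phi> j w)"
    using eventually_nhds_zero_norm by blast
  have lift: "lift_on \<theta> \<psi> (\<phi> i) (ball 0 \<delta>)" if "i \<in> I" for i
    using d(2) that unfolding lift_on_def by auto
  have "\<exists>\<phi>. lift_on \<theta> \<psi> \<phi> (ball 0 \<delta>) \<and> \<phi> u = y" if u: "norm u < \<delta>" and y: "\<theta> y = \<psi> u" for u y
  proof (cases "u = 0")
    case True
    then have yY: "y \<in> Y" using y by (simp add: Y_def)
    then have "(y, 1) \<in> I" by (simp add: I_def)
    moreover have "\<phi> (y, 1) u = y" using g(2)[OF yY] True by (simp add: \<phi>_def)
    ultimately show ?thesis using lift by blast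
  next
    case False
    have "(\<lambda>i. \<phi> i u) ` I = {y. \<theta> y = \<psi> u}"
    proof (rule card_seteq)
      show "finite {y. \<theta> y = \<psi> u}" by (rule rat_finite_fibre[OF r])
      show "(\<lambda>i. \<phi> i u) ` I \<subseteq> {y. \<theta> y = \<psi> u}" using d(2)[OF u] by auto
      have "card I = (\<Sum>y\<in>Y. card {\<zeta>::complex. \<zeta> ^ m y = 1})"
        unfolding I_def using finY m by (intro card_SigmaI) (auto intro!: finite_roots_unity)
      also have "\<dots> = (\<Sum>y\<in>Y. m y)"
        using m by (intro sum.cong refl card_roots_unity_eq) (simp add: Suc_le_eq)
      also have "\<dots> = N" unfolding Y_def m_def by (rule rat_sum_fibre[OF \<theta>])
      finally have "card ((\<lambda>i. \<phi> i u) ` I) = N"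
        using d(2)[OF u] False by (subst card_image) (auto simp: inj_on_def)
      then show "card {y. \<theta> y = \<psi> u} \<le> card ((\<lambda>i. \<phi> i u) ` I)"
        using rat_card_fibre_le[OF \<theta>] by simp
    qed
    moreover have "y \<in> {y. \<theta> y = \<psi> u}" using y by simp
    ultimately have "y \<in> (\<lambda>i. \<phi> i u) ` I" by simp
    then obtain i where "i \<in> I" "\<phi> i u = y" by auto
    then show ?thesis using lift[of i] by (intro exI[of _ "\<phi> i"]) simp
  qed
  with d(1) show thesis by (rule that)
qed

section \<open>Continuation of lifts over growing discs\<close>

text \<open>Strict convexity of a round disc, from the parallelogram law. It makes two overlapping
  discs of equal radius centred on a circle meet inside that circle, where their lifts can be
  compared.\<close>

lemma midpoint_in_ball:
  fixes a :: complex
  assumes "dist a w = \<rho>" "dist a w' = \<rho>" "w \<noteq> w'"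
  shows "dist a ((w + w') / 2) < \<rho>"
proof -
  define x y where "x = w - a" and "y = w' - a"
  have n: "norm x = \<rho>" "norm y = \<rho>" "norm (x - y) > 0"
    using assms by (auto simp: x_def y_def dist_norm norm_minus_commute)
  have "norm (x + y) ^ 2 + norm (x - y) ^ 2 = 2 * norm x ^ 2 + 2 * norm y ^ 2"
    by (simp add: cmod_power2) (simp add: power2_eq_square algebra_simps)
  then have "norm (x + y) ^ 2 = 4 * \<rho> ^ 2 - norm (x - y) ^ 2" using n by simp
  also have "\<dots> < (2 * \<rho>) ^ 2" using n(3) by (simp add: power_mult_distrib)
  finally have "norm (x + y) < 2 * \<rho>"
    using n(1) norm_ge_zero by (metis mult_nonneg_nonneg power_less_imp_less_base zero_le_numeral)
  moreover have "dist a ((w + w') / 2) = norm ((x + y) / 2)"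
    unfolding dist_norm norm_minus_commute[of a] by (rule arg_cong[of _ _ norm]) (simp add: x_def y_def field_simps)
  ultimately show ?thesis by (simp add: norm_divide)
qed

definition lifts_everywhere :: "(cp1 \<Rightarrow> cp1) \<Rightarrow> (complex \<Rightarrow> cp1) \<Rightarrow> complex set \<Rightarrow> bool" where
  "lifts_everywhere \<theta> \<psi> S \<longleftrightarrow> (\<forall>u\<in>S. \<forall>y. \<theta> y = \<psi> u \<longrightarrow> (\<exists>\<phi>. lift_on \<theta> \<psi> \<phi> S \<and> \<phi> u = y))"

lemma lifts_everywhere_subset: "lifts_everywhere \<theta> \<psi> S \<Longrightarrow> T \<subseteq> S \<Longrightarrow> lifts_everywhere \<theta> \<psi> T"
  unfolding lifts_everywhere_def lift_on_def by (meson subsetD)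

text \<open>The disc grows by \<delta> by attaching to each boundary point the local lift that
  continues \<phi>. All intersections that occur are convex, hence connected, so the pieces fit
  together.\<close>

lemma extend_lift:
  assumes \<theta>: "rational_function \<theta>" and \<psi>: "finite {u. \<exists>y. \<theta> y = \<psi> u \<and> local_degree \<theta> y \<noteq> 1}"
    and \<phi>: "lift_on \<theta> \<psi> \<phi> (ball a \<rho>)" and \<rho>: "\<rho> > 0" and \<delta>: "\<delta> > 0"
    and good: "\<And>w. dist a w = \<rho> \<Longrightarrow> lifts_everywhere \<theta> \<psi> (ball w \<delta>)"
  obtains \<Phi> where "lift_on \<theta> \<psi> \<Phi> (ball a (\<rho> + \<delta>))" "\<Phi> a = \<phi> a"
proof -
  have "\<exists>\<phi>'. lift_on \<theta> \<psi> \<phi>' (ball w \<delta>) \<and> (\<forall>x\<in>ball w \<delta> \<inter> ball a \<rho>. \<phi>' x = \<phi> x)" if w: "dist a w = \<rho>" for w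
  proof -
    let ?I = "ball w \<delta> \<inter> ball a \<rho>"
    have "w \<in> closure (ball a \<rho>)" using w \<rho> by (simp add: closure_ball)
    then have ne: "?I \<noteq> {}" using \<delta> by (metis centre_in_ball disjoint_iff open_Int_closure_eq_empty open_ball)
    have op: "open ?I" by (intro open_Int open_ball)
    have con: "connected ?I" by (intro convex_connected convex_Int convex_ball)
    \<comment> \<open>A nonempty open set cannot lie among the finitely many points with ramified
      fibre, and \<open>lift_unique\<close> has to start at an unramified one.\<close>
    have "infinite ?I" using finite_imp_not_open[of ?I] op ne by blast
    then obtain u where u: "u \<in> ?I" "\<And>y. \<theta> y = \<psi> u \<Longrightarrow> local_degree \<theta> y = 1"
      using \<psi> by (metis (mono_tags, lifting) finite_subset mem_Collect_eq subsetI)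
    have tu: "\<theta> (\<phi> u) = \<psi> u" using \<phi> u(1) by (simp add: lift_on_def)
    then obtain \<phi>' where l: "lift_on \<theta> \<psi> \<phi>' (ball w \<delta>)" "\<phi>' u = \<phi> u"
      using good[OF w] u(1) unfolding lifts_everywhere_def by blast
    have "\<phi>' x = \<phi> x" if "x \<in> ?I" for x
      by (rule lift_unique[OF \<theta> op con, of \<psi> \<phi>' \<phi> u])
        (use l \<phi> u tu that in \<open>auto simp: lift_on_def\<close>)
    then show ?thesis using l by blast
  qed
  then have "\<forall>w. \<exists>\<phi>'. dist a w = \<rho> \<longrightarrow> lift_on \<theta> \<psi> \<phi>' (ball w \<delta>) \<and> (\<forall>x\<in>ball w \<delta> \<inter> ball a \<rho>. \<phi>' x = \<phi> x)"
    by blast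
  from choice[OF this] obtain \<phi>' where
    p: "\<And>w. dist a w = \<rho> \<Longrightarrow> lift_on \<theta> \<psi> (\<phi>' w) (ball w \<delta>)"
      "\<And>w x. dist a w = \<rho> \<Longrightarrow> x \<in> ball w \<delta> \<Longrightarrow> x \<in> ball a \<rho> \<Longrightarrow> \<phi>' w x = \<phi> x"
    by blast
  have consistent: "\<phi>' w x = \<phi>' w' x"
    \<comment> \<open>Both local lifts agree with \<phi> near the midpoint of the centres, which
      lies in both small discs and inside the old disc; the identity theorem carries this to
      \<open>x\<close>.\<close>
    if w: "dist a w = \<rho>" "dist a w' = \<rho>" and x: "x \<in> ball w \<delta>" "x \<in> ball w' \<delta>" for w w' x
  proof (cases "w = w'")
    case False
    let ?J = "ball w \<delta> \<inter> ball w' \<delta>" and ?m = "(w + w') / 2"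
    have con: "connected ?J" by (intro convex_connected convex_Int convex_ball)
    have "dist w w' < 2 * \<delta>" using x dist_triangle_half_r[of x w "2 * \<delta>" w'] by (simp add: dist_commute)
    then have m: "?m \<in> ?J"
    proof -
      have "dist w ?m = norm ((w - w') / 2)" "dist w' ?m = norm (- ((w - w') / 2))"
        unfolding dist_norm by (rule arg_cong[of _ _ norm], simp add: field_simps)+
      then show ?thesis using \<open>dist w w' < 2 * \<delta>\<close>
        unfolding norm_minus_cancel norm_divide by (simp add: dist_norm)
    qed
    have "?m \<in> ball a \<rho>" using midpoint_in_ball[OF w False] by simp
    then have "\<forall>\<^sub>F v in nhds ?m. v \<in> ?J \<inter> ball a \<rho>" using m by (intro eventually_nhds_in_open) auto
    then have "\<forall>\<^sub>F v in nhds ?m. \<phi>' w v = \<phi>' w' v" by eventually_elim (use p(2) w in auto)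
    then have "\<forall>\<^sub>F v in at ?m. \<phi>' w v = \<phi>' w' v" by (simp add: eventually_nhds_conv_at)
    then have "\<not> (\<forall>\<^sub>F v in at ?m. \<phi>' w v \<noteq> \<phi>' w' v)" using eventually_at_contradiction by blast
    then show ?thesis
      using p(1)[OF w(1)] p(1)[OF w(2)] x m
      by (intro hol_identity[of ?J "\<phi>' w" "\<phi>' w'" ?m x]) (auto simp: lift_on_def con)
  qed auto
  \<comment> \<open>Radial projection onto the circle of radius \<rho>: it selects a boundary disc
    that contains a given point of the new ring.\<close>
  define \<pi> where "\<pi> = (\<lambda>x. a + of_real (\<rho> / norm (x - a)) * (x - a))"
  have pi: "dist a (\<pi> x) = \<rho>" "x \<in> ball (\<pi> x) \<delta>" if "x \<notin> ball a \<rho>" "x \<in> ball a (\<rho> + \<delta>)" for x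
  proof -
    have nx: "norm (x - a) \<ge> \<rho>" "norm (x - a) < \<rho> + \<delta>" using that by (auto simp: dist_norm norm_minus_commute)
    then have pos: "norm (x - a) > 0" using \<rho> by linarith
    then show "dist a (\<pi> x) = \<rho>" using \<rho> by (simp add: \<pi>_def dist_norm norm_mult norm_divide)
    have "x - \<pi> x = of_real (1 - \<rho> / norm (x - a)) * (x - a)" by (simp add: \<pi>_def algebra_simps)
    then have "norm (x - \<pi> x) = \<bar>1 - \<rho> / norm (x - a)\<bar> * norm (x - a)"
      by (simp only: norm_mult norm_of_real)
    also have "\<bar>1 - \<rho> / norm (x - a)\<bar> = 1 - \<rho> / norm (x - a)"
      using nx pos by simp
    also have "(1 - \<rho> / norm (x - a)) * norm (x - a) = norm (x - a) - \<rho>" using pos by (simp add: field_simps)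
    finally show "x \<in> ball (\<pi> x) \<delta>" using nx by (simp add: dist_norm norm_minus_commute)
  qed
  define \<Phi> where "\<Phi> = (\<lambda>x. if x \<in> ball a \<rho> then \<phi> x else \<phi>' (\<pi> x) x)"
  have near: "\<Phi> v = \<phi>' w v" if "dist a w = \<rho>" "v \<in> ball w \<delta>" "v \<in> ball a (\<rho> + \<delta>)" for w v
    using that p(2)[of w v] consistent[of "\<pi> v" w v] pi[of v] by (auto simp: \<Phi>_def)
  have "hol_at \<Phi> x \<and> \<theta> (\<Phi> x) = \<psi> x" if x: "x \<in> ball a (\<rho> + \<delta>)" for x
  proof (cases "x \<in> ball a \<rho>")
    case True
    have "\<forall>\<^sub>F v in nhds x. v \<in> ball a \<rho>" using True by (intro eventually_nhds_in_open) auto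
    then have ev: "\<forall>\<^sub>F v in nhds x. \<Phi> v = \<phi> v" by eventually_elim (simp add: \<Phi>_def)
    then show ?thesis using \<phi> True hol_at_cong[OF ev] by (auto simp: lift_on_def \<Phi>_def)
  next
    case False
    note q = pi[OF False x]
    have "\<forall>\<^sub>F v in nhds x. v \<in> ball (\<pi> x) \<delta> \<inter> ball a (\<rho> + \<delta>)" using q x by (intro eventually_nhds_in_open) auto
    then have ev: "\<forall>\<^sub>F v in nhds x. \<Phi> v = \<phi>' (\<pi> x) v" by eventually_elim (use near q in auto)
    then show ?thesis
      using p(1)[OF q(1)] q(2) hol_at_cong[OF ev] near[OF q x] by (auto simp: lift_on_def)
  qed
  then have "lift_on \<theta> \<psi> \<Phi> (ball a (\<rho> + \<delta>))" by (simp add: lift_on_def)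
  moreover have "\<Phi> a = \<phi> a" using \<rho> by (simp add: \<Phi>_def)
  ultimately show thesis by (rule that)
qed

text \<open>A Lebesgue number \<delta> of the compact closed disc serves at every boundary point, so
  finitely many enlargements by the same \<delta> reach radius R.\<close>

lemma lift_on_ball:
  assumes \<theta>: "rational_function \<theta>" and \<psi>: "finite {u. \<exists>y. \<theta> y = \<psi> u \<and> local_degree \<theta> y \<noteq> 1}"
    and loc: "\<And>c. \<exists>\<delta>>0. lifts_everywhere \<theta> \<psi> (ball c \<delta>)"
    and y0: "\<theta> y0 = \<psi> a" and R: "R > 0"
  obtains \<phi> where "lift_on \<theta> \<psi> \<phi> (ball a R)" "\<phi> a = y0"
proof -
  let ?G = "{ball c \<delta> | c \<delta>. \<delta> > 0 \<and> lifts_everywhere \<theta> \<psi> (ball c \<delta>)}"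
  have cov: "cball a R \<subseteq> \<Union>?G"
  proof
    fix x
    obtain \<delta> where "\<delta> > 0" "lifts_everywhere \<theta> \<psi> (ball x \<delta>)" using loc by blast
    then show "x \<in> \<Union>?G" by (intro UnionI[of "ball x \<delta>"]) auto
  qed
  have opG: "\<And>G. G \<in> ?G \<Longrightarrow> open G" by auto
  have "\<exists>\<delta>>0. \<forall>x\<in>cball a R. \<exists>G\<in>?G. ball x \<delta> \<subseteq> G"
    by (rule Heine_Borel_lemma[OF compact_cball cov opG]) blast+
  then obtain \<delta> where d: "\<delta> > 0" "\<And>x. x \<in> cball a R \<Longrightarrow> \<exists>G\<in>?G. ball x \<delta> \<subseteq> G"
    by blast
  have good: "lifts_everywhere \<theta> \<psi> (ball x \<delta>)" if "x \<in> cball a R" for x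
    using d(2)[OF that] lifts_everywhere_subset by blast
  have Q: "\<exists>\<phi>. lift_on \<theta> \<psi> \<phi> (ball a (real (Suc n) * \<delta>)) \<and> \<phi> a = y0" if "real n * \<delta> \<le> R" for n
    using that
  proof (induction n)
    case 0
    have "lifts_everywhere \<theta> \<psi> (ball a \<delta>)" using good R by simp
    then show ?case using y0 d(1) unfolding lifts_everywhere_def by simp
  next
    case (Suc n)
    have "real n * \<delta> \<le> R" using Suc.prems d(1) by (simp add: algebra_simps)
    then obtain \<phi> where p: "lift_on \<theta> \<psi> \<phi> (ball a (real (Suc n) * \<delta>))" "\<phi> a = y0" using Suc.IH by blast
    have good': "lifts_everywhere \<theta> \<psi> (ball w \<delta>)" if "dist a w = real (Suc n) * \<delta>" for w
      using good that Suc.prems by simp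
    have pos: "real (Suc n) * \<delta> > 0" using d(1) by simp
    obtain \<Phi> where "lift_on \<theta> \<psi> \<Phi> (ball a (real (Suc n) * \<delta> + \<delta>))" "\<Phi> a = \<phi> a"
      by (rule extend_lift[OF \<theta> \<psi> p(1) pos d(1) good'])
    moreover have "real (Suc n) * \<delta> + \<delta> = real (Suc (Suc n)) * \<delta>" by (simp add: algebra_simps)
    ultimately show ?case using p(2) by metis
  qed
  define n where "n = nat \<lfloor>R / \<delta>\<rfloor>"
  have fl: "\<lfloor>R / \<delta>\<rfloor> \<ge> 0" using R d(1) by simp
  have rn: "real n = of_int \<lfloor>R / \<delta>\<rfloor>" using fl by (simp add: n_def)
  have "real n \<le> R / \<delta>" "R / \<delta> < real n + 1" unfolding rn by linarith+
  then have n: "real n * \<delta> \<le> R" "R \<le> real (Suc n) * \<delta>" using d(1) by (simp_all add: field_simps)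
  obtain \<phi> where p: "lift_on \<theta> \<psi> \<phi> (ball a (real (Suc n) * \<delta>))" "\<phi> a = y0" using Q[OF n(1)] by blast
  have "lift_on \<theta> \<psi> \<phi> (ball a R)" using p(1) n(2) by (auto simp: lift_on_def)
  then show thesis using p(2) by (rule that)
qed

text \<open>Monodromy on the sphere with ramification: divisibility of local degrees provides local
  lifts at every point, the plane is exhausted by discs around a, and \<open>Infty\<close> is added
  last. The condition on \<open>y0\<close> makes the lifts over different discs agree.\<close>

theorem rational_lift:
  assumes \<theta>: "rational_function \<theta>" and \<psi>: "rational_function \<psi>"
    and dvd: "\<And>x y. \<theta> y = \<psi> x \<Longrightarrow> local_degree \<theta> y dvd local_degree \<psi> x"
    and y0: "\<theta> y0 = \<psi> (Fin a)" "local_degree \<theta> y0 = 1"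
  obtains F where "rational_function F" "\<theta> \<circ> F = \<psi>" "F (Fin a) = y0"
proof -
  obtain N where N: "rational_of_degree N \<theta>" using \<theta> by (auto simp: rational_function_def)
  have chart: "\<exists>\<delta>>0. \<forall>u y. norm u < \<delta> \<longrightarrow> \<theta> y = \<psi> (param z u) \<longrightarrow>
      (\<exists>\<phi>. lift_on \<theta> (\<lambda>w. \<psi> (param z w)) \<phi> (ball 0 \<delta>) \<and> \<phi> u = y)" for z
    by (rule local_lifts[OF N rat_mult_at[OF \<psi>, of z]]) (use dvd in auto)
  have bad: "finite {x. \<exists>y. \<theta> y = \<psi> x \<and> local_degree \<theta> y \<noteq> 1}"
  proof -
    have "{x. \<exists>y. \<theta> y = \<psi> x \<and> local_degree \<theta> y \<noteq> 1} = (\<Union>y\<in>{y. local_degree \<theta> y \<noteq> 1}. {x. \<psi> x = \<theta> y})" by auto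
    then show ?thesis using rat_finite_ramified[OF \<theta>] rat_finite_fibre[OF \<psi>] by simp
  qed
  have bad_vimage: "finite {u. \<exists>y. \<theta> y = \<psi> (param z u) \<and> local_degree \<theta> y \<noteq> 1}" for z
    using finite_vimageI[OF bad, of "param z"] by (simp add: vimage_def inj_on_def)
  have loc: "\<exists>\<delta>>0. lifts_everywhere \<theta> (\<lambda>u. \<psi> (Fin u)) (ball c \<delta>)" for c
  proof -
    obtain \<delta> where d: "\<delta> > 0" "\<And>u y. norm u < \<delta> \<Longrightarrow> \<theta> y = \<psi> (param (Fin c) u) \<Longrightarrow>
      (\<exists>\<phi>. lift_on \<theta> (\<lambda>w. \<psi> (param (Fin c) w)) \<phi> (ball 0 \<delta>) \<and> \<phi> u = y)"
      using chart[of "Fin c"] by blast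
    have "lifts_everywhere \<theta> (\<lambda>u. \<psi> (Fin u)) (ball c \<delta>)"
      unfolding lifts_everywhere_def
    proof (intro ballI allI impI)
      fix u y assume u: "u \<in> ball c \<delta>" and y: "\<theta> y = \<psi> (Fin u)"
      have "norm (u - c) < \<delta>" "\<theta> y = \<psi> (param (Fin c) (u - c))"
        using u y by (auto simp: dist_norm norm_minus_commute)
      then obtain \<phi> where l: "lift_on \<theta> (\<lambda>w. \<psi> (param (Fin c) w)) \<phi> (ball 0 \<delta>)" "\<phi> (u - c) = y"
        using d(2) by blast
      have "lift_on \<theta> (\<lambda>u. \<psi> (Fin u)) (\<lambda>v. \<phi> (v - c)) (ball c \<delta>)"
        unfolding lift_on_def
      proof
        fix v assume "v \<in> ball c \<delta>"
        then have v: "v - c \<in> ball 0 \<delta>" by (simp add: dist_norm norm_minus_commute)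
        have "(\<lambda>v. v - c) analytic_on {v}" by (intro analytic_intros)
        then show "hol_at (\<lambda>v. \<phi> (v - c)) v \<and> \<theta> (\<phi> (v - c)) = \<psi> (Fin v)"
          using l(1) v hol_at_compose_analytic[of \<phi> "\<lambda>v. v - c" v] by (auto simp: lift_on_def)
      qed
      then show "\<exists>\<phi>. lift_on \<theta> (\<lambda>u. \<psi> (Fin u)) \<phi> (ball c \<delta>) \<and> \<phi> u = y"
        using l(2) by (intro exI[of _ "\<lambda>v. \<phi> (v - c)"]) simp
    qed
    with d(1) show ?thesis by blast
  qed
  have badF: "finite {u. \<exists>y. \<theta> y = \<psi> (Fin u) \<and> local_degree \<theta> y \<noteq> 1}"
    using bad_vimage[of "Fin 0"] by simp
  have "\<exists>\<phi>. lift_on \<theta> (\<lambda>u. \<psi> (Fin u)) \<phi> (ball a R) \<and> \<phi> a = y0" if "R > 0" for R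
    by (rule lift_on_ball[OF \<theta> badF loc y0(1) that]) auto
  then have "\<forall>R. \<exists>\<phi>. R > 0 \<longrightarrow> lift_on \<theta> (\<lambda>u. \<psi> (Fin u)) \<phi> (ball a R) \<and> \<phi> a = y0"
    by blast
  from choice[OF this] obtain \<phi> where p: "\<And>R. R > 0 \<Longrightarrow> lift_on \<theta> (\<lambda>u. \<psi> (Fin u)) (\<phi> R) (ball a R)"
    "\<And>R. R > 0 \<Longrightarrow> \<phi> R a = y0" by blast
  have cons: "\<phi> R x = \<phi> R' x" if "x \<in> ball a R" "R \<le> R'" for R R' x
  proof -
    have R: "R > 0" using that(1) by (metis ball_eq_empty empty_iff not_le)
    have "lift_on \<theta> (\<lambda>u. \<psi> (Fin u)) (\<phi> R') (ball a R)" using p(1)[of R'] R that(2) by (auto simp: lift_on_def)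
    then show ?thesis
      using lift_unique[OF \<theta> open_ball connected_ball p(1)[OF R], of "\<phi> R'" a x] p(2)[of R] p(2)[of R'] R that y0(2) by simp
  qed
  define \<Phi> where "\<Phi> = (\<lambda>x. \<phi> (dist a x + 1) x)"
  have Phi: "\<Phi> x = \<phi> R x" if "x \<in> ball a R" for x R
  proof (cases "dist a x + 1 \<le> R")
    case True
    have "x \<in> ball a (dist a x + 1)" by simp
    from cons[OF this True] show ?thesis by (simp only: \<Phi>_def)
  next
    case False
    with cons[OF that, of "dist a x + 1"] show ?thesis by (simp only: \<Phi>_def)
  qed
  have hol: "hol_at \<Phi> x" "\<theta> (\<Phi> x) = \<psi> (Fin x)" for x
  proof -
    let ?R = "dist a x + 1"
    have R: "?R > 0" by (simp add: add_nonneg_pos)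
    have "\<forall>\<^sub>F v in nhds x. v \<in> ball a ?R" by (intro eventually_nhds_in_open) auto
    then have "\<forall>\<^sub>F v in nhds x. \<Phi> v = \<phi> ?R v" by eventually_elim (rule Phi)
    from hol_at_cong[OF this] show "hol_at \<Phi> x" using p(1)[OF R] by (simp add: lift_on_def)
    show "\<theta> (\<Phi> x) = \<psi> (Fin x)" using p(1)[OF R] by (simp add: lift_on_def \<Phi>_def)
  qed
  have Phia: "\<Phi> a = y0" using p(2)[of 1] by (simp add: \<Phi>_def)
  obtain \<delta> where d: "\<delta> > 0" "\<And>u y. norm u < \<delta> \<Longrightarrow> \<theta> y = \<psi> (param Infty u) \<Longrightarrow>
      (\<exists>\<phi>. lift_on \<theta> (\<lambda>w. \<psi> (param Infty w)) \<phi> (ball 0 \<delta>) \<and> \<phi> u = y)"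
    using chart[of Infty] by blast
  \<comment> \<open>The punctured disc about \<open>Infty\<close> is connected but not simply
    connected. This suffices, because the plane lift \<Phi> is already single-valued and only has to
    be identified with one local lift, starting from an unramified fibre at
    \<open>w0\<close>.\<close>
  let ?B = "ball (0::complex) \<delta> - {0}"
  have conB: "connected ?B" by (rule connected_punctured_ball) simp
  have opB: "open ?B" by (intro open_delete open_ball)
  have "complex_of_real (\<delta> / 2) \<in> ?B" using d(1) by simp
  then have "infinite ?B" using finite_imp_not_open[of ?B] opB by blast
  then have "\<not> ?B \<subseteq> {u. \<exists>y. \<theta> y = \<psi> (param Infty u) \<and> local_degree \<theta> y \<noteq> 1}"
    using finite_subset[OF _ bad_vimage[of Infty]] by blast
  then obtain w0 where w0: "w0 \<in> ?B" "\<And>y. \<theta> y = \<psi> (param Infty w0) \<Longrightarrow> local_degree \<theta> y = 1"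
    by blast
  have t0: "\<theta> (\<Phi> (1 / w0)) = \<psi> (param Infty w0)" using hol(2) w0(1) by simp
  then obtain \<eta> where chi: "lift_on \<theta> (\<lambda>w. \<psi> (param Infty w)) \<eta> (ball 0 \<delta>)" "\<eta> w0 = \<Phi> (1 / w0)"
    using d(2)[of w0 "\<Phi> (1 / w0)"] w0(1) by auto
  have l1: "lift_on \<theta> (\<lambda>w. \<psi> (param Infty w)) \<eta> ?B" using chi(1) unfolding lift_on_def by blast
  have l2: "lift_on \<theta> (\<lambda>w. \<psi> (param Infty w)) (\<lambda>w. \<Phi> (1 / w)) ?B"
    unfolding lift_on_def
  proof
    fix w assume w: "w \<in> ?B"
    then have "(\<lambda>w. 1 / w) analytic_on {w}" by (intro analytic_intros) auto
    then have "hol_at (\<lambda>w. \<Phi> (1 / w)) w" using hol_at_compose_analytic[of \<Phi> "\<lambda>w. 1 / w" w] hol(1) by simp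
    then show "hol_at (\<lambda>w. \<Phi> (1 / w)) w \<and> \<theta> (\<Phi> (1 / w)) = \<psi> (param Infty w)" using hol(2) w by simp
  qed
  have chiPhi: "\<eta> w = \<Phi> (1 / w)" if "w \<in> ?B" for w
    by (rule lift_unique[OF \<theta> opB conB l1 l2 w0(1) chi(2) _ that]) (use w0(2) t0 chi(2) in simp)
  define F where "F = (\<lambda>z. case z of Fin x \<Rightarrow> \<Phi> x | Infty \<Rightarrow> \<eta> 0)"
  have "holo F"
    unfolding holo_def
  proof
    fix z
    show "hol_at (\<lambda>w. F (param z w)) 0"
    proof (cases z)
      case (Fin c)
      have "(\<lambda>w. c + w) analytic_on {0}" by (intro analytic_intros)
      then have "hol_at (\<lambda>w. \<Phi> (c + w)) 0" using hol_at_compose_analytic[of \<Phi> "\<lambda>w. c + w" 0] hol(1) by simp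
      then show ?thesis by (simp add: Fin F_def)
    next
      case Infty
      have "\<forall>\<^sub>F w in nhds 0. w \<in> ball 0 \<delta>" using d(1) by (intro eventually_nhds_in_open) auto
      then have "\<forall>\<^sub>F w in nhds 0. F (param Infty w) = \<eta> w"
        by eventually_elim (use chiPhi in \<open>auto simp: F_def\<close>)
      from hol_at_cong[OF this] show ?thesis using chi(1) d(1) by (simp add: Infty lift_on_def)
    qed
  qed
  have tF: "\<theta> (F z) = \<psi> z" for z
  proof (cases z)
    case (Fin c)
    then show ?thesis using hol(2) by (simp add: F_def)
  next
    case Infty
    have "\<theta> (\<eta> 0) = \<psi> (param Infty 0)" using chi(1) d(1) by (simp add: lift_on_def)
    then show ?thesis by (simp add: Infty F_def)
  qed
  have "\<nexists>c. F = (\<lambda>_. c)"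
  proof
    assume "\<exists>c. F = (\<lambda>_. c)"
    then have "\<psi> z = \<psi> z'" for z z' using tF by metis
    then show False using rat_surj[OF \<psi>] by (metis cp1.distinct(1) surjD)
  qed
  then have "rational_function F" using holo_imp_rational \<open>holo F\<close> by blast
  moreover have "\<theta> \<circ> F = \<psi>" using tF by auto
  moreover have "F (Fin a) = y0" using Phia by (simp add: F_def)
  ultimately show thesis by (rule that)
qed

section \<open>Universal coverings as quotient maps\<close>

lemma universal_covering_iff:
  "universal_covering \<theta> \<nu> \<longleftrightarrow> rational_function \<theta> \<and> orbifold \<nu> \<and> (\<forall>z. \<nu> (\<theta> z) = local_degree \<theta> z)"
proof
  assume "universal_covering \<theta> \<nu>"
  then show "rational_function \<theta> \<and> orbifold \<nu> \<and> (\<forall>z. \<nu> (\<theta> z) = local_degree \<theta> z)"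
    unfolding universal_covering_def orbifold_covering_def non_ramified_def by auto
next
  assume "rational_function \<theta> \<and> orbifold \<nu> \<and> (\<forall>z. \<nu> (\<theta> z) = local_degree \<theta> z)"
  then show "universal_covering \<theta> \<nu>"
    unfolding universal_covering_def orbifold_covering_def non_ramified_def orbifold_def
    by (intro exI[of _ "\<lambda>_. 1"]) auto
qed

lemma finite_preimage:
  assumes "rational_function f" "finite S"
  shows "finite {z. f z \<in> S}"
proof -
  have "{z. f z \<in> S} = (\<Union>c\<in>S. {z. f z = c})" by auto
  then show ?thesis using rat_finite_fibre[OF assms(1)] assms(2) by simp
qed

lemma rational_lift_unique:
  assumes \<theta>: "rational_function \<theta>" and F: "rational_function F1" "rational_function F2" "\<theta> \<circ> F1 = \<theta> \<circ> F2"
    and p: "p \<noteq> Infty" "F1 p = F2 p" "local_degree \<theta> (F1 p) = 1"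
  shows "F1 = F2"
proof -
  obtain a where a: "p = Fin a" using p(1) by (cases p) auto
  have l: "lift_on \<theta> (\<lambda>x. \<theta> (F1 (Fin x))) (\<lambda>x. F1 (Fin x)) UNIV"
    "lift_on \<theta> (\<lambda>x. \<theta> (F1 (Fin x))) (\<lambda>x. F2 (Fin x)) UNIV"
    unfolding lift_on_def using holo_hol_at[OF rat_holo[OF F(1)] hol_at_Fin] holo_hol_at[OF rat_holo[OF F(2)] hol_at_Fin] F(3)
    by (auto simp: fun_eq_iff)
  have "F1 (Fin x) = F2 (Fin x)" for x
    using lift_unique[OF \<theta> open_UNIV connected_UNIV l, of a x] p by (simp add: a)
  then have "F1 z = F2 z" if "z \<notin> {Infty}" for z using that by (cases z) auto
  then show ?thesis by (intro holo_eqI[OF rat_holo rat_holo, of F1 F2 "{Infty}"]) (use F in auto)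
qed

definition deck :: "(cp1 \<Rightarrow> cp1) \<Rightarrow> (cp1 \<Rightarrow> cp1) set" where
  "deck \<theta> = {\<sigma>. rational_of_degree 1 \<sigma> \<and> \<theta> \<circ> \<sigma> = \<theta>}"

lemma deck_compose: "\<sigma> \<in> deck \<theta> \<Longrightarrow> \<tau> \<in> deck \<theta> \<Longrightarrow> \<sigma> \<circ> \<tau> \<in> deck \<theta>"
  using rational_of_degree_compose[of 1 \<sigma> 1 \<tau>] unfolding deck_def by (auto simp: o_assoc)

lemma deck_rational: "\<sigma> \<in> deck \<theta> \<Longrightarrow> rational_function \<sigma>"
  by (auto simp: deck_def intro: rational_of_degree_imp_rational)

lemma deck_apply: "\<sigma> \<in> deck \<theta> \<Longrightarrow> \<theta> (\<sigma> z) = \<theta> z"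
  by (auto simp: deck_def fun_eq_iff)

text \<open>\<theta> is lifted through itself. This is possible because its local degree depends
  only on the image point, and multiplicativity of degrees forces the lift to have degree
  one.\<close>

lemma deck_transitive:
  assumes uc: "universal_covering \<theta> \<nu>" and z: "z \<noteq> Infty" "\<nu> (\<theta> z) = 1" "\<theta> z = \<theta> z'"
  obtains \<sigma> where "\<sigma> \<in> deck \<theta>" "\<sigma> z = z'"
proof -
  obtain a where a: "z = Fin a" using z(1) by (cases z) auto
  have r: "rational_function \<theta>" and ld: "\<And>z. local_degree \<theta> z = \<nu> (\<theta> z)"
    using uc by (auto simp: universal_covering_iff)
  obtain \<sigma> where s: "rational_function \<sigma>" "\<theta> \<circ> \<sigma> = \<theta>" "\<sigma> (Fin a) = z'"
    by (rule rational_lift[OF r r, of z' a]) (use z a ld in auto)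
  obtain n N where n: "rational_of_degree n \<sigma>" "rational_of_degree N \<theta>"
    using s(1) r by (auto simp: rational_function_def)
  from rational_of_degree_compose[OF n(2,1)] have "N * n = N"
    unfolding s(2) using n(2) by (rule rational_of_degree_unique)
  then have "n = 1" using rational_of_degree_pos[OF n(2)] by simp
  then show thesis using that[of \<sigma>] s n a by (simp add: deck_def)
qed

section \<open>Quotients by finite groups of Moebius transformations\<close>

lemma coprime_complex_polyI:
  fixes A B :: "complex poly"
  assumes "A \<noteq> 0" "\<And>x. poly A x = 0 \<Longrightarrow> poly B x = 0 \<Longrightarrow> False"
  shows "coprime A B"
proof (rule coprimeI)
  fix c assume c: "c dvd A" "c dvd B"
  then have "c \<noteq> 0" using assms(1) by auto
  have "degree c = 0"
  proof (rule ccontr)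
    assume "degree c \<noteq> 0"
    then have "\<not> constant (poly c)" by (simp add: constant_degree)
    then obtain x where "poly c x = 0" using fundamental_theorem_of_algebra by blast
    then show False using assms(2)[of x] c by (auto elim!: dvdE)
  qed
  then show "is_unit c" using \<open>c \<noteq> 0\<close> is_unit_iff_degree by blast
qed

text \<open>
  The constant \<open>t\<close> is chosen so that numerator and denominator have no common zero. If \<open>H\<close> is a
  group, then the product is \<open>H\<close>-invariant.
\<close>

lemma product_of_moebius:
  assumes H: "finite H" "H \<noteq> {}" "\<And>\<sigma>. \<sigma> \<in> H \<Longrightarrow> rational_of_degree 1 \<sigma>"
  obtains r k t where "rational_of_degree k r" "k \<le> card H"
    "\<And>x. (\<And>\<sigma>. \<sigma> \<in> H \<Longrightarrow> \<sigma> (Fin x) \<noteq> Infty) \<Longrightarrow> r (Fin x) = Fin (\<Prod>\<sigma>\<in>H. finite_value (\<sigma> (Fin x)) - t)"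
proof -
  have "\<forall>\<sigma>\<in>H. \<exists>ab. coprime (fst ab) (snd ab) \<and> max (degree (fst ab)) (degree (snd ab)) = 1 \<and> \<sigma> = rat_map (fst ab) (snd ab)"
    using H(3) unfolding rational_of_degree_def by fastforce
  from bchoice[OF this] obtain ab where
    ab: "\<forall>\<sigma>\<in>H. coprime (fst (ab \<sigma>)) (snd (ab \<sigma>)) \<and> max (degree (fst (ab \<sigma>))) (degree (snd (ab \<sigma>))) = 1 \<and> \<sigma> = rat_map (fst (ab \<sigma>)) (snd (ab \<sigma>))"
    by blast
  define a b where "a = (\<lambda>\<sigma>. fst (ab \<sigma>))" and "b = (\<lambda>\<sigma>. snd (ab \<sigma>))"
  have cf: "coprime_fraction (a \<sigma>) (b \<sigma>)" if "\<sigma> \<in> H" for \<sigma>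
    using ab that unfolding coprime_fraction_def a_def b_def by auto
  have map: "\<sigma> = rat_map (a \<sigma>) (b \<sigma>)" and deg: "max (degree (a \<sigma>)) (degree (b \<sigma>)) = 1" if "\<sigma> \<in> H" for \<sigma>
    using ab that unfolding a_def b_def by auto
  have nz: "a \<sigma> - smult t (b \<sigma>) \<noteq> 0" "b \<sigma> \<noteq> 0" if "\<sigma> \<in> H" for \<sigma> t
    using coprime_fraction.fibre_poly_nonzero[OF cf[OF that], of "Fin t"]
      coprime_fraction.fibre_poly_nonzero[OF cf[OF that], of Infty]
    by (auto simp: coprime_fraction.fibre_poly_def[OF cf[OF that]])
  \<comment> \<open>T contains every finite value that a member of H takes at a finite pole of a
    member. With t outside T, a zero of some numerator a - t b is never a zero of another
    denominator.\<close>
  define T where "T = (\<Union>\<sigma>\<in>H. \<Union>\<tau>\<in>H. (\<lambda>x. poly (a \<sigma>) x / poly (b \<sigma>) x) ` {x. poly (b \<tau>) x = 0})"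
  have "finite T" unfolding T_def using H(1) nz by (intro finite_UN_I finite_imageI poly_roots_finite) auto
  then obtain t where t: "t \<notin> T" using ex_new_if_finite infinite_UNIV_char_0 by blast
  define A B where "A = (\<Prod>\<sigma>\<in>H. a \<sigma> - smult t (b \<sigma>))" and "B = (\<Prod>\<sigma>\<in>H. b \<sigma>)"
  have A0: "A \<noteq> 0" and B0: "B \<noteq> 0" unfolding A_def B_def using H(1) nz by auto
  have cop: "coprime A B"
  proof (rule coprime_complex_polyI[OF A0])
    fix x assume "poly A x = 0" "poly B x = 0"
    then obtain \<sigma> \<tau> where st: "\<sigma> \<in> H" "poly (a \<sigma>) x = t * poly (b \<sigma>) x" "\<tau> \<in> H" "poly (b \<tau>) x = 0"
      using H(1) by (auto simp: A_def B_def poly_prod)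
    show False
    proof (cases "poly (b \<sigma>) x = 0")
      case True
      then show False using coprime_fraction.no_common_root[OF cf[OF st(1)], of x] st by simp
    next
      case False
      then have "t = poly (a \<sigma>) x / poly (b \<sigma>) x" using st(2) by simp
      then have "t \<in> T" unfolding T_def using st by blast
      then show False using t by simp
    qed
  qed
  have dA: "degree A = (\<Sum>\<sigma>\<in>H. degree (a \<sigma> - smult t (b \<sigma>)))"
    unfolding A_def by (rule degree_prod_eq_sum_degree) (use nz in auto)
  have dB: "degree B = (\<Sum>\<sigma>\<in>H. degree (b \<sigma>))"
    unfolding B_def by (rule degree_prod_eq_sum_degree) (use nz in auto)
  have le: "degree (a \<sigma> - smult t (b \<sigma>)) \<le> 1" "degree (b \<sigma>) \<le> 1" if "\<sigma> \<in> H" for \<sigma>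
  proof -
    show "degree (b \<sigma>) \<le> 1" using deg[OF that] by linarith
    moreover have "degree (a \<sigma>) \<le> 1" using deg[OF that] by linarith
    ultimately show "degree (a \<sigma> - smult t (b \<sigma>)) \<le> 1"
      by (intro degree_diff_le) (auto intro: order_trans[OF degree_smult_le])
  qed
  have "degree A \<le> card H" "degree B \<le> card H"
    unfolding dA dB using sum_bounded_above[OF le(1), of H] sum_bounded_above[OF le(2), of H] by simp_all
  moreover have "max (degree A) (degree B) \<ge> 1"
  proof -
    obtain \<sigma> where s: "\<sigma> \<in> H" using H(2) by blast
    have "degree (a \<sigma> - smult t (b \<sigma>)) = 1 \<or> degree (b \<sigma>) = 1"
    proof (cases "degree (b \<sigma>) = 1")
      case False
      then have b: "degree (b \<sigma>) = 0" using le(2)[OF s] by linarith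
      then have a: "degree (a \<sigma>) = 1" using deg[OF s] by simp
      have "degree (smult t (b \<sigma>)) < degree (a \<sigma>)"
        using a b degree_smult_le[of t "b \<sigma>"] by simp
      then have "degree (a \<sigma> - smult t (b \<sigma>)) = degree (a \<sigma>)"
        unfolding diff_conv_add_uminus by (intro degree_add_eq_left) simp
      then show ?thesis using a by simp
    qed auto
    moreover have "degree (a \<sigma> - smult t (b \<sigma>)) \<le> degree A" "degree (b \<sigma>) \<le> degree B"
      unfolding dA dB using member_le_sum[OF s _ H(1), of "\<lambda>\<sigma>. degree (a \<sigma> - smult t (b \<sigma>))"]
        member_le_sum[OF s _ H(1), of "\<lambda>\<sigma>. degree (b \<sigma>)"] by auto
    ultimately show ?thesis by linarith
  qed
  moreover have "rat_map A B (Fin x) = Fin (\<Prod>\<sigma>\<in>H. finite_value (\<sigma> (Fin x)) - t)"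
    if "\<And>\<sigma>. \<sigma> \<in> H \<Longrightarrow> \<sigma> (Fin x) \<noteq> Infty" for x
  proof -
    have val: "poly (b \<sigma>) x \<noteq> 0 \<and> finite_value (\<sigma> (Fin x)) = poly (a \<sigma>) x / poly (b \<sigma>) x" if s: "\<sigma> \<in> H" for \<sigma>
    proof -
      have "rat_map (a \<sigma>) (b \<sigma>) (Fin x) \<noteq> Infty" using \<open>\<And>\<sigma>. \<sigma> \<in> H \<Longrightarrow> \<sigma> (Fin x) \<noteq> Infty\<close>[OF s] map[OF s] by metis
      then have nzb: "poly (b \<sigma>) x \<noteq> 0" by auto
      have "\<sigma> (Fin x) = rat_map (a \<sigma>) (b \<sigma>) (Fin x)" using map[OF s] by metis
      then show ?thesis using nzb by simp
    qed
    then have "poly B x \<noteq> 0" using H(1) by (simp add: B_def poly_prod)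
    moreover have "poly A x / poly B x = (\<Prod>\<sigma>\<in>H. finite_value (\<sigma> (Fin x)) - t)"
      unfolding A_def B_def poly_prod prod_dividef[symmetric]
      by (rule prod.cong) (use val in \<open>auto simp: field_simps\<close>)
    ultimately show ?thesis by simp
  qed
  ultimately show thesis
    using that[of "max (degree A) (degree B)" "rat_map A B" t] cop by (auto simp: rational_of_degree_def)
qed

text \<open>Only upper bounds enter: the deck group of \<theta>' has at most N' elements, H at most
  as many, and the quotient map by H degree at most the order of H. That these are equalities is
  never established.\<close>

theorem common_left_factor:
  assumes f: "rational_function f"
    and uc: "universal_covering \<theta> \<nu>" "rational_of_degree N \<theta>"
    and uc': "universal_covering \<theta>' \<nu>'" "rational_of_degree N' \<theta>'"
    and dvd: "\<And>x. pullback f \<nu> x dvd \<nu>' x" and less: "N' < N"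
  obtains g h k m where "rational_of_degree m g" "m \<ge> 2" "rational_function h" "rational_function k"
    "f = g \<circ> h" "\<theta> = g \<circ> k"
proof -
  have r: "rational_function \<theta>" "rational_function \<theta>'" and orb: "orbifold \<nu>" "orbifold \<nu>'"
    and ld: "\<And>z. local_degree \<theta> z = \<nu> (\<theta> z)" "\<And>z. local_degree \<theta>' z = \<nu>' (\<theta>' z)"
    using uc uc' by (auto simp: universal_covering_iff)
  define \<psi> where "\<psi> = f \<circ> \<theta>'"
  have rpsi: "rational_function \<psi>" unfolding \<psi>_def using f r by (intro rational_compose)
  have finnu: "finite {z. \<nu> z \<noteq> 1}" "finite {z. \<nu>' z \<noteq> 1}" using orb by (auto simp: orbifold_def)
  have infF: "infinite (range Fin)"
    using finite_imageD[of Fin UNIV] infinite_UNIV_char_0[where 'a = complex] by (auto simp: inj_on_def)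
  \<comment> \<open>With e the local degree of f, the pullback index is \<nu>/gcd(e, \<nu>), so any
    multiple of it times e is a multiple of \<nu>.\<close>
  have ld_dvd: "local_degree \<theta> y dvd local_degree \<psi> x" if "\<theta> y = \<psi> x" for x y
  proof -
    let ?x = "\<theta>' x" and ?e = "local_degree f (\<theta>' x)"
    have "local_degree \<psi> x = \<nu>' ?x * ?e"
      unfolding \<psi>_def local_degree_compose[OF f r(2)] ld ..
    moreover have "local_degree \<theta> y = \<nu> (f ?x)" using that ld by (simp add: \<psi>_def)
    moreover have "\<nu> (f ?x) dvd pullback f \<nu> ?x * ?e"
      unfolding pullback_def by (metis div_mult_swap dvd_div_mult_self dvd_triv_left gcd_dvd1 gcd_dvd2 mult.commute)
    ultimately show ?thesis using dvd[of ?x] by (metis dvd_trans mult_dvd_mono dvd_refl)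
  qed
  obtain F where F: "rational_function F" "\<theta> \<circ> F = \<psi>"
  proof -
    have "\<not> range Fin \<subseteq> {z. \<psi> z \<in> {z. \<nu> z \<noteq> 1}}"
      using finite_subset[OF _ finite_preimage[OF rpsi finnu(1)]] infF by blast
    then obtain a where a: "\<nu> (\<psi> (Fin a)) = 1" by auto
    obtain y0 where y0: "\<theta> y0 = \<psi> (Fin a)" using rat_surj[OF r(1)] by (metis surjD)
    show thesis
      by (rule rational_lift[OF r(1) rpsi ld_dvd y0]) (use a y0 ld that in auto)
  qed
  have thF: "\<theta> (F z) = f (\<theta>' z)" for z using F(2) by (auto simp: \<psi>_def fun_eq_iff)
  \<comment> \<open>A base point over unramified values, where one value determines a deck
    transformation, and with finite image under F, where \<open>deck_transitive\<close> can
    start.\<close>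
  have "\<not> range Fin \<subseteq> {z. \<psi> z \<in> {z. \<nu> z \<noteq> 1}} \<union> {z. \<theta>' z \<in> {z. \<nu>' z \<noteq> 1}} \<union> {z. F z \<in> {Infty}}"
    using finite_subset[OF _ finite_UnI[OF finite_UnI[OF finite_preimage[OF rpsi finnu(1)] finite_preimage[OF r(2) finnu(2)]]
       finite_preimage[OF F(1), of "{Infty}"]]] infF by blast
  then obtain a where "Fin a \<notin> {z. \<psi> z \<in> {z. \<nu> z \<noteq> 1}} \<union> {z. \<theta>' z \<in> {z. \<nu>' z \<noteq> 1}} \<union> {z. F z \<in> {Infty}}" by blast
  then have a: "\<nu> (\<psi> (Fin a)) = 1" "\<nu>' (\<theta>' (Fin a)) = 1" "F (Fin a) \<noteq> Infty" by auto
  define p where "p = Fin a"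
  \<comment> \<open>F after \<sigma>' is again a lift of \<psi>, and so is \<sigma> after F for any
    deck transformation \<sigma>. Choosing \<sigma> to match them at p makes them equal.\<close>
  have equivariant: "\<exists>\<sigma>\<in>deck \<theta>. \<sigma> \<circ> F = F \<circ> \<sigma>'" if s': "\<sigma>' \<in> deck \<theta>'" for \<sigma>'
  proof -
    have eq: "\<theta> (F p) = \<theta> (F (\<sigma>' p))" using thF deck_apply[OF s'] by simp
    have un: "\<nu> (\<theta> (F p)) = 1" using a(1) thF by (simp add: p_def \<psi>_def)
    obtain \<sigma> where s: "\<sigma> \<in> deck \<theta>" "\<sigma> (F p) = F (\<sigma>' p)"
      using deck_transitive[OF uc(1) _ un eq] a(3) by (auto simp: p_def)
    have "\<sigma> \<circ> F = F \<circ> \<sigma>'"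
    proof (rule rational_lift_unique[OF r(1)])
      show "rational_function (\<sigma> \<circ> F)" "rational_function (F \<circ> \<sigma>')"
        using s s' F(1) by (auto intro: rational_compose deck_rational)
      show "\<theta> \<circ> (\<sigma> \<circ> F) = \<theta> \<circ> (F \<circ> \<sigma>')"
        using thF deck_apply[OF s'] deck_apply[OF s(1)] by (auto simp: fun_eq_iff)
      show "p \<noteq> Infty" by (simp add: p_def)
      show "(\<sigma> \<circ> F) p = (F \<circ> \<sigma>') p" using s by simp
      show "local_degree \<theta> ((\<sigma> \<circ> F) p) = 1" using un ld deck_apply[OF s(1)] by simp
    qed
    with s(1) show ?thesis by blast
  qed
  have inj': "inj_on (\<lambda>\<sigma>. \<sigma> p) (deck \<theta>')"
  proof (rule inj_onI)
    fix \<sigma> \<tau> assume st: "\<sigma> \<in> deck \<theta>'" "\<tau> \<in> deck \<theta>'" "\<sigma> p = \<tau> p"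
    show "\<sigma> = \<tau>"
    proof (rule rational_lift_unique[OF r(2)])
      show "rational_function \<sigma>" "rational_function \<tau>" using st deck_rational by auto
      show "\<theta>' \<circ> \<sigma> = \<theta>' \<circ> \<tau>" using st by (simp add: deck_def)
      show "p \<noteq> Infty" by (simp add: p_def)
      show "local_degree \<theta>' (\<sigma> p) = 1" using a(2) ld deck_apply[OF st(1)] by (simp add: p_def)
    qed (rule st(3))
  qed
  have img: "(\<lambda>\<sigma>. \<sigma> p) ` deck \<theta>' \<subseteq> {z. \<theta>' z = \<theta>' p}" using deck_apply by auto
  have fin': "finite (deck \<theta>')"
    using inj' finite_subset[OF img rat_finite_fibre[OF r(2)]] by (rule finite_imageD[rotated])
  have card': "card (deck \<theta>') \<le> N'"
    using card_inj_on_le[OF inj' img rat_finite_fibre[OF r(2)]] rat_card_fibre_le[OF uc'(2), of "\<theta>' p"] by linarith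
  \<comment> \<open>In place of the image of a homomorphism, H collects every \<sigma> intertwined
    by F with some \<sigma>'. Being finite and closed under composition is enough for the invariance
    arguments.\<close>
  define H where "H = {\<sigma> \<in> deck \<theta>. \<exists>\<sigma>'\<in>deck \<theta>'. \<sigma> \<circ> F = F \<circ> \<sigma>'}"
  have Fsurj: "surj F" by (rule rat_surj[OF F(1)])
  have "\<exists>c. \<forall>\<sigma>\<in>H. c \<sigma> \<in> deck \<theta>' \<and> \<sigma> \<circ> F = F \<circ> c \<sigma>"
    by (rule bchoice) (unfold H_def, blast)
  \<comment> \<open>A choice of partner for each \<sigma>; it is injective because F is onto, which
    bounds the order of H by that of the deck group of \<theta>'.\<close>
  then obtain c where c: "\<And>\<sigma>. \<sigma> \<in> H \<Longrightarrow> c \<sigma> \<in> deck \<theta>'" "\<And>\<sigma>. \<sigma> \<in> H \<Longrightarrow> \<sigma> \<circ> F = F \<circ> c \<sigma>" by blast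
  have "inj_on c H"
  proof (rule inj_onI)
    fix \<sigma> \<tau> assume st: "\<sigma> \<in> H" "\<tau> \<in> H" "c \<sigma> = c \<tau>"
    then have "\<sigma> \<circ> F = \<tau> \<circ> F" using c(2) by metis
    then show "\<sigma> = \<tau>" using Fsurj by (metis (no_types, lifting) comp_apply ext surjD)
  qed
  then have H: "finite H" "card H \<le> N'"
    using inj_on_finite[OF _ _ fin', of c H] card_inj_on_le[OF _ _ fin', of c H] c(1) card'
    by (auto simp: image_subset_iff)
  have Hdeck: "\<sigma> \<in> deck \<theta>" if "\<sigma> \<in> H" for \<sigma> using that by (simp add: H_def)
  have Hcomp: "\<sigma> \<circ> \<tau> \<in> H" if "\<sigma> \<in> H" "\<tau> \<in> H" for \<sigma> \<tau>
  proof -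
    have "\<sigma> \<circ> \<tau> \<circ> F = F \<circ> (c \<sigma> \<circ> c \<tau>)"
      using c(2)[OF that(1)] c(2)[OF that(2)] by (metis comp_assoc)
    then show ?thesis using deck_compose Hdeck that c(1) unfolding H_def by blast
  qed
  have "id \<in> H" unfolding H_def deck_def using rational_of_degree_id by auto
  then have Hne: "H \<noteq> {}" by blast
  have Hdeg: "rational_of_degree 1 \<sigma>" if "\<sigma> \<in> H" for \<sigma> using Hdeck[OF that] by (simp add: deck_def)
  obtain q k t where q: "rational_of_degree k q" "k \<le> card H"
    "\<And>x. (\<And>\<sigma>. \<sigma> \<in> H \<Longrightarrow> \<sigma> (Fin x) \<noteq> Infty) \<Longrightarrow> q (Fin x) = Fin (\<Prod>\<sigma>\<in>H. finite_value (\<sigma> (Fin x)) - t)"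
    using product_of_moebius[OF H(1) Hne Hdeg] by metis
  have rq: "rational_function q" using q(1) by (rule rational_of_degree_imp_rational)
  \<comment> \<open>The default of \<open>finite_value\<close> makes V total, so composition with an
    element of H merely permutes the factors, without exceptional points.\<close>
  define V where "V = (\<lambda>z. \<Prod>\<sigma>\<in>H. finite_value (\<sigma> z) - t)"
  have V: "V (\<tau> z) = V z" if t: "\<tau> \<in> H" for \<tau> z
  proof -
    have inj: "inj_on (\<lambda>\<sigma>. \<sigma> \<circ> \<tau>) H"
    proof (rule inj_onI)
      fix \<sigma> \<sigma>' assume "\<sigma> \<circ> \<tau> = \<sigma>' \<circ> \<tau>"
      then show "\<sigma> = \<sigma>'" using rat_surj[OF deck_rational[OF Hdeck[OF t]]]
        by (metis (no_types, lifting) comp_apply ext surjD)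
    qed
    have "(\<lambda>\<sigma>. \<sigma> \<circ> \<tau>) ` H = H" using Hcomp t inj H(1) by (intro endo_inj_surj) auto
    then have "V z = (\<Prod>\<sigma>\<in>(\<lambda>\<sigma>. \<sigma> \<circ> \<tau>) ` H. finite_value (\<sigma> z) - t)" by (simp add: V_def)
    also have "\<dots> = V (\<tau> z)" unfolding V_def by (subst prod.reindex[OF inj]) simp
    finally show ?thesis by simp
  qed
  \<comment> \<open>The points that some element of H sends to \<open>Infty\<close>. Its complement
    is preserved by H, and there q is given by V.\<close>
  define S0 where "S0 = insert Infty (\<Union>\<sigma>\<in>H. {z. \<sigma> z = Infty})"
  have finS0: "finite S0" unfolding S0_def using H(1) Hdeck by (auto intro: rat_finite_fibre deck_rational)
  have qV: "q z = Fin (V z)" if "z \<notin> S0" for z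
    using that q(3) unfolding S0_def V_def by (cases z) auto
  have S0: "\<tau> z \<notin> S0" if "z \<notin> S0" "\<tau> \<in> H" for \<tau> z
    using that Hcomp[OF _ that(2)] unfolding S0_def by fastforce
  have qH: "q (\<tau> z) = q z" if "z \<notin> S0" "\<tau> \<in> H" for \<tau> z
    using qV[OF that(1)] qV[OF S0[OF that]] V[OF that(2)] by simp
  obtain g where g: "holo g" "\<theta> = g \<circ> q"
  proof (rule holo_factor[OF rq rat_holo[OF r(1)]])
    show "finite (S0 \<union> {z. \<theta> z \<in> {z. \<nu> z \<noteq> 1}})" using finS0 finite_preimage[OF r(1) finnu(1)] by blast
    fix y y' assume y: "y \<notin> S0 \<union> {z. \<theta> z \<in> {z. \<nu> z \<noteq> 1}}" "q y = q y'"
    have inj: "inj_on (\<lambda>\<sigma>. \<sigma> y) H"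
    proof (rule inj_onI)
      fix \<sigma> \<tau> assume st: "\<sigma> \<in> H" "\<tau> \<in> H" "\<sigma> y = \<tau> y"
      show "\<sigma> = \<tau>"
      proof (rule rational_lift_unique[OF r(1)])
        show "rational_function \<sigma>" "rational_function \<tau>" using st Hdeck deck_rational by auto
        show "\<theta> \<circ> \<sigma> = \<theta> \<circ> \<tau>" using st Hdeck by (simp add: deck_def)
        show "y \<noteq> Infty" using y(1) by (auto simp: S0_def)
        show "local_degree \<theta> (\<sigma> y) = 1" using ld deck_apply[OF Hdeck[OF st(1)]] y(1) by simp
      qed (rule st(3))
    qed
    \<comment> \<open>The orbit of an unramified point has as many points as H, while a fibre of q
      has at most k of them and k is at most the order of H; the orbit is therefore the whole
      fibre.\<close>
    have "(\<lambda>\<sigma>. \<sigma> y) ` H = {z. q z = q y}"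
    proof (rule card_seteq)
      show "finite {z. q z = q y}" by (rule rat_finite_fibre[OF rq])
      show "(\<lambda>\<sigma>. \<sigma> y) ` H \<subseteq> {z. q z = q y}" using qH y(1) by auto
      show "card {z. q z = q y} \<le> card ((\<lambda>\<sigma>. \<sigma> y) ` H)"
        using rat_card_fibre_le[OF q(1), of "q y"] q(2) card_image[OF inj] by linarith
    qed
    then have "y' \<in> (\<lambda>\<sigma>. \<sigma> y) ` H" using y(2) by auto
    then show "\<theta> y = \<theta> y'" using deck_apply[OF Hdeck] by auto
  qed auto
  obtain h where h: "holo h" "q \<circ> F = h \<circ> \<theta>'"
  proof (rule holo_factor[OF r(2) rat_holo[OF rational_compose[OF rq F(1)]]])
    show "finite ({z. F z \<in> S0} \<union> {Infty} \<union> {z. \<theta>' z \<in> {z. \<nu>' z \<noteq> 1}})"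
      using finite_preimage[OF F(1) finS0] finite_preimage[OF r(2) finnu(2)] by blast
    fix z z' assume z: "z \<notin> {z. F z \<in> S0} \<union> {Infty} \<union> {z. \<theta>' z \<in> {z. \<nu>' z \<noteq> 1}}" "\<theta>' z = \<theta>' z'"
    then obtain \<sigma>' where s': "\<sigma>' \<in> deck \<theta>'" "\<sigma>' z = z'"
      using deck_transitive[OF uc'(1), of z z'] by auto
    then obtain \<sigma> where s: "\<sigma> \<in> deck \<theta>" "\<sigma> \<circ> F = F \<circ> \<sigma>'" using equivariant by blast
    then have "\<sigma> \<in> H" using s' by (auto simp: H_def)
    have "F z' = \<sigma> (F z)" using s(2) s'(2) by (metis comp_apply)
    then show "(q \<circ> F) z = (q \<circ> F) z'" using qH[OF _ \<open>\<sigma> \<in> H\<close>, of "F z"] z(1) by simp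
  qed auto
  have nonconst: "\<nexists>c. G = (\<lambda>_. c)" if "surj (G \<circ> K)" for G K :: "cp1 \<Rightarrow> cp1"
    using that by (metis comp_apply cp1.distinct(1) surjD)
  have rg: "rational_function g" using nonconst[of g q] g rat_surj[OF r(1)] holo_imp_rational by metis
  have rh: "rational_function h"
    using nonconst[of h \<theta>'] h rat_surj[OF rational_compose[OF rq F(1)]] holo_imp_rational by metis
  obtain m where m: "rational_of_degree m g" using rg by (auto simp: rational_function_def)
  have "m * k = N"
    using rational_of_degree_compose[OF m q(1)] uc(2) unfolding g(2)[symmetric] by (rule rational_of_degree_unique)
  then have "m \<noteq> 1" using q(2) H(2) less by auto
  then have "m \<ge> 2" using rational_of_degree_pos[OF m] by simp
  moreover have "f = g \<circ> h"
  proof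
    fix x
    obtain z where z: "\<theta>' z = x" using rat_surj[OF r(2)] by (metis surjD)
    have "f x = \<theta> (F z)" using thF z by simp
    also have "\<dots> = g ((q \<circ> F) z)" by (simp add: g(2))
    also have "\<dots> = (g \<circ> h) x" unfolding h(2) by (simp add: z)
    finally show "f x = (g \<circ> h) x" .
  qed
  ultimately show thesis using that m rh rq g(2) by blast
qed

lemma decomposable_or_left_factor:
  assumes f: "rational_function f" and \<theta>: "rational_function \<theta>"
    and g: "rational_of_degree m g" "m \<ge> 2" "rational_function h" "rational_function k" "f = g \<circ> h" "\<theta> = g \<circ> k"
  shows "decomposable f \<or> (indecomposable f \<and> left_factor f \<theta>)"
proof (cases "decomposable f")
  case False
  obtain n where n: "rational_of_degree n h" using g(3) by (auto simp: rational_function_def)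
  have "\<not> n \<ge> 2" using False f g n unfolding decomposable_def by blast
  then have "n = 1" using rational_of_degree_pos[OF n] by simp
  then obtain l where l: "rational_of_degree 1 l" "h \<circ> l = id"
    using degree_one_inverse n by metis
  have "\<theta> = f \<circ> (l \<circ> k)" using g(5,6) l(2) by (metis comp_assoc comp_id)
  moreover have "rational_function (l \<circ> k)"
    using rational_compose[OF rational_of_degree_imp_rational[OF l(1)] g(4)] .
  ultimately show ?thesis using False f \<theta> by (auto simp: indecomposable_def left_factor_def)
qed simp

section \<open>The Riemann-Hurwitz formula for orbifolds\<close>

lemma pullback_pos:
  assumes "orbifold \<nu>"
  shows "pullback f \<nu> x \<ge> 1"
proof -
  have "\<nu> (f x) \<ge> 1" using assms by (simp add: orbifold_def)
  then have "gcd (local_degree f x) (\<nu> (f x)) \<le> \<nu> (f x)" "gcd (local_degree f x) (\<nu> (f x)) > 0"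
    by (auto intro: dvd_imp_le)
  then show ?thesis unfolding pullback_def by (simp add: Suc_le_eq div_greater_zero_iff)
qed

lemma pullback_dvd: "pullback f \<nu> x dvd \<nu> (f x)"
  unfolding pullback_def by (metis dvd_div_mult_self dvd_triv_left gcd_dvd2)

lemma orbifold_pullback:
  assumes "rational_function f" "orbifold \<nu>"
  shows "orbifold (pullback f \<nu>)"
proof -
  have "{z. pullback f \<nu> z \<noteq> 1} \<subseteq> {z. f z \<in> {z. \<nu> z \<noteq> 1}}"
    using pullback_dvd[of f \<nu>] by (auto, metis nat_dvd_1_iff_1 One_nat_def)
  moreover have "finite {z. f z \<in> {z. \<nu> z \<noteq> 1}}"
    using assms by (intro finite_preimage) (auto simp: orbifold_def)
  ultimately show ?thesis using pullback_pos[OF assms(2)] finite_subset unfolding orbifold_def by blast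
qed

lemma euler_char_eq:
  assumes "finite X" "\<And>z. z \<notin> X \<Longrightarrow> \<nu> z = 1"
  shows "euler_char \<nu> = 2 + (\<Sum>z\<in>X. 1 / real (\<nu> z) - 1)"
proof -
  have "(\<Sum>z | \<nu> z \<noteq> 1. 1 / real (\<nu> z) - 1) = (\<Sum>z\<in>X. 1 / real (\<nu> z) - 1)"
    using assms by (intro sum.mono_neutral_left) auto
  then show ?thesis by (simp add: euler_char_def)
qed

text \<open>X carries all points where either formula has a nonzero term. Sharing this index set
  turns the comparison of the two Euler characteristics into the termwise comparison of the local
  degree e with gcd(e, \<nu>).\<close>

lemma orbifold_riemann_hurwitz:
  assumes f: "rational_of_degree d f" and \<nu>: "orbifold \<nu>"
  defines "X \<equiv> {x. \<nu> (f x) \<noteq> 1} \<union> {x. local_degree f x \<noteq> 1}"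
  shows "finite X"
    "real d * euler_char \<nu> = 2 + (\<Sum>x\<in>X. real (local_degree f x) / real (\<nu> (f x)) - 1)"
    "euler_char (pullback f \<nu>) = 2 + (\<Sum>x\<in>X. real (gcd (local_degree f x) (\<nu> (f x))) / real (\<nu> (f x)) - 1)"
proof -
  have r: "rational_function f" using f by (rule rational_of_degree_imp_rational)
  define e where "e = local_degree f"
  define Z where "Z = {z. \<nu> z \<noteq> 1}"
  have finZ: "finite Z" using \<nu> by (simp add: Z_def orbifold_def)
  have finP: "finite {x. f x \<in> Z}" by (rule finite_preimage[OF r finZ])
  then show finX: "finite X" using rat_finite_ramified[OF r] by (simp add: X_def Z_def)
  have epos: "e x \<ge> 1" for x unfolding e_def by (rule rat_local_degree_pos[OF r])
  have "real d * (\<Sum>z\<in>Z. 1 / real (\<nu> z) - 1) = (\<Sum>z\<in>Z. (\<Sum>x | f x = z. real (e x)) * (1 / real (\<nu> z) - 1))"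
    unfolding sum_distrib_left e_def
    by (intro sum.cong refl) (simp add: rat_sum_fibre[OF f] flip: of_nat_sum)
  also have "\<dots> = (\<Sum>z\<in>Z. \<Sum>x | x \<in> {x. f x \<in> Z} \<and> f x = z. real (e x) * (1 / real (\<nu> (f x)) - 1))"
    unfolding sum_distrib_right by (intro sum.cong) auto
  also have "\<dots> = (\<Sum>x | f x \<in> Z. real (e x) * (1 / real (\<nu> (f x)) - 1))"
    by (rule sum.group) (use finP finZ in auto)
  also have "\<dots> = (\<Sum>x\<in>X. real (e x) * (1 / real (\<nu> (f x)) - 1))"
    using finX by (intro sum.mono_neutral_left) (auto simp: X_def Z_def)
  finally have 1: "real d * (\<Sum>z\<in>Z. 1 / real (\<nu> z) - 1) = (\<Sum>x\<in>X. real (e x) * (1 / real (\<nu> (f x)) - 1))" .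
  have "2 * real d - 2 = real (2 * d - 2)" using rational_of_degree_pos[OF f] by (simp add: of_nat_diff)
  also have "\<dots> = (\<Sum>x | e x \<noteq> 1. real (e x - 1))"
    unfolding e_def rat_riemann_hurwitz[OF f, symmetric] by simp
  also have "\<dots> = (\<Sum>x | e x \<noteq> 1. real (e x) - 1)" using epos by (intro sum.cong) (auto simp: of_nat_diff)
  also have "\<dots> = (\<Sum>x\<in>X. real (e x) - 1)"
    using finX by (intro sum.mono_neutral_left) (auto simp: X_def e_def)
  finally have 2: "2 * real d - 2 = (\<Sum>x\<in>X. real (e x) - 1)" .
  have "real d * euler_char \<nu> = 2 + ((\<Sum>x\<in>X. real (e x) - 1) + (\<Sum>x\<in>X. real (e x) * (1 / real (\<nu> (f x)) - 1)))"
    unfolding euler_char_def Z_def[symmetric] distrib_left 1 2[symmetric] by simp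
  also have "\<dots> = 2 + (\<Sum>x\<in>X. real (e x) / real (\<nu> (f x)) - 1)"
    unfolding sum.distrib[symmetric] by (simp add: algebra_simps)
  finally show "real d * euler_char \<nu> = 2 + (\<Sum>x\<in>X. real (local_degree f x) / real (\<nu> (f x)) - 1)"
    unfolding e_def .
  have "pullback f \<nu> x = 1" if "x \<notin> X" for x
    using that by (simp add: X_def pullback_def)
  then have "euler_char (pullback f \<nu>) = 2 + (\<Sum>x\<in>X. 1 / real (pullback f \<nu> x) - 1)"
    by (rule euler_char_eq[OF finX])
  moreover have "1 / real (pullback f \<nu> x) = real (gcd (local_degree f x) (\<nu> (f x))) / real (\<nu> (f x))" for x
    unfolding pullback_def by (subst real_of_nat_div) auto
  ultimately show "euler_char (pullback f \<nu>) = 2 + (\<Sum>x\<in>X. real (gcd (local_degree f x) (\<nu> (f x))) / real (\<nu> (f x)) - 1)"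
    by (simp only:)
qed

lemma euler_char_pullback_le:
  assumes f: "rational_of_degree d f" and \<nu>: "orbifold \<nu>"
  shows "euler_char (pullback f \<nu>) \<le> real d * euler_char \<nu>"
proof -
  have "gcd (local_degree f x) (\<nu> (f x)) \<le> local_degree f x" for x
    using rat_local_degree_pos[OF rational_of_degree_imp_rational[OF f], of x] by (intro dvd_imp_le) auto
  then show ?thesis unfolding orbifold_riemann_hurwitz(2,3)[OF f \<nu>]
    by (intro add_left_mono sum_mono diff_right_mono divide_right_mono) auto
qed

text \<open>Each term e/\<nu> - 1 of the orbifold formula vanishes, which leaves only the Euler
  characteristic 2 of the sphere.\<close>

lemma universal_covering_degree:
  assumes uc: "universal_covering \<theta> \<nu>" and N: "rational_of_degree N \<theta>"
  shows "real N * euler_char \<nu> = 2"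
proof -
  have "\<nu> z \<ge> 1" for z using uc by (simp add: universal_covering_iff orbifold_def)
  then have "real (local_degree \<theta> x) / real (\<nu> (\<theta> x)) - 1 = 0" for x
    using uc rat_local_degree_pos[of \<theta> x] by (simp add: universal_covering_iff)
  then have "(\<Sum>x\<in>X. real (local_degree \<theta> x) / real (\<nu> (\<theta> x)) - 1) = 0" for X
    by (intro sum.neutral) blast
  moreover have "orbifold \<nu>" using uc by (simp add: universal_covering_iff)
  ultimately show ?thesis unfolding orbifold_riemann_hurwitz(2)[OF N \<open>orbifold \<nu>\<close>] by simp
qed

section \<open>Orbifolds of positive Euler characteristic\<close>

text \<open>Index 1 is permitted, so orbifolds with fewer than three ramified points have the same
  form and need no separate notation.\<close>

definition orb :: "cp1 \<Rightarrow> nat \<Rightarrow> cp1 \<Rightarrow> nat \<Rightarrow> cp1 \<Rightarrow> nat \<Rightarrow> cp1 \<Rightarrow> nat" where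
  "orb a k b l c m z = (if z = a then k else if z = b then l else if z = c then m else 1)"

lemma orbifold_orb: "k \<ge> 1 \<Longrightarrow> l \<ge> 1 \<Longrightarrow> m \<ge> 1 \<Longrightarrow> orbifold (orb a k b l c m)"
  unfolding orbifold_def by (auto simp: orb_def intro!: finite_subset[of _ "{a, b, c}"])

lemma orb_rotate: "distinct [a, b, c] \<Longrightarrow> orb a k b l c m = orb b l c m a k"
  by (auto simp: orb_def fun_eq_iff)

lemma orb_swap: "distinct [a, b, c] \<Longrightarrow> orb a k b l c m = orb b l a k c m"
  by (auto simp: orb_def fun_eq_iff)

lemma euler_char_orb:
  assumes "distinct [a, b, c]"
  shows "euler_char (orb a k b l c m) = 1 / real k + 1 / real l + 1 / real m - 1"
proof -
  have "euler_char (orb a k b l c m) = 2 + (\<Sum>z\<in>{a, b, c}. 1 / real (orb a k b l c m z) - 1)"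
    by (rule euler_char_eq) (auto simp: orb_def)
  then show ?thesis using assms by (auto simp: orb_def)
qed

lemma fresh_cp1: "\<exists>c::cp1. c \<notin> S" if "finite S"
proof -
  have "infinite (range Fin)"
    using finite_imageD[of Fin UNIV] infinite_UNIV_char_0[where 'a = complex] by (auto simp: inj_on_def)
  then show ?thesis using that by (metis finite_subset subsetI)
qed

text \<open>The sorted triples from 2 upwards whose reciprocals sum to more than 1: dihedral
  (2,2,m), tetrahedral (2,3,3), octahedral (2,3,4) and icosahedral (2,3,5).\<close>

definition spherical :: "nat \<Rightarrow> nat \<Rightarrow> nat \<Rightarrow> bool" where
  "spherical k l m \<longleftrightarrow> k = 2 \<and> l = 2 \<and> m \<ge> 2 \<or> k = 2 \<and> l = 3 \<and> m \<in> {3, 4, 5}"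

lemma sorted_spherical:
  fixes x y z :: nat
  assumes "2 \<le> x" "x \<le> y" "y \<le> z" "1 / real x + 1 / real y + 1 / real z > 1"
  shows "spherical x y z"
proof -
  have inv: "1 / real v \<le> 1 / real u" if "u \<le> v" "2 \<le> u" for u v using that by (simp add: frac_le)
  have "1 / real y \<le> 1 / real x" "1 / real z \<le> 1 / real y" using inv assms by auto
  then have "3 / real x > 1" using assms(4) by simp
  then have x: "x = 2" using assms(1) by (simp add: field_simps)
  have "2 / real y > 1 / 2" using assms(4) \<open>1 / real z \<le> 1 / real y\<close> by (simp add: x)
  then have y: "y = 2 \<or> y = 3" using assms(1,2) by (simp add: field_simps) linarith
  show ?thesis
  proof (cases "y = 2")
    case True
    then show ?thesis using x assms by (simp add: spherical_def)
  next
    case False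
    then have y: "y = 3" using y by simp
    then have "1 / real z > 1 / 6" using assms(4) x by simp
    then have "z < 6" using assms by (simp add: field_simps)
    then show ?thesis using x y assms by (auto simp: spherical_def)
  qed
qed

text \<open>Each ramified point lowers the Euler characteristic by at least 1/2, so at most three
  occur. For m = 1 the indices k and l are unrelated: bad orbifolds are included, as a pullback may
  be bad.\<close>

lemma positive_orbifold_cases:
  assumes \<nu>: "orbifold \<nu>" "euler_char \<nu> > 0"
  obtains a k b l c m where "distinct [a, b, c]" "k \<ge> 1" "l \<ge> 1" "\<nu> = orb a k b l c m" "m = 1 \<or> spherical k l m"
proof -
  note result = that
  define T where "T = {z. \<nu> z \<noteq> 1}"
  have fin: "finite T" using \<nu> by (simp add: T_def orbifold_def)
  have ge: "\<nu> z \<ge> 2" if "z \<in> T" for z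
    using \<nu>(1) that unfolding orbifold_def T_def by (metis (mono_tags) le_antisym mem_Collect_eq not_less_eq_eq numeral_2_eq_2 One_nat_def)
  have "(\<Sum>z\<in>T. 1 / real (\<nu> z) - 1) \<le> (\<Sum>z\<in>T. - (1 / 2))"
  proof (rule sum_mono)
    fix z assume "z \<in> T"
    then have "real (\<nu> z) \<ge> 2" using ge by force
    then show "1 / real (\<nu> z) - 1 \<le> - (1 / 2)" by (simp add: field_simps)
  qed
  also have "\<dots> = - real (card T) / 2" by simp
  finally have "real (card T) < 4" using \<nu>(2) unfolding euler_char_def T_def[symmetric] by linarith
  then consider "card T \<le> 2" | "card T = 3" by linarith
  then show thesis
  proof cases
    case 1
    then have "\<exists>a b. a \<noteq> b \<and> T \<subseteq> {a, b}"
    proof -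
      consider "card T = 0" | "card T = 1" | "card T = 2" using 1 by linarith
      then show ?thesis
      proof cases
        case 1
        then have "T = {}" using fin by simp
        then show ?thesis by (intro exI[of _ "Fin 0"] exI[of _ Infty]) auto
      next
        case 2
        then obtain a where "T = {a}" by (auto simp: card_1_singleton_iff)
        moreover obtain b where "b \<notin> {a}" using fresh_cp1[of "{a}"] by auto
        ultimately show ?thesis by (intro exI[of _ a] exI[of _ b]) auto
      next
        case 3
        then show ?thesis by (auto simp: card_2_iff)
      qed
    qed
    then obtain a b where ab: "a \<noteq> b" "T \<subseteq> {a, b}" by blast
    obtain c where c: "c \<notin> {a, b}" using fresh_cp1[of "{a, b}"] by auto
    have "\<nu> = orb a (\<nu> a) b (\<nu> b) c 1" using ab by (auto simp: orb_def T_def fun_eq_iff)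
    then show ?thesis using result[of a b c "\<nu> a" "\<nu> b" 1] ab c \<nu>(1) by (auto simp: orbifold_def)
  next
    case 2
    then obtain a b c where abc: "T = {a, b, c}" "distinct [a, b, c]" by (auto simp: card_3_iff)
    have sorted: thesis if d: "distinct [a, b, c]" "T = {a, b, c}" "\<nu> a \<le> \<nu> b" "\<nu> b \<le> \<nu> c" for a b c
    proof -
      have eq: "\<nu> = orb a (\<nu> a) b (\<nu> b) c (\<nu> c)"
      proof
        fix z show "\<nu> z = orb a (\<nu> a) b (\<nu> b) c (\<nu> c) z"
          using d(2) unfolding T_def orb_def by (cases "\<nu> z = 1") auto
      qed
      have g: "2 \<le> \<nu> a" "2 \<le> \<nu> b" "2 \<le> \<nu> c" using ge d(2) by auto
      have "euler_char \<nu> = 1 / real (\<nu> a) + 1 / real (\<nu> b) + 1 / real (\<nu> c) - 1"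
        using euler_char_orb[OF d(1), of "\<nu> a" "\<nu> b" "\<nu> c"] eq by simp
      then have "spherical (\<nu> a) (\<nu> b) (\<nu> c)" using sorted_spherical[OF g(1) d(3,4)] \<nu>(2) by simp
      then show thesis using result[OF d(1) _ _ eq] g by simp
    qed
    show thesis
      using sorted[of a b c] sorted[of a c b] sorted[of b a c] sorted[of b c a] sorted[of c a b] sorted[of c b a] abc
      by (auto simp: insert_commute) (meson nat_le_linear)
  qed
qed

section \<open>Existence of universal coverings\<close>

lemma universal_covering_compose:
  assumes g: "rational_function g" and uc: "universal_covering \<theta> \<nu>'" and \<nu>: "orbifold \<nu>"
    and cov: "\<And>x. \<nu> (g x) = \<nu>' x * local_degree g x"
  shows "universal_covering (g \<circ> \<theta>) \<nu>"
  using uc \<nu> unfolding universal_covering_iff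
  by (auto simp: local_degree_compose[OF g] cov intro: rational_compose[OF g])

lemma rational_of_degree_imp_local_degree_one:
  assumes "rational_of_degree 1 \<mu>"
  shows "local_degree \<mu> z = 1"
proof -
  have r: "rational_function \<mu>" using assms by (rule rational_of_degree_imp_rational)
  have "local_degree \<mu> z \<le> (\<Sum>x | \<mu> x = \<mu> z. local_degree \<mu> x)"
    by (rule member_le_sum) (auto intro: rat_finite_fibre[OF r])
  then show ?thesis using rat_sum_fibre[OF assms] rat_local_degree_pos[OF r, of z] by simp
qed

section \<open>Explicit coverings of the spherical orbifolds\<close>

lemma moebius_three_points:
  assumes d: "distinct [z1, z2, z3]"
  obtains \<mu> where "rational_of_degree 1 \<mu>" "\<mu> (Fin 0) = z1" "\<mu> Infty = z2" "\<mu> (Fin 1) = z3"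
proof -
  have lin: "rational_of_degree 1 (rat_map [:a, b:] [:c, d:])" if "a * d - b * c \<noteq> 0" for a b c d :: complex
  proof -
    have "coprime [:a, b:] [:c, d:]"
    proof (rule coprime_complex_polyI)
      show "[:a, b:] \<noteq> 0" using that by auto
      fix x assume x: "poly [:a, b:] x = 0" "poly [:c, d:] x = 0"
      then have "a = - (x * b)" "c = - (x * d)" by (simp_all add: eq_neg_iff_add_eq_0)
      then show False using that by simp
    qed
    moreover have "max (degree [:a, b:]) (degree [:c, d:]) = 1" using that by auto
    ultimately show ?thesis unfolding rational_of_degree_def
      by (intro conjI exI[of _ "[:a, b:]"] exI[of _ "[:c, d:]"]) auto
  qed
  have "\<exists>\<kappa>. rational_of_degree 1 \<kappa> \<and> \<kappa> z1 = Fin 0 \<and> \<kappa> z2 = Infty \<and> \<kappa> z3 = Fin 1"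
  proof (cases z1)
    case z1: Infty
    obtain b c where bc: "z2 = Fin b" "z3 = Fin c" "b \<noteq> c" using d z1 by (cases z2; cases z3) auto
    show ?thesis
      by (intro exI[of _ "rat_map [:c - b, 0:] [:-b, 1:]"] conjI lin) (use bc z1 in auto)
  next
    case z1: (Fin a)
    show ?thesis
    proof (cases z2)
      case z2: Infty
      obtain c where c: "z3 = Fin c" "c \<noteq> a" using d z1 z2 by (cases z3) auto
      show ?thesis
        by (intro exI[of _ "rat_map [:-a, 1:] [:c - a, 0:]"] conjI lin) (use c z1 z2 in auto)
    next
      case z2: (Fin b)
      show ?thesis
      proof (cases z3)
        case z3: Infty
        have "a \<noteq> b" using d z1 z2 by auto
        then show ?thesis
          by (intro exI[of _ "rat_map [:-a, 1:] [:-b, 1:]"] conjI lin) (use z1 z2 z3 in auto)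
      next
        case z3: (Fin c)
        have ne: "a \<noteq> b" "a \<noteq> c" "b \<noteq> c" using d z1 z2 z3 by auto
        \<comment> \<open>The cross ratio (x - a)(c - b) / ((x - b)(c - a)), which sends a, b, c to
          0, \<open>Infty\<close>, 1.\<close>
        define p q where "p = [:- a * (c - b), c - b:]" and "q = [:- b * (c - a), c - a:]"
        have "- a * (c - b) * (c - a) - (c - b) * (- b * (c - a)) = (c - b) * (c - a) * (b - a)"
          by (simp add: algebra_simps)
        then have "rational_of_degree 1 (rat_map p q)" unfolding p_def q_def using ne by (intro lin) simp
        moreover have pq: "poly p x = (x - a) * (c - b)" "poly q x = (x - b) * (c - a)" for x
          by (simp_all add: p_def q_def algebra_simps)
        have "rat_map p q z1 = Fin 0" "rat_map p q z2 = Infty" "rat_map p q z3 = Fin 1"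
          using ne by (simp_all add: z1 z2 z3 pq)
        ultimately show ?thesis by blast
      qed
    qed
  qed
  then obtain \<kappa> where k: "rational_of_degree 1 \<kappa>" "\<kappa> z1 = Fin 0" "\<kappa> z2 = Infty" "\<kappa> z3 = Fin 1" by blast
  obtain \<mu> where m: "rational_of_degree 1 \<mu>" "\<mu> \<circ> \<kappa> = id" using degree_one_inverse[OF k(1)] by metis
  have "\<mu> (\<kappa> z) = z" for z using m(2) by (metis comp_apply id_apply)
  then show thesis using that[OF m(1)] k by metis
qed

text \<open>Quantifying over all positions of the three points lets each step of the tower place
  them where its polynomial map needs them.\<close>

definition covered :: "nat \<Rightarrow> nat \<Rightarrow> nat \<Rightarrow> bool" where
  "covered k l m \<longleftrightarrow> (\<forall>a b c. distinct [a, b, c] \<longrightarrow> (\<exists>\<theta>. universal_covering \<theta> (orb a k b l c m)))"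

lemma covered_rotate: "covered k l m \<Longrightarrow> covered l m k"
  unfolding covered_def by (metis orb_rotate distinct_length_2_or_more distinct_singleton)

lemma covered_swap: "covered k l m \<Longrightarrow> covered l k m"
  unfolding covered_def by (metis orb_swap distinct_length_2_or_more distinct_singleton)

text \<open>Moebius transformations carry 0, \<open>Infty\<close>, 1 to any three points, so one
  standard position suffices. There a map g from an already covered orbifold is enough, since local
  degrees multiply.\<close>

lemma coveredI:
  assumes klm: "k \<ge> 1" "l \<ge> 1" "m \<ge> 1" and g: "rational_function g" and uc: "universal_covering \<theta> \<nu>'"
    and cov: "\<And>x. orb (Fin 0) k Infty l (Fin 1) m (g x) = \<nu>' x * local_degree g x"
  shows "covered k l m"
  unfolding covered_def
proof (intro allI impI)
  fix a b c :: cp1 assume d: "distinct [a, b, c]"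
  obtain \<mu> where m: "rational_of_degree 1 \<mu>" "\<mu> (Fin 0) = a" "\<mu> Infty = b" "\<mu> (Fin 1) = c"
    using moebius_three_points[OF d] by metis
  have r: "rational_function \<mu>" using m(1) by (rule rational_of_degree_imp_rational)
  obtain \<kappa> where k: "\<kappa> \<circ> \<mu> = id" using degree_one_inverse[OF m(1)] by metis
  then have inj: "\<mu> z = \<mu> z' \<longleftrightarrow> z = z'" for z z' by (metis comp_apply id_apply)
  have "orb a k b l c m (\<mu> z) = orb (Fin 0) k Infty l (Fin 1) m z" for z
    unfolding orb_def m(2-4)[symmetric] inj ..
  then have "universal_covering (\<mu> \<circ> (g \<circ> \<theta>)) (orb a k b l c m)"
    using universal_covering_compose[OF g uc orbifold_orb[OF klm] cov]
    by (intro universal_covering_compose[OF r _ orbifold_orb[OF klm]])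
       (auto simp: rational_of_degree_imp_local_degree_one[OF m(1)])
  then show "\<exists>\<theta>. universal_covering \<theta> (orb a k b l c m)" by blast
qed

lemma polynomial_map:
  assumes "degree P \<ge> 1"
  shows "rational_function (rat_map P 1)"
    "rat_map P 1 (Fin x) = Fin (poly P x)" "rat_map P 1 Infty = Infty"
    "local_degree (rat_map P 1) (Fin x) = Suc (order x (pderiv P))"
    "local_degree (rat_map P 1) Infty = degree P"
proof -
  interpret coprime_fraction P 1 by standard (use assms in auto)
  show r: "rational_function (rat_map P 1)"
    unfolding rational_function_def rational_of_degree_def using assms
    by (intro exI[of _ "degree P"] conjI exI[of _ P] exI[of _ 1]) auto
  show "rat_map P 1 (Fin x) = Fin (poly P x)" by simp
  show inf: "rat_map P 1 Infty = Infty" using assms by simp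
  show "local_degree (rat_map P 1) (Fin x) = Suc (order x (pderiv P))"
    using wronskian_order(2)[of x] rat_local_degree_pos[OF r, of "Fin x"] by (simp add: wronskian_def)
  show "local_degree (rat_map P 1) Infty = degree P"
    unfolding local_degree_Infty inf by (simp add: fibre_poly_def d_def)
qed

lemma order_linear_factor: "order a [:-b, 1:] = (if a = b then 1 else 0)" for a b :: complex
  using order_power_n_n[of b 1] order_0I[of "[:-b, 1:]" a] by auto

lemma power_map:
  assumes "n \<ge> 1"
  shows "local_degree (rat_map (monom 1 n) 1) (Fin x) = (if x = 0 then n else 1)"
proof -
  have "pderiv (monom 1 n) = smult (of_nat n) ([:- (0::complex), 1:] ^ (n - 1))"
    unfolding pderiv_monom by (simp add: monom_altdef)
  then have "order x (pderiv (monom 1 n)) = order x ([:- 0, 1:] ^ (n - 1))"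
    using assms by (simp add: order_smult)
  also have "\<dots> = (if x = 0 then n - 1 else 0)"
    using order_power_n_n[of 0 "n - 1"] order_0I[of "[:- (0::complex), 1:] ^ (n - 1)" x] by auto
  finally show ?thesis using polynomial_map(4)[of "monom 1 n" x] assms by (simp add: degree_monom_eq)
qed

lemma covered_cyclic:
  assumes n: "n \<ge> 1"
  shows "covered n n 1"
proof (rule coveredI)
  let ?g = "rat_map (monom 1 n) 1"
  note g = polynomial_map[of "monom 1 n :: complex poly"]
  have deg: "degree (monom 1 n :: complex poly) = n" by (simp add: degree_monom_eq)
  show "rational_function ?g" using g deg n by simp
  have "mult_at (\<lambda>w. id (param z w)) 0 1" for z
    unfolding mult_at_def by (intro conjI exI[of _ "\<lambda>_. 1"]) (auto intro: analytic_intros)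
  then have "local_degree id z = 1" for z by (intro local_degree_eqI) auto
  then show "universal_covering id (\<lambda>_. 1)"
    unfolding universal_covering_iff orbifold_def
    using rational_of_degree_id by (auto intro: rational_of_degree_imp_rational)
  show "orb (Fin 0) n Infty n (Fin 1) 1 (?g x) = 1 * local_degree ?g x" for x
    using g(2,3,5) deg n power_map[OF n] by (cases x) (auto simp: orb_def poly_monom)
qed (use n in auto)

text \<open>Squaring is the quotient by z -> -z: it exchanges the two points 1 and -1 of index n and
  creates index 2 at its ramified points 0 and \<open>Infty\<close>.\<close>

lemma covered_dihedral:
  assumes n: "n \<ge> 1"
  shows "covered 2 2 n"
proof -
  let ?g = "rat_map (monom 1 2) 1" and ?\<nu> = "orb (Fin 1) n (Fin (-1)) n (Fin 0) 1"
  note g = polynomial_map[of "monom 1 2 :: complex poly"]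
  have deg: "degree (monom 1 2 :: complex poly) = 2" by (simp add: degree_monom_eq)
  obtain \<theta> where uc: "universal_covering \<theta> ?\<nu>"
    using covered_cyclic[OF n] unfolding covered_def by fastforce
  have "orb (Fin 0) 2 Infty 2 (Fin 1) n (?g x) = ?\<nu> x * local_degree ?g x" for x
    using g(2,3,5) deg power_map[of 2] by (cases x) (auto simp: orb_def poly_monom power2_eq_1_iff)
  then show ?thesis using g(1) deg uc n by (intro coveredI) auto
qed

text \<open>Cubing is the quotient by a rotation of order three that permutes the three points of
  index 2 of the orbifold (2,2,2), that of the Klein four-group in the tetrahedral group.\<close>

lemma covered_tetrahedral: "covered 3 3 2"
proof -
  define \<omega> where "\<omega> = Complex (-1/2) (sqrt 3 / 2)"
  have w: "\<omega> ^ 2 + \<omega> + 1 = 0" "\<omega> \<noteq> 1" "\<omega> ^ 2 \<noteq> 1" "\<omega> \<noteq> \<omega> ^ 2"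
    by (auto simp: \<omega>_def complex_eq_iff power2_eq_square)
  have cube: "x ^ 3 = 1 \<longleftrightarrow> x = 1 \<or> x = \<omega> \<or> x = \<omega> ^ 2" for x
  proof -
    have "x ^ 3 - 1 = (x - 1) * (x - \<omega>) * (x - \<omega> ^ 2)"
      using w(1) by algebra
    then show ?thesis by (metis eq_iff_diff_eq_0 mult_eq_0_iff)
  qed
  let ?g = "rat_map (monom 1 3) 1" and ?\<nu> = "orb (Fin 1) 2 (Fin \<omega>) 2 (Fin (\<omega> ^ 2)) 2"
  note g = polynomial_map[of "monom 1 3 :: complex poly"]
  have deg: "degree (monom 1 3 :: complex poly) = 3" by (simp add: degree_monom_eq)
  obtain \<theta> where uc: "universal_covering \<theta> ?\<nu>"
    using covered_dihedral[of 2] w unfolding covered_def by fastforce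
  have w0: "\<omega> \<noteq> 0" using w(1) by auto
  have "orb (Fin 0) 3 Infty 3 (Fin 1) 2 (?g x) = ?\<nu> x * local_degree ?g x" for x
    using g(2,3,5) deg power_map[of 3] cube w0 by (cases x) (auto simp: orb_def poly_monom)
  then show ?thesis using g(1) deg uc by (intro coveredI) auto
qed

text \<open>The tetrahedral group has index 2 in the octahedral group. Squaring identifies the two
  points of index 3 and doubles the index 2 at \<open>Infty\<close> to 4.\<close>

lemma covered_octahedral: "covered 2 4 3"
proof -
  let ?g = "rat_map (monom 1 2) 1" and ?\<nu> = "orb (Fin 1) 3 (Fin (-1)) 3 Infty 2"
  note g = polynomial_map[of "monom 1 2 :: complex poly"]
  have deg: "degree (monom 1 2 :: complex poly) = 2" by (simp add: degree_monom_eq)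
  obtain \<theta> where uc: "universal_covering \<theta> ?\<nu>"
    using covered_tetrahedral unfolding covered_def by fastforce
  have "orb (Fin 0) 2 Infty 4 (Fin 1) 3 (?g x) = ?\<nu> x * local_degree ?g x" for x
    using g(2,3,5) deg power_map[of 2] by (cases x) (auto simp: orb_def poly_monom power2_eq_1_iff)
  then show ?thesis using g(1) deg uc by (intro coveredI) auto
qed

text \<open>
  The quintic \<open>P\<close> is the quotient map from the tetrahedral to the icosahedral orbifold:
  \<open>1728 (P - 1) = (x\<^sup>2 + 4x + 24)\<^sup>2 (x - 3)\<close> and \<open>1728 P' = 5x\<^sup>2 (x\<^sup>2 + 4x + 24)\<close>.
\<close>

lemma covered_icosahedral: "covered 3 5 2"
proof -
  obtain u :: complex where u: "u ^ 2 = - 135" using complex_root_exists[of 2] by auto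
  obtain v :: complex where v: "v ^ 2 = - 20" using complex_root_exists[of 2] by auto
  have u0: "u \<noteq> 0" and v0: "v \<noteq> 0" using u v by auto
  \<comment> \<open>The roots of x^2 + 5x + 40, where 1728 P = x^3 (x^2 + 5x + 40), and of x^2 + 4x
    + 24.\<close>
  define r1 r2 s1 s2 where "r1 = (- 5 + u) / 2" and "r2 = (- 5 - u) / 2" and "s1 = - 2 + v" and "s2 = - 2 - v"
  have "2 * r1 = - 5 + u" "2 * r2 = - 5 - u" by (simp_all add: r1_def r2_def)
  then have rs: "x ^ 2 + 5 * x + 40 = (x - r1) * (x - r2)" for x
    using u by algebra
  have ss: "x ^ 2 + 4 * x + 24 = (x - s1) * (x - s2)" for x
    using v unfolding s1_def s2_def by algebra
  have s12: "s1 \<noteq> s2" using v0 by (simp add: s1_def s2_def eq_neg_iff_add_eq_0)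
  have r12: "r1 \<noteq> r2" using u0 by (simp add: r1_def r2_def eq_neg_iff_add_eq_0)
  have r0: "r1 \<noteq> 0" "r2 \<noteq> 0" using rs[of 0] by auto
  have s0: "s1 \<noteq> 0" "s2 \<noteq> 0" using ss[of 0] by auto
  have r3: "r1 \<noteq> 3" "r2 \<noteq> 3" using rs[of 3] by auto
  have s3: "s1 \<noteq> 3" "s2 \<noteq> 3" using ss[of 3] by auto
  define P :: "complex poly" where "P = [:0, 0, 0, 40/1728, 5/1728, 1/1728:]"
  have deg: "degree P = 5" by (simp add: P_def)
  have val: "poly P x = x ^ 3 * ((x - r1) * (x - r2)) / 1728" for x
    unfolding rs[symmetric] by (simp add: P_def algebra_simps power2_eq_square power3_eq_cube)
  have val1: "poly P x - 1 = ((x - s1) * (x - s2)) ^ 2 * (x - 3) / 1728" for x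
    unfolding ss[symmetric] by (simp add: P_def algebra_simps power2_eq_square power3_eq_cube)
  have P0: "poly P x = 0 \<longleftrightarrow> x = 0 \<or> x = r1 \<or> x = r2" for x unfolding val by simp
  have P1: "poly P x = 1 \<longleftrightarrow> x = s1 \<or> x = s2 \<or> x = 3" for x
    using val1[of x] by auto
  have rs_ne: "r1 \<noteq> s1" "r1 \<noteq> s2" "r2 \<noteq> s1" "r2 \<noteq> s2"
    using P0[of r1] P1[of r1] P0[of r2] P1[of r2] by auto
  have "pderiv P = smult (5/1728) ([:- 0, 1:] ^ 2 * ([:- s1, 1:] * [:- s2, 1:]))"
  proof -
    have "s1 + s2 = - 4" by (simp add: s1_def s2_def)
    moreover have "s1 * s2 = 24" using ss[of 0] by simp
    moreover have "[:- s1, 1:] * [:- s2, 1:] = [:s1 * s2, - (s1 + s2), 1:]" by simp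
    ultimately have "[:- s1, 1:] * [:- s2, 1:] = [:24, 4, 1:]" by simp
    then show ?thesis by (simp add: P_def pderiv_pCons power2_eq_square)
  qed
  moreover have "order x ([:- 0, 1:] ^ 2) = (if x = 0 then 2 else 0)" for x :: complex
    using order_power_n_n[of 0 2] order_0I[of "[:- (0::complex), 1:] ^ 2" x] by auto
  ultimately have ord: "order x (pderiv P) = (if x = 0 then 2 else if x = s1 \<or> x = s2 then 1 else 0)" for x
    using s12 s0 by (simp add: order_smult order_mult order_linear_factor del: mult_pCons_left mult_pCons_right)
  let ?g = "rat_map P 1" and ?\<nu> = "orb (Fin r1) 3 (Fin r2) 3 (Fin 3) 2"
  note g = polynomial_map[of P]
  obtain \<theta> where uc: "universal_covering \<theta> ?\<nu>"
    using covered_tetrahedral r12 r3 unfolding covered_def by fastforce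
  \<comment> \<open>Over 0 lie the triple point 0 of index 1 and the simple points r1, r2 of index
    3; over 1 the double points s1, s2 of index 1 and the simple point 3 of index 2; over
    \<open>Infty\<close> one point of local degree 5.\<close>
  have "orb (Fin 0) 3 Infty 5 (Fin 1) 2 (?g x) = ?\<nu> x * local_degree ?g x" for x
    using g(2-5) deg r0 s0 r3 s3 rs_ne P0 P1 by (cases x) (auto simp: orb_def ord)
  then show ?thesis using g(1) deg uc by (intro coveredI) auto
qed

lemma spherical_covered:
  assumes "spherical k l m"
  shows "covered k l m"
proof -
  consider "k = 2" "l = 2" "m \<ge> 2" | "k = 2" "l = 3" "m = 3" | "k = 2" "l = 3" "m = 4" | "k = 2" "l = 3" "m = 5"
    using assms by (auto simp: spherical_def)
  then show ?thesis
  proof cases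
    case 1
    then show ?thesis using covered_dihedral[of m] by simp
  next
    case 2
    then show ?thesis using covered_rotate[OF covered_rotate[OF covered_tetrahedral]] by simp
  next
    case 3
    then show ?thesis using covered_swap[OF covered_rotate[OF covered_rotate[OF covered_octahedral]]] by simp
  next
    case 4
    then show ?thesis using covered_rotate[OF covered_rotate[OF covered_icosahedral]] by simp
  qed
qed

section \<open>Comparison of the two orbifolds\<close>

text \<open>The pullback index at x is the additive order of the local degree modulo \<nu>(f(x)). In
  this form it combines with linear congruences between local degrees.\<close>

lemma pullback_dvd_iff:
  assumes "orbifold \<nu>"
  shows "int (pullback f \<nu> x) dvd j \<longleftrightarrow> int (\<nu> (f x)) dvd j * int (local_degree f x)"
proof -
  define n e g where "n = \<nu> (f x)" and "e = local_degree f x" and "g = gcd e n"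
  have n: "n > 0" using assms by (simp add: n_def orbifold_def Suc_le_eq)
  then have g: "g > 0" by (simp add: g_def)
  define n' e' where "n' = n div g" and "e' = e div g"
  have d: "n = n' * g" "e = e' * g" "coprime n' e'"
    using div_gcd_coprime[of e n] n by (simp_all add: n'_def e'_def g_def coprime_commute)
  have "pullback f \<nu> x = n'" by (simp add: pullback_def n'_def g_def n_def e_def)
  moreover have "int n dvd j * int e \<longleftrightarrow> int n' * int g dvd (j * int e') * int g"
    by (simp add: d(1,2) mult.assoc)
  moreover have "int n' * int g dvd (j * int e') * int g \<longleftrightarrow> int n' dvd j"
    using g d(3) by (simp add: coprime_dvd_mult_left_iff)
  ultimately show ?thesis unfolding n_def[symmetric] e_def[symmetric] by simp
qed

text \<open>Where the pullback index is 1, the local degree is a multiple of \<nu>; modulo \<nu>(z)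
  only the three exceptional points contribute to the fibre sum d.\<close>

lemma fibre_congruence:
  assumes f: "rational_of_degree d f" and \<nu>: "orbifold \<nu>" and dis: "distinct [x1, x2, x3]"
    and one: "\<And>x. x \<notin> {x1, x2, x3} \<Longrightarrow> pullback f \<nu> x = 1"
  defines "I \<equiv> \<lambda>z x. if f x = z then int (local_degree f x) else 0"
  shows "int (\<nu> z) dvd int d - (I z x1 + I z x2 + I z x3)"
proof -
  let ?X = "{x1, x2, x3}"
  have fin: "finite {x. f x = z}" by (rule rat_finite_fibre[OF rational_of_degree_imp_rational[OF f]])
  have "int d = (\<Sum>x | f x = z. int (local_degree f x))" using rat_sum_fibre[OF f, of z] by auto
  also have "\<dots> = (\<Sum>x\<in>{x. f x = z} \<union> ?X. I z x)"
    using fin by (intro sum.mono_neutral_cong_left) (auto simp: I_def)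
  also have "{x. f x = z} \<union> ?X = ?X \<union> ({x. f x = z} - ?X)" by blast
  also have "(\<Sum>x\<in>?X \<union> ({x. f x = z} - ?X). I z x) = (\<Sum>x\<in>?X. I z x) + (\<Sum>x\<in>{x. f x = z} - ?X. I z x)"
    using fin by (intro sum.union_disjoint) auto
  also have "(\<Sum>x\<in>?X. I z x) = I z x1 + I z x2 + I z x3" using dis by simp
  finally have "int d - (I z x1 + I z x2 + I z x3) = (\<Sum>x\<in>{x. f x = z} - ?X. I z x)" by simp
  also have "int (\<nu> z) dvd \<dots>"
  proof (rule dvd_sum)
    fix x assume "x \<in> {x. f x = z} - ?X"
    then show "int (\<nu> z) dvd I z x" using pullback_dvd_iff[OF \<nu>, of f x 1] one[of x] by (auto simp: I_def)
  qed
  finally show ?thesis .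
qed

text \<open>The numbers \<open>a\<^sub>i\<close> are the orders of three elements of \<open>\<int>/n\<close> with sum zero.\<close>

lemma orders_sum_zero:
  fixes n E1 E2 E3 :: int and a1 a2 a3 :: nat
  assumes a: "\<And>j. int a1 dvd j \<longleftrightarrow> n dvd j * E1" "\<And>j. int a2 dvd j \<longleftrightarrow> n dvd j * E2" "\<And>j. int a3 dvd j \<longleftrightarrow> n dvd j * E3"
    and sum: "n dvd E1 + E2 + E3"
  shows "\<not> spherical a1 a2 a3" "a3 = 1 \<Longrightarrow> a1 = a2"
proof -
  have s: "n dvd j * E1 + j * E2 + j * E3" for j
    using dvd_mult[OF sum, of j] by (simp add: algebra_simps)
  \<comment> \<open>An integer that annihilates two elements of a zero sum annihilates the third, so
    each order divides every common multiple of the other two.\<close>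
  have r1: "int a1 dvd j" if "int a2 dvd j" "int a3 dvd j" for j
    using s[of j] that unfolding a by (metis add.assoc add.commute dvd_add dvd_add_left_iff)
  have r2: "int a2 dvd j" if "int a1 dvd j" "int a3 dvd j" for j
    using s[of j] that unfolding a by (metis dvd_add_left_iff dvd_add_right_iff)
  have r3: "int a3 dvd j" if "int a1 dvd j" "int a2 dvd j" for j
    using s[of j] that unfolding a by (metis dvd_add dvd_add_right_iff)
  show "a1 = a2" if "a3 = 1"
    using r1[of "int a2"] r2[of "int a1"] that by (simp add: dvd_antisym)
  show "\<not> spherical a1 a2 a3"
  proof
    assume sp: "spherical a1 a2 a3"
    then consider "a1 = 2" "a2 = 2" "a3 \<ge> 2" | "a1 = 2" "a2 = 3" "a3 \<in> {3, 4, 5}"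
      by (auto simp: spherical_def)
    then show False
    proof cases
      case 1
      \<comment> \<open>This leaves only the triple (2,2,2). A cyclic group has a single element of
        order two, so two such elements cannot add up to a third one.\<close>
      then have "int a3 dvd 2" using r3[of 2] by simp
      then have a3: "a3 = 2" using 1 by (metis int_dvd_int_iff of_nat_numeral dvd_imp_le le_antisym zero_less_numeral)
      have "\<not> n dvd 1 * E1" "n dvd 2 * E1" "\<not> n dvd 1 * E2" "n dvd 2 * E2" "\<not> n dvd 1 * E3"
        unfolding a[symmetric] using 1 a3 by simp_all
      then obtain u v where uv: "2 * E1 = n * u" "2 * E2 = n * v" "\<not> n dvd E1" "\<not> n dvd E2" "\<not> n dvd E3"
        by (auto simp: dvd_def)
      have "odd u"
      proof
        assume "even u"
        then obtain u' where "u = 2 * u'" by blast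
        then have "E1 = n * u'" using uv(1) by simp
        then show False using uv(3) by simp
      qed
      moreover have "odd v"
      proof
        assume "even v"
        then obtain v' where "v = 2 * v'" by blast
        then have "E2 = n * v'" using uv(2) by simp
        then show False using uv(4) by simp
      qed
      ultimately obtain w where "u + v = 2 * w" by (metis odd_add evenE)
      then have "2 * (E1 + E2) = 2 * (n * w)" using uv(1,2) by (metis distrib_left mult.left_commute)
      then have "E1 + E2 = n * w" by (metis mult_cancel_left zero_neq_numeral)
      then have "n dvd E1 + E2" by simp
      then have "n dvd E3" using sum by (metis dvd_add_right_iff)
      then show False using uv(5) by simp
    next
      case 2
      \<comment> \<open>The common multiples 3, 4 and 15 refute a3 = 3, 4 and 5 in turn: 2 does not
        divide 3, 3 does not divide 4, 2 does not divide 15.\<close>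
      then show False using r1[of 3] r2[of 4] r1[of 15] by auto
    qed
  qed
qed

lemma signature_orb:
  assumes "distinct [a, b, c]"
  shows "signature (orb a k b l c m) = filter_mset (\<lambda>n. n > 1) {#k, l, m#}"
proof -
  let ?\<nu> = "orb a k b l c m"
  have "{z. ?\<nu> z > 1} = {z \<in> {a, b, c}. ?\<nu> z > 1}" by (auto simp: orb_def)
  then have "signature ?\<nu> = image_mset ?\<nu> (filter_mset (\<lambda>z. ?\<nu> z > 1) (mset_set {a, b, c}))"
    unfolding signature_def by (simp add: filter_mset_mset_set)
  also have "\<dots> = filter_mset (\<lambda>n. n > 1) (image_mset ?\<nu> (mset_set {a, b, c}))"
    by (simp add: filter_mset_image_mset)
  also have "image_mset ?\<nu> (mset_set {a, b, c}) = {#k, l, m#}"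
    using assms by (auto simp: orb_def)
  finally show ?thesis .
qed

lemma good_orb_cyclic:
  assumes "good_orbifold (orb a k b l c 1)" "distinct [a, b, c]" "k \<ge> 1" "l \<ge> 1"
  shows "k = l"
proof (rule ccontr)
  assume ne: "k \<noteq> l"
  have set: "{z. orb a k b l c 1 z > 1} = (if k > 1 then {a} else {}) \<union> (if l > 1 then {b} else {})"
    using assms(2) by (auto simp: orb_def)
  have "\<exists>z. {z. orb a k b l c 1 z > 1} = {z}" if "k = 1 \<or> l = 1"
    unfolding set using that ne assms(3,4) by auto
  moreover have "\<exists>z1 z2. z1 \<noteq> z2 \<and> {z. orb a k b l c 1 z > 1} = {z1, z2} \<and> orb a k b l c 1 z1 \<noteq> orb a k b l c 1 z2" if "\<not> (k = 1 \<or> l = 1)"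
    unfolding set using that ne assms by (intro exI[of _ a] exI[of _ b]) (auto simp: orb_def)
  ultimately have "bad_orbifold (orb a k b l c 1)"
    using assms(1) unfolding bad_orbifold_def good_orbifold_def by blast
  then show False using assms(1) by (simp add: good_orbifold_def)
qed

text \<open>The orbifold (k,l,m) on the ramified points of the pullback plays the part of O'. As
  degree times Euler characteristic is 2 for both coverings, the larger Euler characteristic means
  the smaller degree.\<close>

lemma left_factor_of_dominating:
  assumes f: "rational_function f" and \<nu>: "euler_char \<nu> > 0" "\<exists>\<theta>. universal_covering \<theta> \<nu>"
    and pb: "pullback f \<nu> = orb x1 a1 x2 a2 x3 a3" and x: "distinct [x1, x2, x3]"
    and cov: "covered k l m" "a1 dvd k" "a2 dvd l" "a3 dvd m"
    and less: "euler_char \<nu> < 1 / real k + 1 / real l + 1 / real m - 1"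
  shows "decomposable f \<or> (indecomposable f \<and> left_factor f (theta \<nu>))"
proof -
  have uc: "universal_covering (theta \<nu>) \<nu>"
    unfolding theta_def using \<nu>(2) by (rule someI_ex)
  then have r: "rational_function (theta \<nu>)" by (simp add: universal_covering_iff)
  then obtain N where N: "rational_of_degree N (theta \<nu>)" by (auto simp: rational_function_def)
  let ?\<nu>' = "orb x1 k x2 l x3 m"
  obtain \<theta>' where uc': "universal_covering \<theta>' ?\<nu>'" using cov(1) x unfolding covered_def by blast
  then obtain N' where N': "rational_of_degree N' \<theta>'" by (auto simp: rational_function_def universal_covering_iff)
  have e: "real N * euler_char \<nu> = 2" "real N' * euler_char ?\<nu>' = 2"
    using universal_covering_degree[OF uc N] universal_covering_degree[OF uc' N'] by auto
  have "euler_char \<nu> < euler_char ?\<nu>'" using less euler_char_orb[OF x] by simp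
  then have "real N' * euler_char \<nu> < real N * euler_char \<nu>"
    using e rational_of_degree_pos[OF N'] by (metis mult_strict_left_mono of_nat_0_less_iff less_le_trans zero_less_one)
  then have "N' < N" using \<nu>(1) by (simp add: mult_less_cancel_right)
  moreover have "pullback f \<nu> x dvd ?\<nu>' x" for x
    using cov(2-4) x unfolding pb by (auto simp: orb_def)
  ultimately show ?thesis
    using common_left_factor[OF f uc N uc' N'] decomposable_or_left_factor[OF f r] by metis
qed

section \<open>The cyclic, polyhedral and dihedral targets\<close>

locale pulled_back =
  fixes f :: "cp1 \<Rightarrow> cp1" and \<nu> :: "cp1 \<Rightarrow> nat" and d :: nat
    and x1 x2 x3 z1 z2 z3 :: cp1 and a1 a2 a3 k l m :: nat
  assumes f: "rational_of_degree d f"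
    and nu: "\<nu> = orb z1 k z2 l z3 m" and z: "distinct [z1, z2, z3]" and klm: "k \<ge> 1" "l \<ge> 1" "m \<ge> 1"
    and pb: "pullback f \<nu> = orb x1 a1 x2 a2 x3 a3" and x: "distinct [x1, x2, x3]"
    and a: "a1 \<ge> 1" "a2 \<ge> 1" "a3 = 1 \<or> spherical a1 a2 a3"
    and sig: "signature (pullback f \<nu>) \<noteq> signature \<nu>"
begin

lemma orbifold_nu: "orbifold \<nu>"
  unfolding nu using klm by (rule orbifold_orb)

lemma rational_f: "rational_function f"
  using f by (rule rational_of_degree_imp_rational)

lemma pb_at: "pullback f \<nu> x1 = a1" "pullback f \<nu> x2 = a2" "pullback f \<nu> x3 = a3"
  using x unfolding pb by (auto simp: orb_def)

abbreviation I :: "cp1 \<Rightarrow> cp1 \<Rightarrow> int" where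
  "I z x \<equiv> if f x = z then int (local_degree f x) else 0"

lemma congruence: "int (\<nu> z) dvd int d - (I z x1 + I z x2 + I z x3)"
  by (rule fibre_congruence[OF f orbifold_nu x]) (auto simp: pb orb_def)

lemma sig_neq: "filter_mset (\<lambda>n. n > 1) {#a1, a2, a3#} \<noteq> filter_mset (\<lambda>n. n > 1) {#k, l, m#}"
  using sig unfolding pb signature_orb[OF x] unfolding nu signature_orb[OF z] .

lemma pb_cases: "pullback f \<nu> x dvd k \<or> pullback f \<nu> x dvd l \<or> pullback f \<nu> x dvd m"
  using pullback_dvd[of f \<nu> x] unfolding nu orb_def[of _ _ _ _ _ _ "f x"]
  by (auto split: if_splits)

lemma pb_dvd: "a1 dvd k \<or> a1 dvd l \<or> a1 dvd m" "a2 dvd k \<or> a2 dvd l \<or> a2 dvd m" "a3 dvd k \<or> a3 dvd l \<or> a3 dvd m"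
  using pb_cases[of x1] pb_cases[of x2] pb_cases[of x3] unfolding pb_at by auto

lemma conclude:
  assumes "euler_char \<nu> > 0" "\<exists>\<theta>. universal_covering \<theta> \<nu>"
    and "covered k' l' m'" "a1 dvd k'" "a2 dvd l'" "a3 dvd m'"
    and "1 / real k + 1 / real l + 1 / real m < 1 / real k' + 1 / real l' + 1 / real m'"
  shows "decomposable f \<or> (indecomposable f \<and> left_factor f (theta \<nu>))"
proof (rule left_factor_of_dominating[OF rational_f assms(1,2) pb x assms(3-6)])
  show "euler_char \<nu> < 1 / real k' + 1 / real l' + 1 / real m' - 1"
    using assms(7) euler_char_orb[OF z, of k l m] by (simp flip: nu)
qed

text \<open>Subtracting the fibre congruences over the two ramified points eliminates d. The indices
  of the pullback become orders of three elements of Z/k with sum zero, which leaves (a,a) with a a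
  divisor of k, proper by the signatures.\<close>

lemma cyclic_case:
  assumes "m = 1" "l = k" and u: "euler_char \<nu> > 0" "\<exists>\<theta>. universal_covering \<theta> \<nu>"
  shows "decomposable f \<or> (indecomposable f \<and> left_factor f (theta \<nu>))"
proof -
  \<comment> \<open>The local degree, counted positively over z1 and negatively over z2; the sign
    does not affect orders modulo k.\<close>
  define E where "E = (\<lambda>x. I z1 x - I z2 x)"
  have nz: "\<nu> z1 = k" "\<nu> z2 = k" using z assms by (auto simp: nu orb_def)
  have "int k dvd (int d - (I z2 x1 + I z2 x2 + I z2 x3)) - (int d - (I z1 x1 + I z1 x2 + I z1 x3))"
    using congruence[of z1] congruence[of z2] unfolding nz by (rule dvd_diff[rotated])
  also have "\<dots> = E x1 + E x2 + E x3" by (simp add: E_def)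
  finally have sum: "int k dvd E x1 + E x2 + E x3" .
  have iff: "int (pullback f \<nu> x) dvd j \<longleftrightarrow> int k dvd j * E x" for x j
  proof -
    consider "f x = z1" | "f x = z2" | "f x \<noteq> z1" "f x \<noteq> z2" by blast
    then show ?thesis
    proof cases
      case 1
      then have "E x = int (local_degree f x)" "\<nu> (f x) = k" using z nz by (auto simp: E_def)
      then show ?thesis using pullback_dvd_iff[OF orbifold_nu, of f x j] by simp
    next
      case 2
      then have "E x = - int (local_degree f x)" "\<nu> (f x) = k" using z nz by (auto simp: E_def)
      then show ?thesis using pullback_dvd_iff[OF orbifold_nu, of f x j] by simp
    next
      case 3
      then have "E x = 0" "\<nu> (f x) = 1" using assms(1) by (auto simp: E_def nu orb_def)
      then show ?thesis using pullback_dvd_iff[OF orbifold_nu, of f x j] by simp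
    qed
  qed
  note o = orders_sum_zero[OF iff[of x1, unfolded pb_at] iff[of x2, unfolded pb_at] iff[of x3, unfolded pb_at] sum]
  have a3: "a3 = 1" using o(1) a(3) by blast
  then have eq: "a1 = a2" by (rule o(2))
  have "a1 dvd k" using pb_dvd(1) assms(1,2) by auto
  then have "a1 \<le> k" using klm by (intro dvd_imp_le) auto
  moreover have "a1 \<noteq> k" using sig_neq a3 eq assms by auto
  ultimately have "a1 < k" by simp
  then have "1 / real k < 1 / real a1" using a(1) by (simp add: frac_less2)
  then show ?thesis
    using conclude[OF u covered_cyclic[OF a(1)]] assms a3 eq by simp
qed

lemma polyhedral_case:
  assumes "k = 2" "l = 3" "m \<in> {3, 4, 5}" and u: "euler_char \<nu> > 0" "\<exists>\<theta>. universal_covering \<theta> \<nu>"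
  shows "decomposable f \<or> (indecomposable f \<and> left_factor f (theta \<nu>))"
proof -
  have small: "i \<in> {1, 2, 3} \<or> i = 4 \<and> m = 4 \<or> i = 5 \<and> m = 5" if "i dvd k \<or> i dvd l \<or> i dvd m" for i
  proof -
    have "i > 0" using that assms by (auto intro: Nat.gr0I)
    moreover have "i \<le> 5" using that assms by (auto dest: dvd_imp_le)
    ultimately have "i \<in> {1, 2, 3, 4, 5}" by auto
    then show ?thesis using that assms by auto
  qed
  note s = small[OF pb_dvd(1)] small[OF pb_dvd(2)] small[OF pb_dvd(3)]
  show ?thesis
  proof (cases "a3 = 1")
    case True
    have gcds: "gcd (3::nat) 4 = 1" "gcd (4::nat) 3 = 1" "gcd (3::nat) 5 = 1" "gcd (5::nat) 3 = 1"
      by (simp_all add: gcd_non_0_nat)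
    have "lcm a1 a2 \<ge> 1" using a(1,2) by (simp add: Suc_le_eq lcm_pos_nat)
    \<comment> \<open>The largest possible least common multiples are 6, 12, 15 for m = 3, 4, 5.
      They give Euler characteristics 1/3, 1/6, 2/15 against 1/6, 1/12, 1/30.\<close>
    moreover have "1 / real k + 1 / real l + 1 / real m < 2 / real (lcm a1 a2) + 1"
      using s(1,2) assms gcds by (auto simp: lcm_nat_def)
    ultimately show ?thesis
      using conclude[OF u covered_cyclic] True by simp
  next
    case False
    then have sp: "spherical a1 a2 a3" using a by blast
    then consider "a1 = 2" "a2 = 2" "a3 \<ge> 2" | "a1 = 2" "a2 = 3" "a3 \<in> {3, 4, 5}"
      by (auto simp: spherical_def)
    then have "1 / real k + 1 / real l + 1 / real m < 1 / real a1 + 1 / real a2 + 1 / real a3"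
    proof cases
      case 1
      then have "a3 \<in> {2, 3, 4, 5}" using s(3) by auto
      then show ?thesis using 1 assms by auto
    next
      case 2
      \<comment> \<open>Together with divisibility this leaves a3 = 3 < m, since 4 and 5 can occur
        only as m itself.\<close>
      have "a3 \<noteq> m" using sig_neq 2 assms(1,2) by auto
      then show ?thesis using 2 s(3) assms by auto
    qed
    then show ?thesis using conclude[OF u spherical_covered[OF sp]] by simp
  qed
qed

text \<open>Here the Euler characteristic of the target is 1/m with m unbounded, so parity of local
  degrees over z1 and z2 has to be exploited. \<open>b\<close> marks the points over them with odd
  local degree, which are those that keep index 2.\<close>

lemma dihedral_case:
  assumes "k = 2" "l = 2" "m \<ge> 2" and u: "euler_char \<nu> > 0" "\<exists>\<theta>. universal_covering \<theta> \<nu>"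
  shows "decomposable f \<or> (indecomposable f \<and> left_factor f (theta \<nu>))"
proof -
  have nz: "\<nu> z1 = 2" "\<nu> z2 = 2" "\<nu> z3 = m" using z assms by (auto simp: nu orb_def)
  define b where "b = (\<lambda>x. (f x = z1 \<or> f x = z2) \<and> pullback f \<nu> x = 2)"
  have two: "pullback f \<nu> x = (if even (local_degree f x) then 1 else 2)" if "f x = z1 \<or> f x = z2" for x
  proof -
    have "\<nu> (f x) = 2" using that nz by auto
    then have "pullback f \<nu> x dvd 2" "int (pullback f \<nu> x) dvd 1 \<longleftrightarrow> even (local_degree f x)"
      using pullback_dvd[of f \<nu> x] pullback_dvd_iff[OF orbifold_nu, of f x 1] by auto
    moreover from this(1) have "pullback f \<nu> x \<le> 2" by (rule dvd_imp_le) simp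
    moreover have "pullback f \<nu> x \<ge> 1" by (rule pullback_pos[OF orbifold_nu])
    ultimately show ?thesis by (cases "pullback f \<nu> x = 1") auto
  qed
  have odd_iff: "odd (I z1 x + I z2 x) \<longleftrightarrow> b x" for x
    using two[of x] z by (auto simp: b_def)
  have nb: "f x = z3 \<and> pullback f \<nu> x dvd m \<or> pullback f \<nu> x = 1" if "\<not> b x" for x
  proof (cases "f x = z1 \<or> f x = z2")
    case True
    then show ?thesis using two[of x] that by (auto simp: b_def)
  next
    case False
    then show ?thesis using pullback_dvd[of f \<nu> x] nz(3) by (cases "f x = z3") (auto simp: nu orb_def)
  qed
  have nb': "pullback f \<nu> x dvd m" if "\<not> b x" for x using nb[OF that] by auto
  \<comment> \<open>Over z1 and over z2 the contributions of the three points are congruent to d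
    modulo 2. Their total is therefore even, and an even number of the three points satisfies
    \<open>b\<close>.\<close>
  have "even (int d - (I z1 x1 + I z1 x2 + I z1 x3))" "even (int d - (I z2 x1 + I z2 x2 + I z2 x3))"
    using congruence[of z1] congruence[of z2] unfolding nz by simp_all
  moreover have "even ((p1 + q1) + (p2 + q2) + (p3 + q3))"
    if "even (c - (p1 + p2 + p3))" "even (c - (q1 + q2 + q3))" for c p1 p2 p3 q1 q2 q3 :: int
    using that by presburger
  ultimately have "even ((I z1 x1 + I z2 x1) + (I z1 x2 + I z2 x2) + (I z1 x3 + I z2 x3))" by blast
  moreover have "odd p1 \<longleftrightarrow> (odd p2 \<longleftrightarrow> \<not> odd p3)" if "even (p1 + p2 + p3)" for p1 p2 p3 :: int
    using that by presburger
  ultimately have par_b: "b x1 \<longleftrightarrow> (b x2 \<longleftrightarrow> \<not> b x3)"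
    unfolding odd_iff[symmetric] by blast
  have ba: "b x1 \<Longrightarrow> a1 = 2" "b x2 \<Longrightarrow> a2 = 2" "b x3 \<Longrightarrow> a3 = 2"
    unfolding b_def pb_at by auto
  show ?thesis
  proof (cases "a3 = 1")
    case True
    then have b12: "b x1 \<longleftrightarrow> b x2" using par_b ba(3) by auto
    \<comment> \<open>By parity both points satisfy \<open>b\<close>, giving 2, or neither does,
      giving a divisor of m. Then 2/lcm is at least 2/m, more than 1/m.\<close>
    have "lcm a1 a2 \<le> m"
    proof (cases "b x1")
      case True
      then have "lcm a1 a2 = 2" using ba b12 by simp
      then show ?thesis using assms(3) by simp
    next
      case False
      then have "lcm a1 a2 dvd m" using nb'[of x1] nb'[of x2] b12 unfolding pb_at by simp
      then show ?thesis using assms(3) by (intro dvd_imp_le) auto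
    qed
    moreover have pos: "lcm a1 a2 \<ge> 1" using a(1,2) by (simp add: Suc_le_eq lcm_pos_nat)
    ultimately have "1 / real m \<le> 1 / real (lcm a1 a2)" by (simp add: frac_le)
    moreover have "1 / real (lcm a1 a2) > 0" using pos by simp
    moreover have "1 / real k + 1 / real l = 1" "1 / real 1 = 1" using assms(1,2) by simp_all
    ultimately have "1 / real k + 1 / real l + 1 / real m < 1 / real (lcm a1 a2) + 1 / real (lcm a1 a2) + 1 / real 1"
      by linarith
    then show ?thesis using conclude[OF u covered_cyclic[OF pos]] True by simp
  next
    case False
    then have sp: "spherical a1 a2 a3" using a by blast
    then consider "a1 = 2" "a2 = 2" "a3 \<ge> 2" | "a1 = 2" "a2 = 3" "a3 \<in> {3, 4, 5}"
      by (auto simp: spherical_def)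
    then have "1 / real k + 1 / real l + 1 / real m < 1 / real a1 + 1 / real a2 + 1 / real a3"
    proof cases
      case 1
      have "a3 \<le> m"
      proof (cases "b x3")
        case True
        then show ?thesis using ba assms(3) by simp
      next
        case False
        then show ?thesis using nb'[of x3] assms(3) unfolding pb_at by (intro dvd_imp_le) auto
      qed
      moreover have "a3 \<noteq> m" using sig_neq 1 assms by auto
      ultimately have "a3 < m" by simp
      then have "1 / real m < 1 / real a3" using 1 by (simp add: frac_less2)
      then show ?thesis using 1 assms by simp
    next
      case 2
      \<comment> \<open>Indices above 2 exclude \<open>b\<close> at x2 and x3, and parity then
        excludes it at x1. So all three points lie over z3, and every local degree over z1 is
        even.\<close>
      then have b: "\<not> b x1" "\<not> b x2" "\<not> b x3" using ba par_b by auto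
      then have fz: "f x1 = z3" "f x2 = z3" "f x3 = z3" and dm: "a1 dvd m" "a2 dvd m" "a3 dvd m"
        using nb[of x1] nb[of x2] nb[of x3] 2 unfolding pb_at by auto
      define e1 e2 e3 where "e1 = int (local_degree f x1)" and "e2 = int (local_degree f x2)" and "e3 = int (local_degree f x3)"
      have "z3 \<noteq> z1" using z by auto
      then have "even (int d)" using congruence[of z1] unfolding nz fz by simp
      moreover have "int m dvd int d - (e1 + e2 + e3)"
        using congruence[of z3] fz unfolding nz by (simp add: e1_def e2_def e3_def)
      moreover have "even m" using dm(1) 2 by simp
      ultimately have ev: "even (e1 + e2 + e3)"
        by (metis (no_types, lifting) dvd_diff_right_iff dvd_trans even_of_nat)
      have i: "int a1 dvd j \<longleftrightarrow> int m dvd j * e1" "int a2 dvd j \<longleftrightarrow> int m dvd j * e2" "int a3 dvd j \<longleftrightarrow> int m dvd j * e3" for j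
        using pullback_dvd_iff[OF orbifold_nu, of f _ j] fz nz pb_at unfolding e1_def e2_def e3_def by metis+
      have c: "\<not> int m dvd e1" "int m dvd 2 * e1" "int m dvd 3 * e2" "\<not> int m dvd 2 * e3" "int m dvd int a3 * e3"
        using i(1)[of 1] i(1)[of 2] i(2)[of 3] i(3)[of 2] i(3)[of "int a3"] 2 by auto
      have "int 2 dvd int m" "int 3 dvd int m" "int a3 dvd int m" using dm 2 by (simp_all only: int_dvd_int_iff)
      then have d: "(2::int) dvd int m" "(3::int) dvd int m" "int a3 dvd int m" by simp_all
      \<comment> \<open>As 2, 3 and a3 divide m, it is a multiple of 6, 12 or 30. At these minimal
        values 1/m equals 1/a3 - 1/6 and the Euler characteristics coincide. There the orders of e1,
        e2, e3 modulo m make exactly one of them odd (e1 for 6 and 30, e3 for 12), against the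
        evenness of their sum.\<close>
      from 2(3) consider "a3 = 3" | "a3 = 4" | "a3 = 5" by auto
      then show ?thesis
      proof cases
        case 1
        have "m \<noteq> 6"
        proof
          assume "m = 6"
          then have "\<not> 6 dvd e1" "6 dvd 2 * e1" "6 dvd 3 * e2" "6 dvd 3 * e3" using c 1 by simp_all
          then show False using ev by presburger
        qed
        moreover have "6 dvd int m" using d(1,2) by presburger
        ultimately have "m > 6" using assms(3) by (metis dvd_imp_le int_dvd_int_iff le_neq_implies_less not_numeral_le_zero of_nat_numeral gr0I)
        then have "1 / real m < 1 / real 6" by (intro frac_less2) auto
        then show ?thesis using 1 2 assms by simp
      next
        case cs: 2
        have "m \<noteq> 12"
        proof
          assume "m = 12"
          then have "12 dvd 2 * e1" "12 dvd 3 * e2" "12 dvd 4 * e3" "\<not> 12 dvd 2 * e3" using c cs by simp_all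
          then show False using ev by presburger
        qed
        moreover have "12 dvd int m" using d cs by simp presburger
        ultimately have "m > 12" using assms(3) by (metis dvd_imp_le int_dvd_int_iff le_neq_implies_less not_numeral_le_zero of_nat_numeral gr0I)
        then have "1 / real m < 1 / real 12" by (intro frac_less2) auto
        then show ?thesis using cs 2 assms by simp
      next
        case cs: 3
        have "m \<noteq> 30"
        proof
          assume "m = 30"
          then have "\<not> 30 dvd e1" "30 dvd 2 * e1" "30 dvd 3 * e2" "30 dvd 5 * e3" using c cs by simp_all
          then show False using ev by presburger
        qed
        moreover have "30 dvd int m" using d cs by simp presburger
        ultimately have "m > 30" using assms(3) by (metis dvd_imp_le int_dvd_int_iff le_neq_implies_less not_numeral_le_zero of_nat_numeral gr0I)
        then have "1 / real m < 1 / real 30" by (intro frac_less2) auto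
        then show ?thesis using cs 2 assms by simp
      qed
    qed
    then show ?thesis using conclude[OF u spherical_covered[OF sp]] by simp
  qed
qed

end

theorem corollary1p6:
  fixes f :: "cp1 \<Rightarrow> cp1" and \<nu> :: "cp1 \<Rightarrow> nat"
  assumes "rational_function f"
    and "good_orbifold \<nu>"
    and "euler_char (pullback f \<nu>) > 0"
    and "signature (pullback f \<nu>) \<noteq> signature \<nu>"
  shows "decomposable f \<or> (indecomposable f \<and> left_factor f (theta \<nu>))"
proof -
  have orb: "orbifold \<nu>" using assms(2) by (simp add: good_orbifold_def)
  obtain d where d: "rational_of_degree d f" using assms(1) by (auto simp: rational_function_def)
  have "real d * euler_char \<nu> > 0" using euler_char_pullback_le[OF d orb] assms(3) by simp
  then have pos: "euler_char \<nu> > 0" using rational_of_degree_pos[OF d] by (simp add: zero_less_mult_iff)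
  obtain z1 k z2 l z3 m where nudec: "distinct [z1, z2, z3]" "k \<ge> 1" "l \<ge> 1" "\<nu> = orb z1 k z2 l z3 m" "m = 1 \<or> spherical k l m"
    by (rule positive_orbifold_cases[OF orb pos])
  obtain x1 a1 x2 a2 x3 a3 where pb: "distinct [x1, x2, x3]" "a1 \<ge> 1" "a2 \<ge> 1"
    "pullback f \<nu> = orb x1 a1 x2 a2 x3 a3" "a3 = 1 \<or> spherical a1 a2 a3"
    by (rule positive_orbifold_cases[OF orbifold_pullback[OF assms(1) orb] assms(3)])
  have m: "m \<ge> 1" using nudec(5) by (auto simp: spherical_def)
  interpret pulled_back f \<nu> d x1 x2 x3 z1 z2 z3 a1 a2 a3 k l m
    by standard (use d nudec pb m assms(4) in auto)
  \<comment> \<open>Goodness of O enters here: with at most two ramified points the indices must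
    coincide for a universal covering to be available.\<close>
  have eq: "l = k" if "m = 1"
    using good_orb_cyclic[OF assms(2)[unfolded nudec(4) that] nudec(1-3)] by simp
  have cov: "covered k l m"
    using nudec(5) eq covered_cyclic[OF nudec(2)] spherical_covered by metis
  then have ex: "\<exists>\<theta>. universal_covering \<theta> \<nu>" using nudec(1) unfolding covered_def nudec(4) by blast
  from nudec(5) consider "m = 1" | "k = 2" "l = 2" "m \<ge> 2" | "k = 2" "l = 3" "m \<in> {3, 4, 5}"
    by (auto simp: spherical_def)
  then show ?thesis
    by cases (use cyclic_case dihedral_case polyhedral_case eq pos ex in blast)+
qed

end
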